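(* Fix integers $s\geq 3$ and $s+2\leq t\leq 2s-1$. For a suitable choice of positive constants $c_1,c_2,c_3$ (depending only on $s,t$), for all sufficiently large $n$ the random graph $G$ described below has, with positive probability, the property that every set $A$ of $a$ vertices induces a copy of $K_s$ in $G$. (The graph $G$ is always $K_t$-free.)
   Context: Let $\alpha=\alpha_{s,t}$ where, calling $(s,t)$ regular if either $s\geq 11$ and $s+3\leq t\leq 2s-4$ or $(s,t)\in\{(10,14),(10,15)\}$ and exceptional otherwise, $\alpha_{s,t}=\frac{(s-2)(t-s)(t+s-1)+2t-2s}{(2s-3)(t-s)(t+s-1)-2s+4}$ in the regular case and $\alpha_{s,t}=\frac{(s-2)(t-s)(s-1)+s-1}{(2s-3)(t-s)(s-1)+2s-t}$ in the exceptional case; let $\delta=s-(2s-1)\alpha$. Put $m=n^{\delta}(\log n)^{-c_1}$, $\gamma=n^{\alpha-1}(\log n)^{-c_2}$, $a=n^{\alpha}(\log n)^{c_3}$. Let $V=\{1,\dots,n\}$. Choose random subsets $S_1,\dots,S_m\subseteq V$ such that each $v\in V$ lies in each $S_i$ independently with probability $\gamma$; randomly partition each $S_i$ into $s$ parts $S_{i1},\dots,S_{is}$ (each element assigned independently to a uniformly random part). Let $G_0$ be the union over $i$ of the complete $s$-partite graphs with parts $S_{i1},\dots,S_{is}$, and $G_1$ obtained from $G_0$ by deleting every edge $xy$ for which there exist $i\neq j$ with $x,y\in S_i\cap S_j$. A colour configuration is a finite set of nodes with a family of colours, each a set of at least two nodes; its value is $v(W)=h-2+(b-1)\delta+(l-2)(\alpha-1)$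 ($h$ nodes, $b$ colours, $l$ node–colour incidences). The induced subconfiguration on a node subset $S$ has nodes $S$ and as colours those colours meeting $S$ in at least two nodes (restricted to $S$). A copy of $K_t$ in $G_1$ with vertex set $X$ is viewed as the configuration with nodes $X$ and colours $S_i\cap X$ for $i$ with $|S_i\cap X|\geq 2$; its core is an induced subconfiguration on at least two nodes of minimal value, with maximum number of nodes among such (ties broken arbitrarily). To obtain $G$: give each edge $e$ of $G_1$ an independent birthtime $\beta_e$ uniform in $[0,1]$. Processing edges in increasing order of birthtime, put $e$ into $E(G)$ unless there is a copy of $K_t$ in $G_1$ whose core contains $e$ (as an edge between two of its nodes), such that all edges of the core have birthtime at most $\beta_e$ and all of them other than $e$ already belong to $E(G)$. *)

theory Defs
  imports "HOL-Probability.Probability" "HOL-Library.Ramsey"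
begin

section \<open>The exponents\<close>

definition regular :: "nat \<Rightarrow> nat \<Rightarrow> bool" where
  "regular s t \<longleftrightarrow>
     (11 \<le> s \<and> s + 3 \<le> t \<and> t + 4 \<le> 2 * s) \<or> (s, t) \<in> {(10, 14), (10, 15)}"

definition alpha :: "nat \<Rightarrow> nat \<Rightarrow> real" where
  "alpha s t =
    (let \<sigma> = real s; \<tau> = real t in
      if regular s t
      then ((\<sigma> - 2) * (\<tau> - \<sigma>) * (\<tau> + \<sigma> - 1) + 2 * \<tau> - 2 * \<sigma>)
             / ((2 * \<sigma> - 3) * (\<tau> - \<sigma>) * (\<tau> + \<sigma> - 1) - 2 * \<sigma> + 4)
      else ((\<sigma> - 2) * (\<tau> - \<sigma>) * (\<sigma> - 1) + \<sigma> - 1)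
             / ((2 * \<sigma> - 3) * (\<tau> - \<sigma>) * (\<sigma> - 1) + 2 * \<sigma> - \<tau>))"

definition delta :: "nat \<Rightarrow> nat \<Rightarrow> real" where
  "delta s t = real s - (2 * real s - 1) * alpha s t"

text \<open>The number of random sets and the size of the vertex sets \<open>A\<close> are rounded to integers.\<close>

definition num_sets :: "nat \<Rightarrow> nat \<Rightarrow> real \<Rightarrow> nat \<Rightarrow> nat" where
  "num_sets s t c1 n = nat \<lfloor>real n powr delta s t * ln (real n) powr (- c1)\<rfloor>"

definition incl_prob :: "nat \<Rightarrow> nat \<Rightarrow> real \<Rightarrow> nat \<Rightarrow> real" where
  "incl_prob s t c2 n = real n powr (alpha s t - 1) * ln (real n) powr (- c2)"

definition target_size :: "nat \<Rightarrow> nat \<Rightarrow> real \<Rightarrow> nat \<Rightarrow> nat" where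
  "target_size s t c3 n = nat \<lceil>real n powr alpha s t * ln (real n) powr c3\<rceil>"


section \<open>Colour configurations and cores\<close>

text \<open>The colours form a family, so repeated colours count with multiplicity.\<close>

datatype 'a config = Config (nodes: "'a set") (colours: "'a set multiset")

definition wf_config :: "'a config \<Rightarrow> bool" where
  "wf_config W \<longleftrightarrow> finite (nodes W) \<and> (\<forall>c \<in># colours W. c \<subseteq> nodes W \<and> 2 \<le> card c)"

definition config_value :: "nat \<Rightarrow> nat \<Rightarrow> 'a config \<Rightarrow> real" where
  "config_value s t W =
     (let h = real (card (nodes W));
          b = real (size (colours W));
          l = real (\<Sum>c \<in># colours W. card c)
      in h - 2 + (b - 1) * delta s t + (l - 2) * (alpha s t - 1))"

definition induced_config :: "'a config \<Rightarrow> 'a set \<Rightarrow> 'a config" where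
  "induced_config W Y =
     Config Y (filter_mset (\<lambda>c. 2 \<le> card c) (image_mset (\<lambda>c. c \<inter> Y) (colours W)))"

definition induced_subconfigs :: "'a config \<Rightarrow> 'a config set" where
  "induced_subconfigs W = {induced_config W Y | Y. Y \<subseteq> nodes W \<and> 2 \<le> card Y}"

definition is_core :: "nat \<Rightarrow> nat \<Rightarrow> 'a config \<Rightarrow> 'a config \<Rightarrow> bool" where
  "is_core s t W C \<longleftrightarrow>
     C \<in> induced_subconfigs W \<and>
     (\<forall>D \<in> induced_subconfigs W. config_value s t C \<le> config_value s t D) \<and>
     (\<forall>D \<in> induced_subconfigs W.
        config_value s t D = config_value s t C \<longrightarrow> card (nodes D) \<le> card (nodes C))"

text \<open>An arbitrary rule for breaking ties between the candidates for the core.\<close>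

definition core_rule :: "nat \<Rightarrow> nat \<Rightarrow> ('a config \<Rightarrow> 'a config) \<Rightarrow> bool" where
  "core_rule s t \<kappa> \<longleftrightarrow>
     (\<forall>W. wf_config W \<and> 2 \<le> card (nodes W) \<longrightarrow> is_core s t W (\<kappa> W))"

definition copy_config :: "nat \<Rightarrow> (nat \<Rightarrow> 'a set) \<Rightarrow> 'a set \<Rightarrow> 'a config" where
  "copy_config m S X =
     Config X {# S i \<inter> X. i \<in># mset_set {i \<in> {1..m}. 2 \<le> card (S i \<inter> X)} #}"


section \<open>The graphs\<close>

text \<open>Graphs are given by their sets of edges, which are two-element sets of vertices.
  \<open>P i j\<close> is the \<open>j\<close>-th part of \<open>S i\<close>.\<close>

definition graph0 :: "nat \<Rightarrow> nat \<Rightarrow> (nat \<Rightarrow> nat \<Rightarrow> 'a set) \<Rightarrow> 'a set set" where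
  "graph0 s m P =
     {{x, y} | x y i j k. i \<in> {1..m} \<and> j \<in> {1..s} \<and> k \<in> {1..s} \<and> j \<noteq> k
                          \<and> x \<in> P i j \<and> y \<in> P i k}"

definition graph1 :: "nat \<Rightarrow> nat \<Rightarrow> (nat \<Rightarrow> 'a set) \<Rightarrow> (nat \<Rightarrow> nat \<Rightarrow> 'a set) \<Rightarrow> 'a set set" where
  "graph1 s m S P =
     graph0 s m P -
     {{x, y} | x y i j. i \<in> {1..m} \<and> j \<in> {1..m} \<and> i \<noteq> j
                        \<and> x \<in> S i \<inter> S j \<and> y \<in> S i \<inter> S j}"

definition clique_copy :: "nat \<Rightarrow> 'a set \<Rightarrow> 'a set set \<Rightarrow> 'a set \<Rightarrow> bool" where
  "clique_copy k V E X \<longleftrightarrow> X \<subseteq> V \<and> card X = k \<and> clique X E"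

text \<open>\<open>cores\<close> is the set of node sets of the cores of the copies of \<open>K\<^sub>t\<close>, and \<open>E\<close> the set of
  edges kept so far.\<close>

definition blocked :: "'a set set \<Rightarrow> ('a set \<Rightarrow> real) \<Rightarrow> 'a set set \<Rightarrow> 'a set \<Rightarrow> bool" where
  "blocked cores \<beta> E e \<longleftrightarrow>
     (\<exists>Y \<in> cores. e \<in> nsets Y 2 \<and> (\<forall>f \<in> nsets Y 2. \<beta> f \<le> \<beta> e \<and> (f \<noteq> e \<longrightarrow> f \<in> E)))"

definition process :: "'a set set \<Rightarrow> ('a set \<Rightarrow> real) \<Rightarrow> 'a set list \<Rightarrow> 'a set set" where
  "process cores \<beta> es = fold (\<lambda>e E. if blocked cores \<beta> E e then E else insert e E) es {}"

definition all_pairs :: "nat \<Rightarrow> nat set list" where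
  "all_pairs n = concat (map (\<lambda>y. map (\<lambda>x. {x, y}) [1..<y]) [1..<Suc n])"

definition core_sets ::
  "nat \<Rightarrow> nat \<Rightarrow> (nat config \<Rightarrow> nat config) \<Rightarrow> nat \<Rightarrow> nat \<Rightarrow> (nat \<Rightarrow> nat set)
     \<Rightarrow> nat set set \<Rightarrow> nat set set" where
  "core_sets s t \<kappa> n m S E1 =
     {nodes (\<kappa> (copy_config m S X)) | X. clique_copy t {1..n} E1 X}"

text \<open>Edges with equal birthtimes (an event of probability zero) are processed in the order of
  \<^term>\<open>all_pairs n\<close>, since \<^const>\<open>sort_key\<close> is stable.\<close>

definition final_graph ::
  "nat \<Rightarrow> nat \<Rightarrow> (nat config \<Rightarrow> nat config) \<Rightarrow> nat \<Rightarrow> nat \<Rightarrow> (nat \<Rightarrow> nat set)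
     \<Rightarrow> (nat \<Rightarrow> nat \<Rightarrow> nat set) \<Rightarrow> (nat set \<Rightarrow> real) \<Rightarrow> nat set set" where
  "final_graph s t \<kappa> n m S P \<beta> =
     (let E1 = graph1 s m S P
      in process (core_sets s t \<kappa> n m S E1) \<beta>
           (sort_key \<beta> (filter (\<lambda>e. e \<in> E1) (all_pairs n))))"


section \<open>The probability space\<close>

text \<open>An outcome consists of the memberships \<open>v \<in> S i\<close>, the labels \<open>j\<close> of the parts and the
  birthtimes, all independent.  Labels are drawn for all pairs \<open>(i, v)\<close> and birthtimes for all
  pairs of vertices, but only the labels with \<open>v \<in> S i\<close> and the birthtimes of the edges of
  \<open>G\<^sub>1\<close> are used.\<close>

type_synonym outcome = "(nat \<times> nat \<Rightarrow> bool) \<times> (nat \<times> nat \<Rightarrow> nat) \<times> (nat set \<Rightarrow> real)"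

definition outcomes :: "nat \<Rightarrow> nat \<Rightarrow> nat \<Rightarrow> real \<Rightarrow> outcome measure" where
  "outcomes s n m \<gamma> =
     (\<Pi>\<^sub>M p \<in> {1..m} \<times> {1..n}. measure_pmf (bernoulli_pmf \<gamma>)) \<Otimes>\<^sub>M
     ((\<Pi>\<^sub>M p \<in> {1..m} \<times> {1..n}. measure_pmf (pmf_of_set {1..s})) \<Otimes>\<^sub>M
      (\<Pi>\<^sub>M e \<in> nsets {1..n} 2. uniform_measure lborel {0..1}))"

definition random_set :: "nat \<Rightarrow> outcome \<Rightarrow> nat \<Rightarrow> nat set" where
  "random_set n \<omega> i = {v \<in> {1..n}. fst \<omega> (i, v)}"

definition random_part :: "nat \<Rightarrow> outcome \<Rightarrow> nat \<Rightarrow> nat \<Rightarrow> nat set" where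
  "random_part n \<omega> i j = {v \<in> random_set n \<omega> i. fst (snd \<omega>) (i, v) = j}"

definition random_graph ::
  "nat \<Rightarrow> nat \<Rightarrow> (nat config \<Rightarrow> nat config) \<Rightarrow> nat \<Rightarrow> nat \<Rightarrow> outcome \<Rightarrow> nat set set" where
  "random_graph s t \<kappa> n m \<omega> =
     final_graph s t \<kappa> n m (random_set n \<omega>) (random_part n \<omega>) (snd (snd \<omega>))"

abbreviation construction_space ::
  "nat \<Rightarrow> nat \<Rightarrow> real \<Rightarrow> real \<Rightarrow> nat \<Rightarrow> outcome measure" where
  "construction_space s t c1 c2 n \<equiv>
     outcomes s n (num_sets s t c1 n) (incl_prob s t c2 n)"

abbreviation construction_graph ::
  "nat \<Rightarrow> nat \<Rightarrow> (nat config \<Rightarrow> nat config) \<Rightarrow> real \<Rightarrow> nat \<Rightarrow> outcome \<Rightarrow> nat set set" where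
  "construction_graph s t \<kappa> c1 n \<equiv> random_graph s t \<kappa> n (num_sets s t c1 n)"

end

theory Submission
  imports Defs "HOL-Real_Asymp.Real_Asymp"
begin

text \<open>
  \<open>K\<^sub>t\<close>-freeness is built into the process: the edge of a core that is processed last is rejected.

  For the other half only the existence of one good outcome matters, because being good depends on
  finitely many memberships and labels, each of positive probability, and on which edges have
  birthtime below \<open>1 / 2\<close>.

  Every copy of \<open>K\<^sub>t\<close> in \<open>G\<^sub>1\<close> is a linear space on \<open>t\<close> points with lines of size at most \<open>s\<close>, and
  \<open>\<alpha>\<close> is the least exponent for which all of these have value at most \<open>0\<close>.  Hence a core has at
  least three nodes and non-positive value, and by minimality the expected number of extensions
  of any of its subconfigurations to the core is at most \<open>O(1 / log n)\<close>.  If an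
  edge were in more than polylogarithmically many cores, then a sunflower among them would give
  \<open>log n\<close> disjoint extensions of one kernel, which a first moment bound excludes.

  Given a set \<open>A\<close> of \<open>a\<close> vertices, about \<open>m (a \<gamma>)\<^sup>s\<close> of the sets \<open>S\<^sub>i\<close> meet \<open>A\<close> in a rainbow \<open>s\<close>-set, and
  exposing the sets one after another (in both orders) shows that few of these lose an
  edge to another \<open>S\<^sub>j\<close>.  The exceptional probability is so small that all \<open>A\<close> can be treated at once.

  Finally choose the early edges at random with polylogarithmically small density.  A copy of
  \<open>K\<^sub>s\<close> survives if its edges are early and all other edges in cores that it meets are late.  This
  happens with probability at least a negative power of \<open>log n\<close>, almost independently for the copies inside \<open>A\<close>, and there are
  many more than \<open>a log n\<close> of them.
\<close>

section \<open>The exponents\<close>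

text \<open>The exponent \<delta> is fixed by \<delta> + s(2\<alpha> - 1) = \<alpha>. With it,
  \<open>m * (a * \<gamma>) ^ s\<close> is n^\<alpha> times a power of log n, and since
  \<open>a\<close> carries (log n)^c3 and enters with exponent s \<ge> 3, this count exceeds
  \<open>a\<close> by any prescribed power of log n once c3 is large. The surplus pays for
  everything polylogarithmic: the number of cores at an edge, the density of early edges, and the
  factor log n in n^a = exp(a log n), which bounds the number of choices of A. Because of this last
  factor, a failure event belonging to one A needs probability at most about exp(-2 a log n). Second
  moments do not give that; hence exponential moments and union bounds over k-sets of rows. The
  obstacle is that damage to one random set depends on all the others. In a fixed order of exposure
  only earlier rows can hit a row, so the pairs to be avoided are already determined and conditional
  probabilities multiply; the reversed order accounts for the later rows. The determined pairs are
  few compared with a^2 because m \<gamma>^2 is at most n^(-w) with w > 0.\<close>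

locale exponents =
  fixes s t :: nat
  assumes s3: "3 \<le> s" and st: "s + 2 \<le> t" and ts: "t \<le> 2 * s - 1"
begin

abbreviation "\<alpha> \<equiv> alpha s t"
abbreviation "\<delta> \<equiv> delta s t"

text \<open>In these parameters, where \<open>1 - \<alpha> = w + u\<close> and \<open>\<delta> = w + 2 * u\<close>, a colour with \<open>j + 1\<close> nodes
  changes the value by \<open>- (j * (w + u) - u)\<close>.  For \<open>j = 1\<close> this is \<open>- w\<close>.\<close>

definition q :: real where "q = real t - real s"
definition w :: real where "w = (2 * real s - 3) * \<alpha> - (real s - 2)"
definition u :: real where "u = (real s - 1) * (1 - 2 * \<alpha>)"

section \<open>Inequalities between \<open>w\<close> and \<open>u\<close>\<close>

lemma q_bounds: "2 \<le> q" "q \<le> real s - 1" "real s \<ge> 3"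
  using s3 st ts by (auto simp: q_def)

lemma t_eq: "real t = real s + q" by (simp add: q_def)

text \<open>Clearing the denominator of \<alpha>: \<open>w\<close> and \<open>u\<close> become
  polynomials in \<open>s\<close> and \<open>q\<close> when multiplied by it, and the sign arguments
  below work with these polynomials.\<close>

lemma alpha_regular:
  assumes "regular s t"
  shows "((2 * real s - 3) * q * (2 * real s + q - 1) - 2 * real s + 4) * \<alpha> =
         (real s - 2) * q * (2 * real s + q - 1) + 2 * q"
    and "(2 * real s - 3) * q * (2 * real s + q - 1) - 2 * real s + 4 > 0"
proof -
  have "q * (2 * real s + q - 1) \<ge> 2 * (2 * real s + 2 - 1)"
    using q_bounds by (intro mult_mono) auto
  hence "(2 * real s - 3) * (q * (2 * real s + q - 1)) \<ge> 3 * (2 * (2 * real s + 2 - 1))"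
    using q_bounds by (intro mult_mono) auto
  thus pos: "(2 * real s - 3) * q * (2 * real s + q - 1) - 2 * real s + 4 > 0"
    using q_bounds by (simp add: algebra_simps)
  have eq: "\<alpha> = ((real s - 2) * q * (2 * real s + q - 1) + 2 * q) /
      ((2 * real s - 3) * q * (2 * real s + q - 1) - 2 * real s + 4)"
    using assms by (simp add: alpha_def Let_def q_def algebra_simps)
  show "((2 * real s - 3) * q * (2 * real s + q - 1) - 2 * real s + 4) * \<alpha> =
         (real s - 2) * q * (2 * real s + q - 1) + 2 * q"
    unfolding eq using pos by simp
qed

lemma alpha_exceptional:
  assumes "\<not> regular s t"
  shows "((2 * real s - 3) * q * (real s - 1) + real s - q) * \<alpha> =
         (real s - 2) * q * (real s - 1) + real s - 1"
    and "(2 * real s - 3) * q * (real s - 1) + real s - q > 0"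
proof -
  have "(2 * real s - 3) * q * (real s - 1) \<ge> 0"
    using q_bounds by (intro mult_nonneg_nonneg) auto
  thus pos: "(2 * real s - 3) * q * (real s - 1) + real s - q > 0"
    using q_bounds by linarith
  have eq: "\<alpha> = ((real s - 2) * q * (real s - 1) + real s - 1) /
      ((2 * real s - 3) * q * (real s - 1) + real s - q)"
    using assms by (simp add: alpha_def Let_def q_def algebra_simps)
  show "((2 * real s - 3) * q * (real s - 1) + real s - q) * \<alpha> =
         (real s - 2) * q * (real s - 1) + real s - 1"
    unfolding eq using pos by simp
qed

text \<open>This sign makes \<open>m * \<gamma> ^ 2\<close> tend to 0, so that a given pair rarely
  lies in a random set. Times the denominator of \<alpha>, \<open>w\<close> is a visibly positive
  polynomial.\<close>

lemma w_pos: "w > 0"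
proof (cases "regular s t")
  case True
  let ?D = "(2 * real s - 3) * q * (2 * real s + q - 1) - 2 * real s + 4"
  have "?D * w = (2 * real s - 3) * (?D * \<alpha>) - (real s - 2) * ?D"
    by (simp add: w_def algebra_simps)
  also have "\<dots> = 2 * ((2 * real s - 3) * q + (real s - 2)\<^sup>2)"
    unfolding alpha_regular(1)[OF True] by (simp add: power2_eq_square algebra_simps)
  also have "\<dots> > 0"
    using q_bounds by (intro mult_pos_pos add_pos_nonneg) auto
  finally show ?thesis using alpha_regular(2)[OF True] by (simp add: zero_less_mult_iff)
next
  case False
  let ?D = "(2 * real s - 3) * q * (real s - 1) + real s - q"
  have "?D * w = (2 * real s - 3) * (?D * \<alpha>) - (real s - 2) * ?D"
    by (simp add: w_def algebra_simps)
  also have "\<dots> = (real s - 2) * (q + real s - 1) + 1"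
    unfolding alpha_exceptional(1)[OF False] by (simp add: power2_eq_square algebra_simps)
  also have "\<dots> > 0"
    using q_bounds by (intro add_nonneg_pos mult_nonneg_nonneg) auto
  finally show ?thesis using alpha_exceptional(2)[OF False] by (simp add: zero_less_mult_iff)
qed

text \<open>Both \<open>?D * w\<close> and \<open>?D * u\<close> are polynomials in \<open>s\<close>
  and \<open>q\<close>; cross-multiplying eliminates \<alpha> and leaves the ratio of
  \<open>u\<close> to \<open>w\<close>.\<close>

lemma u_w_regular:
  assumes "regular s t"
  shows "2 * u * ((2 * real s - 3) * q + (real s - 2)\<^sup>2) =
         (real s - 1) * (q * (2 * real s + q - 5) - 2 * real s + 4) * w"
proof -
  let ?D = "(2 * real s - 3) * q * (2 * real s + q - 1) - 2 * real s + 4"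
  have a: "?D * w = 2 * ((2 * real s - 3) * q + (real s - 2)\<^sup>2)"
  proof -
    have "?D * w = (2 * real s - 3) * (?D * \<alpha>) - (real s - 2) * ?D"
      by (simp add: w_def algebra_simps)
    thus ?thesis
      unfolding alpha_regular(1)[OF assms] by (simp add: power2_eq_square algebra_simps)
  qed
  have b: "?D * u = (real s - 1) * (q * (2 * real s + q - 5) - 2 * real s + 4)"
  proof -
    have "?D * u = (real s - 1) * (?D - 2 * (?D * \<alpha>))"
      by (simp add: u_def algebra_simps)
    thus ?thesis
      unfolding alpha_regular(1)[OF assms] by (simp add: power2_eq_square algebra_simps)
  qed
  have "u * (?D * w) = w * (?D * u)" by simp
  thus ?thesis unfolding a b by (simp add: algebra_simps)
qed

lemma u_w_exceptional:
  assumes "\<not> regular s t"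
  shows "2 * u * ((real s - 2) * (q + real s - 1) + 1) =
         2 * (real s - 1) * (real s - 2) * (q - 1) * w"
proof -
  let ?D = "(2 * real s - 3) * q * (real s - 1) + real s - q"
  have a: "?D * w = (real s - 2) * (q + real s - 1) + 1"
  proof -
    have "?D * w = (2 * real s - 3) * (?D * \<alpha>) - (real s - 2) * ?D"
      by (simp add: w_def algebra_simps)
    thus ?thesis
      unfolding alpha_exceptional(1)[OF assms] by (simp add: power2_eq_square algebra_simps)
  qed
  have b: "?D * u = (real s - 1) * (real s - 2) * (q - 1)"
  proof -
    have "?D * u = (real s - 1) * (?D - 2 * (?D * \<alpha>))"
      by (simp add: u_def algebra_simps)
    thus ?thesis
      unfolding alpha_exceptional(1)[OF assms] by (simp add: power2_eq_square algebra_simps)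
  qed
  have "u * (?D * w) = w * (?D * u)" by simp
  thus ?thesis unfolding a b by (simp add: algebra_simps)
qed

text \<open>The sign of this cubic decides which of the two formulas for \<^const>\<open>alpha\<close> is larger.\<close>

lemma regular_sign:
  "regular s t \<Longrightarrow> (real s - 2) * (q\<^sup>2 - (real s - 1) * q + 2 * (real s - 1)) + q \<le> 0"
  "\<not> regular s t \<Longrightarrow> (real s - 2) * (q\<^sup>2 - (real s - 1) * q + 2 * (real s - 1)) + q \<ge> 0"
proof -
  assume r: "regular s t"
  show "(real s - 2) * (q\<^sup>2 - (real s - 1) * q + 2 * (real s - 1)) + q \<le> 0"
  proof (cases "11 \<le> s \<and> s + 3 \<le> t \<and> t + 4 \<le> 2 * s")
    case True
    hence q: "3 \<le> q" "q \<le> real s - 4" "real s \<ge> 11" by (auto simp: q_def)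
    \<comment> \<open>The quadratic equals \<open>(q - 3) * (q - (s - 4)) + 10 - s\<close>. This is
      where the bounds 11, \<open>s + 3\<close> and \<open>2 * s - 4\<close> of the regular range
      come from.\<close>
    have "(q - 3) * (q - (real s - 4)) \<le> 0"
      using q by (intro mult_nonneg_nonpos) auto
    hence "q\<^sup>2 - (real s - 1) * q + 2 * (real s - 1) \<le> 10 - real s"
      by (simp add: power2_eq_square algebra_simps)
    hence "(real s - 2) * (q\<^sup>2 - (real s - 1) * q + 2 * (real s - 1)) \<le> (real s - 2) * (-1)"
      using q by (intro mult_left_mono) auto
    thus ?thesis using q by (smt (verit) mult_minus_right mult_1_right)
  next
    case False
    hence "(s, t) \<in> {(10, 14), (10, 15)}" using r by (auto simp: regular_def)
    thus ?thesis by (auto simp: q_def)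
  qed
next
  assume r: "\<not> regular s t"
  \<comment> \<open>The discriminant in \<open>q\<close> is \<open>(s - 1) * (s - 9)\<close>: there
    is no negative value for \<open>s\<close> up to 9, and for \<open>s = 10\<close> the roots are 3
    and 6, which leaves \<open>q = 4\<close> and \<open>q = 5\<close>.\<close>
  have "q\<^sup>2 - (real s - 1) * q + 2 * (real s - 1) \<ge> 0 \<or> s = 10 \<and> (t = 14 \<or> t = 15)"
  proof (cases "s \<le> 10")
    case True
    then have "s \<in> {3,4,5,6,7,8,9,10}" using s3 by auto
    moreover have "t \<in> (\<lambda>k. s + k) ` {2..9}"
      using True st ts by (auto simp: image_iff intro!: bexI[of _ "t - s"])
    hence "t \<in> {s+2,s+3,s+4,s+5,s+6,s+7,s+8,s+9}"
      by (auto simp: numeral_eq_Suc atLeastAtMost_iff le_Suc_eq)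
    ultimately show ?thesis using ts by (auto simp: q_def power2_eq_square)
  next
    case False
    hence "t = s + 2 \<or> t + 3 = 2 * s \<or> t + 2 = 2 * s \<or> t + 1 = 2 * s"
      using r s3 st ts by (auto simp: regular_def)
    hence q: "q = 2 \<or> real s = q + 3 \<or> real s = q + 2 \<or> real s = q + 1"
      by (auto simp: q_def)
    have "real s > 10" using False by simp
    with q have "q\<^sup>2 - (real s - 1) * q + 2 * (real s - 1) \<ge> 0"
      by (elim disjE) (simp_all add: power2_eq_square algebra_simps)
    thus ?thesis ..
  qed
  hence "q\<^sup>2 - (real s - 1) * q + 2 * (real s - 1) \<ge> 0"
    using r by (auto simp: regular_def)
  thus "(real s - 2) * (q\<^sup>2 - (real s - 1) * q + 2 * (real s - 1)) + q \<ge> 0"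
    using q_bounds by (intro add_nonneg_nonneg[OF mult_nonneg_nonneg]) auto
qed

text \<open>By \<open>u_w_regular\<close> the gap is \<open>- w\<close> times the cubic of
  \<open>regular_sign\<close>, up to a positive factor. It says that a line with
  \<open>q + 1 = t - s + 1\<close> nodes brings no gain over its pairs. In the exceptional case the
  sign is reversed.\<close>

lemma regular_u: "regular s t \<Longrightarrow> q * w \<le> 2 * u"
proof -
  assume r: "regular s t"
  let ?E = "(2 * real s - 3) * q + (real s - 2)\<^sup>2"
  have E: "?E > 0" using q_bounds by (intro add_pos_nonneg) auto
  have "2 * u * ?E - q * w * ?E =
      - w * ((real s - 2) * (q\<^sup>2 - (real s - 1) * q + 2 * (real s - 1)) + q)"
    unfolding u_w_regular[OF r] by (simp add: power2_eq_square algebra_simps)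
  also have "\<dots> \<ge> 0" using regular_sign(1)[OF r] w_pos by (simp add: mult_nonneg_nonpos)
  finally have "(2 * u - q * w) * ?E \<ge> 0" by (simp add: algebra_simps)
  thus ?thesis using E by (simp add: zero_le_mult_iff)
qed

lemma exceptional_u: "\<not> regular s t \<Longrightarrow> 2 * u \<le> q * w"
proof -
  assume r: "\<not> regular s t"
  let ?E = "(real s - 2) * (q + real s - 1) + 1"
  have E: "?E > 0" using q_bounds by (intro add_nonneg_pos mult_nonneg_nonneg) auto
  have "q * w * ?E - 2 * u * ?E =
      w * ((real s - 2) * (q\<^sup>2 - (real s - 1) * q + 2 * (real s - 1)) + q)"
    unfolding u_w_exceptional[OF r] by (simp add: power2_eq_square algebra_simps)
  also have "\<dots> \<ge> 0" using regular_sign(2)[OF r] w_pos by simp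
  finally have "(q * w - 2 * u) * ?E \<ge> 0" by (simp add: algebra_simps)
  thus ?thesis using E by (simp add: zero_le_mult_iff)
qed

text \<open>Lines with at most \<open>q\<close> nodes bring no gain over their pairs, except
  possibly for \<open>q = s - 1\<close>, that is \<open>t = 2 * s - 1\<close>.\<close>

lemma exceptional_u_lower:
  assumes r: "\<not> regular s t"
  shows "q \<le> real s - 2 \<Longrightarrow> (q - 1) * w \<le> 2 * u"
proof -
  assume q: "q \<le> real s - 2"
  let ?E = "(real s - 2) * (q + real s - 1) + 1"
  have E: "?E > 0" using q_bounds by (intro add_nonneg_pos mult_nonneg_nonneg) auto
  have "2 * u * ?E - (q - 1) * w * ?E =
      (q - 1) * w * ((real s - 2) * (real s - 1 - q) - 1)"
    unfolding u_w_exceptional[OF r] by (simp add: power2_eq_square algebra_simps)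
  moreover have "(real s - 2) * (real s - 1 - q) \<ge> 1 * 1"
    using q q_bounds by (intro mult_mono) auto
  hence "(q - 1) * w * ((real s - 2) * (real s - 1 - q) - 1) \<ge> 0"
    using q_bounds w_pos by (intro mult_nonneg_nonneg) auto
  ultimately have "(2 * u - (q - 1) * w) * ?E \<ge> 0" by (simp add: algebra_simps)
  thus ?thesis using E by (simp add: zero_le_mult_iff)
qed

text \<open>For \<open>t = 2 * s - 1\<close> the inequality of \<open>exceptional_u_lower\<close>
  fails, but only by a small multiple of \<open>w\<close>. The exact amount is needed in
  \<open>line_bound\<close>.\<close>

lemma exceptional_u_top:
  assumes r: "\<not> regular s t" and q: "q = real s - 1"
  shows "(real s - 2) * w - 2 * u \<ge> 0"
    and "((real s - 2) * w - 2 * u) * (2 * (real s - 1) * (real s - 2) + 1) = (real s - 2) * w"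
proof -
  have "2 * u * (2 * (real s - 1) * (real s - 2) + 1) = 2 * (real s - 1) * (real s - 2) * (real s - 2) * w"
    using u_w_exceptional[OF r] unfolding q by (simp add: algebra_simps)
  thus eq: "((real s - 2) * w - 2 * u) * (2 * (real s - 1) * (real s - 2) + 1) = (real s - 2) * w"
    by (simp add: algebra_simps)
  have "(real s - 2) * w \<ge> 0" using q_bounds w_pos by simp
  moreover have "2 * (real s - 1) * (real s - 2) + 1 > 0"
    using q_bounds by (intro add_nonneg_pos mult_nonneg_nonneg) auto
  ultimately show "(real s - 2) * w - 2 * u \<ge> 0"
    using eq by (smt (verit) mult_neg_pos)
qed

lemma alpha_pos: "\<alpha> > 0"
  using w_pos q_bounds unfolding w_def
  by (smt (verit) mult_nonneg_nonpos)

lemma alpha_less: "\<alpha> < 1 / 2"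
proof -
  have "u > 0"
  proof (cases "regular s t")
    case True
    have "0 < q * w" using q_bounds w_pos by simp
    thus ?thesis using regular_u[OF True] by linarith
  next
    case False
    let ?E = "(real s - 2) * (q + real s - 1) + 1"
    have E: "?E > 0" using q_bounds by (intro add_nonneg_pos mult_nonneg_nonneg) auto
    have "0 < 2 * u * ?E"
      unfolding u_w_exceptional[OF False] using q_bounds w_pos by (intro mult_pos_pos) auto
    thus ?thesis using E by (simp add: zero_less_mult_iff)
  qed
  thus ?thesis using q_bounds by (simp add: u_def zero_less_mult_iff)
qed

lemma u_pos: "u > 0"
  using alpha_less q_bounds by (simp add: u_def)

text \<open>A line of the largest possible size \<open>s\<close> never lowers the value compared
  with its pairs; this gives \<open>rhs_nonneg\<close>.\<close>

lemma u_le: "2 * u \<le> (real s - 1) * w"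
proof (cases "regular s t")
  case True
  let ?E = "(2 * real s - 3) * q + (real s - 2)\<^sup>2"
  have E: "?E > 0" using q_bounds by (intro add_pos_nonneg) auto
  have "(real s - 1) * w * ?E - 2 * u * ?E = (real s - 1) * w * (real s ^ 2 - 2 * real s + q * (2 - q))"
    unfolding u_w_regular[OF True] by (simp add: power2_eq_square algebra_simps)
  moreover have "q * (q - 2) \<le> (real s - 1) * (real s - 3)"
    using q_bounds by (intro mult_mono) auto
  hence "real s ^ 2 - 2 * real s + q * (2 - q) \<ge> 0"
    using q_bounds by (simp add: power2_eq_square algebra_simps)
  hence "(real s - 1) * w * (real s ^ 2 - 2 * real s + q * (2 - q)) \<ge> 0"
    using q_bounds w_pos by (intro mult_nonneg_nonneg) auto
  ultimately have "((real s - 1) * w - 2 * u) * ?E \<ge> 0" by (simp add: algebra_simps)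
  thus ?thesis using E by (simp add: zero_le_mult_iff)
next
  case False
  have "2 * u \<le> q * w" by (rule exceptional_u[OF False])
  also have "\<dots> \<le> (real s - 1) * w" using q_bounds w_pos by (intro mult_right_mono) auto
  finally show ?thesis .
qed

lemma one_minus_alpha: "1 - \<alpha> = w + u"
  by (simp add: w_def u_def algebra_simps)

lemma delta_eq: "\<delta> = w + 2 * u"
  by (simp add: delta_def w_def u_def algebra_simps)

text \<open>The equation \<open>rhs_eq\<close> says that the extremal configuration has value \<open>0\<close>: one colour of size \<open>s\<close>
  in the regular case, two colours of sizes \<open>s\<close> and \<open>t - s + 1\<close> sharing a node in the
  exceptional case, and colours of size \<open>2\<close> otherwise.\<close>

definition rhs :: real where
  "rhs = (if regular s t then (real s - 2) * ((real s - 1) * w - 2 * u)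
     else (real s - 2) * ((real s - 1) * w - 2 * u) + (q - 1) * (q * w - 2 * u))"

lemma rhs_eq: "2 * (real t - 2 - \<delta> + 2 * (1 - \<alpha>)) - w * real t * (real t - 1) = - rhs"
proof (cases "regular s t")
  case True
  note a = alpha_regular(1)[OF True]
  have "2 * (real t - 2 - \<delta> + 2 * (1 - \<alpha>)) - w * real t * (real t - 1) + rhs =
     - (((2 * real s - 3) * q * (2 * real s + q - 1) - 2 * real s + 4) * \<alpha>)
     + ((real s - 2) * q * (2 * real s + q - 1) + 2 * q)"
    using True unfolding rhs_def t_eq w_def u_def delta_def
    by (simp add: algebra_simps)
  thus ?thesis using a by linarith
next
  case False
  note a = alpha_exceptional(1)[OF False]
  have "2 * (real t - 2 - \<delta> + 2 * (1 - \<alpha>)) - w * real t * (real t - 1) + rhs =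
     2 * (- (((2 * real s - 3) * q * (real s - 1) + real s - q) * \<alpha>)
     + ((real s - 2) * q * (real s - 1) + real s - 1))"
    using False unfolding rhs_def t_eq w_def u_def delta_def
    by (simp add: algebra_simps)
  thus ?thesis unfolding a by simp
qed

text \<open>The case distinction in \<open>alpha\<close> makes \<open>rhs\<close> the larger of the
  two expressions, so later bounds may use either one without splitting into cases.\<close>

lemma rhs_ge:
  "rhs \<ge> (real s - 2) * ((real s - 1) * w - 2 * u)"
  "rhs \<ge> (real s - 2) * ((real s - 1) * w - 2 * u) + (q - 1) * (q * w - 2 * u)"
proof -
  have "regular s t \<Longrightarrow> (q - 1) * (q * w - 2 * u) \<le> 0"
    using regular_u q_bounds by (intro mult_nonneg_nonpos) auto
  moreover have "\<not> regular s t \<Longrightarrow> (q - 1) * (q * w - 2 * u) \<ge> 0"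
    using exceptional_u q_bounds by (intro mult_nonneg_nonneg) auto
  ultimately show
    "rhs \<ge> (real s - 2) * ((real s - 1) * w - 2 * u)"
    "rhs \<ge> (real s - 2) * ((real s - 1) * w - 2 * u) + (q - 1) * (q * w - 2 * u)"
    unfolding rhs_def by auto
qed

lemma rhs_nonneg: "rhs \<ge> 0"
proof -
  have "(real s - 2) * ((real s - 1) * w - 2 * u) \<ge> 0"
    using u_le q_bounds by (intro mult_nonneg_nonneg) auto
  thus ?thesis using rhs_ge(1) by linarith
qed

end

section \<open>Linear spaces have non-positive value\<close>

context exponents begin

text \<open>Replacing the pairs of nodes inside a set of \<open>j + 1\<close> nodes by a single colour changes the value
  by \<open>g j / 2\<close>.\<close>

definition g :: "real \<Rightarrow> real" where "g j = (j - 1) * (j * w - 2 * u)"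

text \<open>\<open>g\<close> is a quadratic with leading coefficient \<open>w > 0\<close>, hence
  convex: for a fixed sum \<open>j + r\<close> the total is largest at the ends of the range,
  \<open>j = s - 1\<close> and \<open>r = q\<close>.\<close>

lemma g_two_lines:
  assumes "j + r = real s + q - 1" "q \<le> j" "j \<le> real s - 1"
  shows "g j + g r \<le> rhs"
proof -
  have "g (real s - 1) + g q - (g j + g r) = 2 * w * (real s - 1 - j) * (j - q)"
  proof -
    have r: "r = real s + q - 1 - j" using assms by simp
    show ?thesis unfolding g_def r by (simp add: algebra_simps)
  qed
  also have "\<dots> \<ge> 0" using assms w_pos by (intro mult_nonneg_nonneg) auto
  finally have "g j + g r \<le> g (real s - 1) + g q" by simp
  also have "\<dots> \<le> rhs" using rhs_ge(2) by (simp add: g_def algebra_simps)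
  finally show ?thesis .
qed

lemma g_one_line:
  assumes "1 \<le> j" "j \<le> real s - 1"
  shows "g j \<le> rhs"
proof (cases "j * w \<le> 2 * u")
  case True
  hence "g j \<le> 0" using assms unfolding g_def by (intro mult_nonneg_nonpos) auto
  thus ?thesis using rhs_nonneg by linarith
next
  case False
  have "j * w \<le> (real s - 1) * w" using assms w_pos by (intro mult_right_mono) auto
  hence "g j \<le> (real s - 2) * ((real s - 1) * w - 2 * u)"
    using False assms unfolding g_def by (intro mult_mono) auto
  thus ?thesis using rhs_ge(1) by linarith
qed

text \<open>Here \<open>j + 1\<close> is the size of a largest line and \<open>r\<close> the number of points outside of it.  Every
  other line has at most \<open>min j r + 1\<close> points, and all but one of them lie outside, so that
  \<open>r * (r - 1)\<close> limits how many lines there are.\<close>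

lemma line_bound:
  fixes j r :: nat
  assumes j: "1 \<le> j" "real j \<le> real s - 1" and sum: "real j + real r = real s + q - 1"
  shows "g j + real r * (real r - 1) * max 0 (w - 2 * u / min (real j) (real r)) \<le> rhs"
proof -
  define M where "M = min (real j) (real r)"
  have rq: "real r \<ge> q" using j sum by linarith
  hence r2: "real r \<ge> 2" using q_bounds by linarith
  have M1: "M \<ge> 1" using j r2 by (auto simp: M_def)
  consider (nonpos) "w - 2 * u / M \<le> 0" | (small_r) "w - 2 * u / M > 0" "real r \<le> real j"
    | (small_j) "w - 2 * u / M > 0" "real j < real r" by linarith
  thus ?thesis unfolding M_def[symmetric]
  proof cases
    case nonpos
    thus "g j + real r * (real r - 1) * max 0 (w - 2 * u / M) \<le> rhs"
      using g_one_line[of "real j"] j by (simp add: max_def)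
  next
    case small_r
    hence M: "M = r" by (simp add: M_def)
    have "real r * (real r - 1) * (w - 2 * u / r) = g r"
      using r2 by (simp add: g_def field_simps)
    moreover have "g j + g r \<le> rhs"
      using sum j rq small_r by (intro g_two_lines) auto
    ultimately show "g j + real r * (real r - 1) * max 0 (w - 2 * u / M) \<le> rhs"
      using small_r unfolding M by (simp add: max_def)
  next
    case small_j
    hence M: "M = j" by (simp add: M_def)
    have jw: "real j * w > 2 * u" using small_j(1) j unfolding M by (simp add: field_simps)
    have nn: "real r * (real r - 1) \<ge> 0" using r2 by simp
    show "g j + real r * (real r - 1) * max 0 (w - 2 * u / M) \<le> rhs"
    proof (cases "q \<le> real j")
      case True
      have "2 * u / r \<le> 2 * u / j"
        using small_j j u_pos by (intro divide_left_mono) auto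
      hence "real r * (real r - 1) * (w - 2 * u / j) \<le> real r * (real r - 1) * (w - 2 * u / r)"
        using nn by (intro mult_left_mono) auto
      also have "\<dots> = g r" using r2 by (simp add: g_def field_simps)
      finally show ?thesis
        using small_j(1) g_two_lines[OF sum True j(2)] unfolding M by (simp add: max_def)
    next
      case False
      \<comment> \<open>A line with at most \<open>q\<close> nodes can gain only where
        \<open>exceptional_u_lower\<close> does not apply, which forces
        \<open>t = 2 * s - 1\<close>. Since the gain \<open>E\<close> is below \<open>w\<close>,
        only \<open>j = s - 2\<close> and hence \<open>r = s\<close> remain.\<close>
      have "q = real (t - s)" using st by (simp add: q_def)
      hence jq: "real j \<le> q - 1" using False by simp
      have nreg: "\<not> regular s t"
      proof
        assume "regular s t"
        hence "q * w \<le> 2 * u" by (rule regular_u)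
        moreover have "real j * w \<le> q * w" using False w_pos by simp
        ultimately show False using jw by linarith
      qed
      have "real j * w \<le> (q - 1) * w" using jq w_pos by simp
      hence "\<not> q \<le> real s - 2" using exceptional_u_lower[OF nreg] jw by linarith
      hence "real (2 * s) < real (t + 2)" by (simp add: q_def)
      hence "t + 1 = 2 * s" using ts s3 unfolding of_nat_less_iff by linarith
      hence "real (t + 1) = real (2 * s)" by (rule arg_cong)
      hence "q = real s - 1" by (simp add: q_def)
      note qs = this
      define E where "E = (real s - 2) * w - 2 * u"
      define Y where "Y = 2 * (real s - 1) * (real s - 2) + 1"
      have EY: "E * Y = (real s - 2) * w"
        using exceptional_u_top(2)[OF nreg qs] by (simp add: E_def Y_def)
      have Y: "Y > real s - 2" "Y \<ge> 1"
      proof -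
        define Z where "Z = (real s - 1) * (real s - 2)"
        have "Z \<ge> 1 * (real s - 2)"
          using q_bounds unfolding Z_def by (intro mult_right_mono) auto
        moreover have "Y = 2 * Z + 1" by (simp add: Y_def Z_def)
        ultimately show "Y > real s - 2" "Y \<ge> 1" using q_bounds by auto
      qed
      have E: "E = (real s - 2) * w / Y" using EY Y by (simp add: field_simps)
      have "(real s - 2) * w < Y * w" using Y(1) w_pos by (rule mult_strict_right_mono)
      hence Ew: "E < w" using Y(2) unfolding E by (simp add: pos_divide_less_eq mult.commute)
      have js: "real j = real s - 2"
      proof (rule ccontr)
        assume "real j \<noteq> real s - 2"
        moreover have "real (j + 2) \<le> real s" using jq qs by simp
        hence "j + 2 \<le> s" by (simp only: of_nat_le_iff)
        ultimately have "j + 3 \<le> s" by (cases "j + 2 = s") auto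
        hence "real j \<le> real s - 3" by linarith
        hence "real j * w \<le> (real s - 3) * w" using w_pos by simp
        also have "\<dots> = E - w + 2 * u" by (simp add: E_def algebra_simps)
        finally show False using Ew jw by linarith
      qed
      have rs: "real r = real s" using sum qs js by linarith
      have s2: "real s - 2 > 0" using q_bounds by linarith
      have "g j + real r * (real r - 1) * (w - 2 * u / j)
          = (real s - 3) * E + real s * (real s - 1) * (E / (real s - 2))"
      proof -
        have "w - 2 * u / (real s - 2) = E / (real s - 2)"
          using s2 by (simp add: E_def field_simps)
        thus ?thesis by (simp add: js rs g_def E_def)
      qed
      also have "\<dots> = ((real s - 3) * (real s - 2) + real s * (real s - 1)) * (w / Y)"
      proof -
        have "E / (real s - 2) = w / Y" "E = (real s - 2) * (w / Y)"
          unfolding E using s2 by simp_all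
        thus ?thesis by (simp only: ring_distribs mult.assoc)
      qed
      also have "\<dots> = (Y + 1) * (w / Y)"
        unfolding Y_def by (simp add: algebra_simps)
      also have "\<dots> \<le> 2 * w"
        using Y w_pos by (simp add: field_simps)
      also have "\<dots> \<le> 2 * (real s - 2) * (E + w)"
      proof -
        have "E \<ge> 0" using Y w_pos s2 unfolding E by simp
        hence "1 * w \<le> (real s - 2) * (E + w)" using q_bounds w_pos by (intro mult_mono) auto
        thus ?thesis unfolding mult.assoc by linarith
      qed
      also have "\<dots> \<le> rhs"
        using rhs_ge(2) unfolding qs E_def by (simp add: algebra_simps)
      finally show ?thesis using small_j(1) unfolding M by (simp add: max_def)
    qed
  qed
qed

lemma nsets2_card_real: "finite A \<Longrightarrow> 2 * real (card (nsets A 2)) = real (card A) * (real (card A) - 1)"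
proof -
  assume "finite A"
  have "even (card A * (card A - 1))" by (cases "even (card A)") auto
  hence "2 * card (nsets A 2) = card A * (card A - 1)"
    using \<open>finite A\<close> by (simp add: card_nsets choose_two)
  hence "real (2 * card (nsets A 2)) = real (card A * (card A - 1))" by (rule arg_cong)
  thus ?thesis by (cases "card A") (auto simp: algebra_simps)
qed

text \<open>Every pair lies in exactly one line, so the sum of \<open>k i * (k i - 1)\<close> is
  \<open>t * (t - 1)\<close>, and by \<open>rhs_eq\<close> twice the value is the sum of all
  \<open>g (k i - 1)\<close> minus \<open>rhs\<close>. A largest line \<open>L\<close> is split off.
  Every other line meets it in at most one point, so it leaves at least \<open>k i - 1\<close>
  points outside \<open>L\<close>, and these remainders share no pair; \<open>line_bound\<close>
  does the rest.\<close>

lemma linear_space_value: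
  fixes B :: "'i \<Rightarrow> 'a set"
  assumes fin: "finite J" "finite X" and X: "card X = t"
    and B: "\<And>i. i \<in> J \<Longrightarrow> B i \<subseteq> X" "\<And>i. i \<in> J \<Longrightarrow> 2 \<le> card (B i)" "\<And>i. i \<in> J \<Longrightarrow> card (B i) \<le> s"
    and cover: "\<And>x y. x \<in> X \<Longrightarrow> y \<in> X \<Longrightarrow> x \<noteq> y \<Longrightarrow> \<exists>i\<in>J. x \<in> B i \<and> y \<in> B i"
    and lin: "\<And>i j x y. i \<in> J \<Longrightarrow> j \<in> J \<Longrightarrow> x \<noteq> y \<Longrightarrow> {x, y} \<subseteq> B i \<Longrightarrow> {x, y} \<subseteq> B j \<Longrightarrow> i = j"
  shows "real t - 2 + (real (card J) - 1) * \<delta> + (real (\<Sum>i\<in>J. card (B i)) - 2) * (\<alpha> - 1) \<le> 0"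
proof -
  have finB: "finite (B i)" if "i \<in> J" for i using B(1)[OF that] fin(2) finite_subset by blast
  have disj: "nsets (B i) 2 \<inter> nsets (B j) 2 = {}" if "i \<in> J" "j \<in> J" "i \<noteq> j" for i j
  proof -
    have False if "e \<in> nsets (B i) 2" "e \<in> nsets (B j) 2" for e
    proof -
      from that(1) obtain x y where "e = {x, y}" "x \<noteq> y" by (auto elim: nsets2_E)
      thus False using that lin[OF \<open>i \<in> J\<close> \<open>j \<in> J\<close>] \<open>i \<noteq> j\<close> by auto
    qed
    thus ?thesis by blast
  qed
  define k where "k i = real (card (B i))" for i
  have sum_pairs: "(\<Sum>i\<in>J. k i * (k i - 1)) = real t * (real t - 1)"
  proof -
    have "nsets X 2 = (\<Union>i\<in>J. nsets (B i) 2)"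
    proof
      show "nsets X 2 \<subseteq> (\<Union>i\<in>J. nsets (B i) 2)"
      proof
        fix e assume e: "e \<in> nsets X 2"
        then obtain x y where xy: "e = {x, y}" "x \<noteq> y" by (auto elim: nsets2_E)
        with e have "x \<in> X" "y \<in> X" by auto
        from cover[OF this xy(2)] show "e \<in> (\<Union>i\<in>J. nsets (B i) 2)" using xy by auto
      qed
    qed (use B(1) nsets_mono in blast)
    hence "card (nsets X 2) = (\<Sum>i\<in>J. card (nsets (B i) 2))"
      using disj fin finB by (simp add: card_UN_disjoint finite_imp_finite_nsets)
    hence "2 * real (card (nsets X 2)) = (\<Sum>i\<in>J. 2 * real (card (nsets (B i) 2)))"
      by (simp add: sum_distrib_left)
    also have "\<dots> = (\<Sum>i\<in>J. k i * (k i - 1))"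
      unfolding k_def by (intro sum.cong refl nsets2_card_real finB)
    finally show ?thesis using nsets2_card_real[OF fin(2)] X by simp
  qed
  have "\<exists>x y. x \<in> X \<and> y \<in> X \<and> x \<noteq> y"
  proof -
    have "card X \<ge> 2" using X st by simp
    then obtain Y where "Y \<subseteq> X" "card Y = 2" by (meson obtain_subset_with_card_n)
    thus ?thesis by (auto simp: card_2_iff)
  qed
  hence "J \<noteq> {}" using cover by blast
  then obtain L where L: "L \<in> J" "\<And>i. i \<in> J \<Longrightarrow> card (B i) \<le> card (B L)"
  proof -
    have "Max ((\<lambda>i. card (B i)) ` J) \<in> (\<lambda>i. card (B i)) ` J"
      using \<open>J \<noteq> {}\<close> fin by (intro Max_in) auto
    then obtain L where "L \<in> J" "card (B L) = Max ((\<lambda>i. card (B i)) ` J)" by force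
    thus ?thesis using fin by (intro that[of L]) auto
  qed
  define j where "j = card (B L) - 1"
  define r where "r = card (X - B L)"
  have kL: "k L = real j + 1" using B(2)[OF L(1)] by (simp add: k_def j_def of_nat_diff)
  have r: "real r = real t - k L"
    unfolding r_def k_def using card_Diff_subset[OF finB[OF L(1)] B(1)[OF L(1)]]
      card_mono[OF fin(2) B(1)[OF L(1)]] X by (simp add: of_nat_diff)
  have j: "1 \<le> j" "real j \<le> real s - 1"
    using B(2,3)[OF L(1)] s3 by (auto simp: j_def)
  have sum: "real j + real r = real s + q - 1" using r kL t_eq by linarith
  define m where "m i = real (card (B i - B L))" for i
  have inter: "card (B i \<inter> B L) \<le> 1" if "i \<in> J" "i \<noteq> L" for i
  proof (rule ccontr)
    assume "\<not> card (B i \<inter> B L) \<le> 1"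
    hence "card (B i \<inter> B L) \<ge> 2" by simp
    then obtain Y where "Y \<subseteq> B i \<inter> B L" "card Y = 2" by (meson obtain_subset_with_card_n)
    thus False using lin[OF that(1) L(1)] that(2) by (auto simp: card_2_iff)
  qed
  have m_ge: "m i \<ge> k i - 1" if "i \<in> J" "i \<noteq> L" for i
  proof -
    have "card (B i) = card (B i \<inter> B L) + card (B i - B L)"
      using finB[OF that(1)] by (metis Int_Diff_Un card_Un_disjoint finite_Diff finite_Int Int_Diff_disjoint)
    thus ?thesis using inter[OF that] unfolding m_def k_def by simp
  qed
  have m_le: "m i \<le> real r" if "i \<in> J" for i
    unfolding m_def r_def using B(1)[OF that] fin by (intro of_nat_mono card_mono) auto
  have k2: "k i \<ge> 2" if "i \<in> J" for i using B(2)[OF that] by (simp add: k_def)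
  have outer: "(\<Sum>i\<in>J-{L}. (k i - 1) * (k i - 2)) \<le> real r * (real r - 1)"
  proof -
    have "(\<Sum>i\<in>J-{L}. (k i - 1) * (k i - 2)) \<le> (\<Sum>i\<in>J-{L}. m i * (m i - 1))"
      using m_ge k2 by (intro sum_mono mult_mono) (fastforce, fastforce, fastforce+)
    also have "\<dots> = (\<Sum>i\<in>J-{L}. 2 * real (card (nsets (B i - B L) 2)))"
      unfolding m_def using finB by (intro sum.cong refl nsets2_card_real[symmetric]) auto
    also have "\<dots> = 2 * real (card (\<Union>i\<in>J-{L}. nsets (B i - B L) 2))"
    proof (subst card_UN_disjoint)
      show "\<forall>i\<in>J-{L}. \<forall>i'\<in>J-{L}. i \<noteq> i' \<longrightarrow> nsets (B i - B L) 2 \<inter> nsets (B i' - B L) 2 = {}"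
      proof (intro ballI impI)
        fix i i' assume "i \<in> J - {L}" "i' \<in> J - {L}" "i \<noteq> i'"
        thus "nsets (B i - B L) 2 \<inter> nsets (B i' - B L) 2 = {}"
          using disj[of i i'] nsets_mono[of "B i - B L" "B i" 2] nsets_mono[of "B i' - B L" "B i'" 2]
          by blast
      qed
    qed (use fin finB in \<open>auto simp: sum_distrib_left finite_imp_finite_nsets\<close>)
    also have "\<dots> \<le> 2 * real (card (nsets (X - B L) 2))"
      using fin B(1) by (intro mult_left_mono of_nat_mono card_mono)
         (auto simp: finite_imp_finite_nsets nsets_def)
    also have "\<dots> = real r * (real r - 1)"
      unfolding r_def using fin by (intro nsets2_card_real) auto
    finally show ?thesis .
  qed
  define M where "M = min (real j) (real r)"
  define c where "c = max 0 (w - 2 * u / M)"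
  \<comment> \<open>With \<open>x = k i - 1\<close>, \<open>g x\<close> is
    \<open>x * (x - 1)\<close> times the increasing function \<open>w - 2 * u / x\<close>. Here
    \<open>x \<le> M\<close>, because the line is no larger than \<open>L\<close> and has at least
    \<open>x\<close> points outside it.\<close>
  have each: "g (k i - 1) \<le> (k i - 1) * (k i - 2) * c" if i: "i \<in> J" "i \<noteq> L" for i
  proof -
    define x where "x = k i - 1"
    have x1: "x \<ge> 1" using k2[OF i(1)] by (simp add: x_def)
    have "k i \<le> k L" using L(2)[OF i(1)] by (simp add: k_def)
    hence xM: "x \<le> M" using m_ge[OF i] m_le[OF i(1)] kL unfolding x_def M_def by auto
    have "2 * u / M \<le> 2 * u / x" using x1 xM u_pos by (intro divide_left_mono) auto
    hence "w - 2 * u / x \<le> c" unfolding c_def by auto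
    hence "x * (x - 1) * (w - 2 * u / x) \<le> x * (x - 1) * c"
      using x1 by (intro mult_left_mono) auto
    moreover have "x * (x - 1) * (w - 2 * u / x) = g x" using x1 by (simp add: g_def field_simps)
    ultimately show ?thesis by (simp add: x_def algebra_simps)
  qed
  have "(\<Sum>i\<in>J. g (k i - 1)) = g (real j) + (\<Sum>i\<in>J-{L}. g (k i - 1))"
    using fin L(1) kL by (simp add: sum.remove)
  also have "\<dots> \<le> g (real j) + (\<Sum>i\<in>J-{L}. (k i - 1) * (k i - 2) * c)"
    using each by (intro add_left_mono sum_mono) auto
  also have "\<dots> = g (real j) + (\<Sum>i\<in>J-{L}. (k i - 1) * (k i - 2)) * c"
    by (simp add: sum_distrib_right)
  also have "\<dots> \<le> g (real j) + real r * (real r - 1) * c"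
    using outer by (intro add_left_mono mult_right_mono) (auto simp: c_def)
  also have "\<dots> \<le> rhs" unfolding c_def M_def by (rule line_bound[OF j sum])
  finally have total: "(\<Sum>i\<in>J. g (k i - 1)) \<le> rhs" .
  have "g (k i - 1) = w * (k i * (k i - 1)) - 2 * (k i * (1 - \<alpha>) - \<delta>)" for i
    unfolding g_def one_minus_alpha delta_eq by (simp add: algebra_simps)
  hence "(\<Sum>i\<in>J. g (k i - 1)) = w * (\<Sum>i\<in>J. k i * (k i - 1)) - 2 * ((\<Sum>i\<in>J. k i) * (1 - \<alpha>) - card J * \<delta>)"
    by (simp add: sum_subtractf sum_distrib_left sum_distrib_right)
  with total sum_pairs have
    "w * (real t * (real t - 1)) - 2 * ((\<Sum>i\<in>J. k i) * (1 - \<alpha>) - card J * \<delta>) \<le> rhs" by simp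
  with rhs_eq have "2 * (real t - 2 - \<delta> + 2 * (1 - \<alpha>)) - 2 * ((\<Sum>i\<in>J. k i) * (1 - \<alpha>) - card J * \<delta>) \<le> 0"
    by (simp add: algebra_simps)
  moreover have "real (\<Sum>i\<in>J. card (B i)) = (\<Sum>i\<in>J. k i)" by (simp add: k_def)
  ultimately show ?thesis by (simp add: algebra_simps)
qed

end

section \<open>The process and the cores\<close>

lemma process_snoc:
  "process cores \<beta> (es @ [e]) =
     (if blocked cores \<beta> (process cores \<beta> es) e then process cores \<beta> es
      else insert e (process cores \<beta> es))"
  by (simp add: process_def)

lemma process_subset: "process cores \<beta> es \<subseteq> set es"
proof (induction es rule: rev_induct)
  case Nil
  then show ?case by (simp add: process_def)
next
  case (snoc e es)
  then show ?case by (auto simp: process_snoc)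
qed

text \<open>Ties are harmless: an edge listed before \<open>e\<close> has birthtime at most
  \<open>\<beta> e\<close>, which is exactly what \<open>blocked\<close> asks for.\<close>

lemma process_no_core:
  assumes "sorted (map \<beta> es)" "Y \<in> cores" "nsets Y 2 \<noteq> {}"
  shows "\<not> nsets Y 2 \<subseteq> process cores \<beta> es"
  using assms(1)
proof (induction es rule: rev_induct)
  case Nil
  then show ?case using assms(3) by (simp add: process_def)
next
  case (snoc e es)
  let ?E = "process cores \<beta> es"
  have IH: "\<not> nsets Y 2 \<subseteq> ?E" using snoc by (simp add: sorted_append)
  show ?case
  proof
    assume sub: "nsets Y 2 \<subseteq> process cores \<beta> (es @ [e])"
    hence nb: "\<not> blocked cores \<beta> ?E e" using IH by (auto simp: process_snoc)
    hence sub: "nsets Y 2 \<subseteq> insert e ?E" using sub by (simp add: process_snoc)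
    hence "e \<in> nsets Y 2" using IH by blast
    moreover have "\<beta> f \<le> \<beta> e \<and> (f \<noteq> e \<longrightarrow> f \<in> ?E)" if "f \<in> nsets Y 2" for f
    proof (cases "f = e")
      case False
      hence "f \<in> ?E" using sub that by blast
      moreover from this have "f \<in> set es" using process_subset by blast
      ultimately show ?thesis using snoc.prems by (auto simp: sorted_append)
    qed auto
    ultimately have "blocked cores \<beta> ?E e" using assms(2) unfolding blocked_def by blast
    thus False using nb by simp
  qed
qed

lemma process_keeps:
  assumes "e \<in> set es" "\<And>Y. Y \<in> cores \<Longrightarrow> e \<in> nsets Y 2 \<Longrightarrow> \<exists>f\<in>nsets Y 2. \<beta> e < \<beta> f"
  shows "e \<in> process cores \<beta> es"
  using assms(1)
proof (induction es rule: rev_induct)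
  case (snoc e' es)
  have "\<not> blocked cores \<beta> E e" for E
    using assms(2) unfolding blocked_def by (meson linorder_not_less)
  thus ?case using snoc by (auto simp: process_snoc)
qed simp

lemma set_all_pairs: "set (all_pairs n) = nsets {1..n} 2"
proof -
  have "set (all_pairs n) = {{x, y} | x y. 1 \<le> x \<and> x < y \<and> y \<le> n}"
    by (fastforce simp: all_pairs_def)
  also have "\<dots> = nsets {1..n} 2"
    by (subst ordered_nsets_2_eq) fastforce
  finally show ?thesis .
qed

section \<open>Colours, cores and the final graph for one fixed outcome of memberships and
  labels\<close>

locale layout = exponents +
  fixes n m :: nat and \<kappa> :: "nat config \<Rightarrow> nat config"
    and S :: "nat \<Rightarrow> nat set" and lab :: "nat \<Rightarrow> nat \<Rightarrow> nat"
  assumes core_rule: "core_rule s t \<kappa>"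
    and S_subset: "S i \<subseteq> {1..n}"
begin

definition P :: "nat \<Rightarrow> nat \<Rightarrow> nat set" where "P i j = {v \<in> S i. lab i v = j}"

definition E1 :: "nat set set" where "E1 = graph1 s m S P"

definition cores :: "nat set set" where "cores = core_sets s t \<kappa> n m S E1"

definition col :: "nat set \<Rightarrow> nat set" where
  "col Z = {i \<in> {1..m}. 2 \<le> card (S i \<inter> Z)}"

text \<open>The value of the subconfiguration induced on \<open>Z\<close>. It is the same for every
  copy \<open>X\<close> containing \<open>Z\<close>, since
  \<open>S i \<inter> X \<inter> Z = S i \<inter> Z\<close>.\<close>

definition cval :: "nat set \<Rightarrow> real" where
  "cval Z = real (card Z) - 2 + (real (card (col Z)) - 1) * \<delta> +
     (real (\<Sum>i\<in>col Z. card (S i \<inter> Z)) - 2) * (\<alpha> - 1)"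

lemma finite_S: "finite (S i)"
  using S_subset finite_subset by blast

lemma finite_col [simp]: "finite (col Z)"
  by (simp add: col_def)

lemma E1_E:
  assumes "e \<in> E1"
  obtains x y i where "i \<in> {1..m}" "e = {x, y}" "x \<noteq> y" "x \<in> S i" "y \<in> S i"
    "lab i x \<noteq> lab i y" "lab i x \<in> {1..s}" "lab i y \<in> {1..s}"
    "\<And>j. j \<in> {1..m} \<Longrightarrow> x \<in> S j \<Longrightarrow> y \<in> S j \<Longrightarrow> j = i"
proof -
  from assms obtain x y i j k where *: "e = {x, y}" "i \<in> {1..m}" "j \<in> {1..s}" "k \<in> {1..s}" "j \<noteq> k"
    "x \<in> P i j" "y \<in> P i k"
    unfolding E1_def graph1_def graph0_def by blast
  have xy: "x \<in> S i" "lab i x = j" "y \<in> S i" "lab i y = k" using *(6,7) by (simp_all add: P_def)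
  show ?thesis
  proof (rule that[of i x y])
    fix j' assume j': "j' \<in> {1..m}" "x \<in> S j'" "y \<in> S j'"
    show "j' = i"
    proof (rule ccontr)
      assume "j' \<noteq> i"
      hence "e \<in> {{x, y} | x y i j. i \<in> {1..m} \<and> j \<in> {1..m} \<and> i \<noteq> j
          \<and> x \<in> S i \<inter> S j \<and> y \<in> S i \<inter> S j}"
        using j' xy *(1,2) by blast
      thus False using assms unfolding E1_def graph1_def by blast
    qed
  qed (use * xy in auto)
qed

lemma E1_I:
  assumes "i \<in> {1..m}" "x \<in> S i" "y \<in> S i" "lab i x \<noteq> lab i y" "lab i x \<in> {1..s}" "lab i y \<in> {1..s}"
    "\<And>j. j \<in> {1..m} \<Longrightarrow> x \<in> S j \<Longrightarrow> y \<in> S j \<Longrightarrow> j = i"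
  shows "{x, y} \<in> E1"
proof -
  have "{x, y} \<in> graph0 s m P"
  proof -
    have "x \<in> P i (lab i x)" "y \<in> P i (lab i y)" using assms(2,3) by (simp_all add: P_def)
    thus ?thesis unfolding graph0_def using assms(1,4-6) by blast
  qed
  moreover have "{x, y} \<notin> {{x, y} | x y i j. i \<in> {1..m} \<and> j \<in> {1..m} \<and> i \<noteq> j
      \<and> x \<in> S i \<inter> S j \<and> y \<in> S i \<inter> S j}"
  proof
    assume "{x, y} \<in> {{x, y} | x y i j. i \<in> {1..m} \<and> j \<in> {1..m} \<and> i \<noteq> j
      \<and> x \<in> S i \<inter> S j \<and> y \<in> S i \<inter> S j}"
    then obtain x' y' i' j' where *: "{x, y} = {x', y'}" "i' \<in> {1..m}" "j' \<in> {1..m}" "i' \<noteq> j'"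
      "{x', y'} \<subseteq> S i' \<inter> S j'" by blast
    hence "x \<in> S i'" "y \<in> S i'" "x \<in> S j'" "y \<in> S j'" unfolding *(1)[symmetric] by simp_all
    thus False using *(2-4) assms(7) by metis
  qed
  ultimately show ?thesis unfolding E1_def graph1_def by (rule DiffI)
qed

lemma E1_subset: "E1 \<subseteq> nsets {1..n} 2"
proof
  fix e assume "e \<in> E1"
  then obtain x y i where "e = {x, y}" "x \<noteq> y" "x \<in> S i" "y \<in> S i" by (rule E1_E)
  thus "e \<in> nsets {1..n} 2" using S_subset[of i] by (auto simp del: One_nat_def)
qed

lemma edge_in_unique_colour:
  assumes "{x, y} \<in> E1" "i \<in> {1..m}" "j \<in> {1..m}" "{x, y} \<subseteq> S i" "{x, y} \<subseteq> S j"
  shows "i = j"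
proof -
  from assms(1) obtain x' y' k where *: "{x, y} = {x', y'}"
    "\<And>j. j \<in> {1..m} \<Longrightarrow> x' \<in> S j \<Longrightarrow> y' \<in> S j \<Longrightarrow> j = k"
    by (rule E1_E) (rule that, assumption+)
  have "{x', y'} \<subseteq> S i" "{x', y'} \<subseteq> S j" using assms(4,5) unfolding *(1) .
  thus ?thesis using *(2)[OF assms(2)] *(2)[OF assms(3)] by simp
qed

lemma edge_colour:
  assumes "{x, y} \<in> E1"
  obtains i where "i \<in> {1..m}" "x \<in> S i" "y \<in> S i" "lab i x \<noteq> lab i y" "lab i x \<in> {1..s}" "lab i y \<in> {1..s}"
proof -
  from assms obtain x' y' i where i: "i \<in> {1..m}" "{x, y} = {x', y'}" "x' \<in> S i" "y' \<in> S i"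
    "lab i x' \<noteq> lab i y'" "lab i x' \<in> {1..s}" "lab i y' \<in> {1..s}" by (rule E1_E)
  from i(2) have "x = x' \<and> y = y' \<or> x = y' \<and> y = x'" by (simp add: doubleton_eq_iff)
  thus ?thesis using i by (intro that[of i]) auto
qed

lemma two_elements: "finite A \<Longrightarrow> 2 \<le> card A \<longleftrightarrow> (\<exists>x y. x \<noteq> y \<and> {x, y} \<subseteq> A)"
proof
  assume "2 \<le> card A"
  then obtain B where "B \<subseteq> A" "card B = 2" by (meson obtain_subset_with_card_n)
  thus "\<exists>x y. x \<noteq> y \<and> {x, y} \<subseteq> A" by (auto simp: card_2_iff)
next
  assume "finite A" "\<exists>x y. x \<noteq> y \<and> {x, y} \<subseteq> A"
  then obtain x y where "x \<noteq> y" "{x, y} \<subseteq> A" by blast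
  thus "2 \<le> card A" using card_mono[OF \<open>finite A\<close>, of "{x, y}"] by simp
qed

lemma col_iff: "i \<in> col Z \<longleftrightarrow> i \<in> {1..m} \<and> (\<exists>x y. x \<noteq> y \<and> {x, y} \<subseteq> S i \<and> {x, y} \<subseteq> Z)"
  unfolding col_def using two_elements[of "S i \<inter> Z"] finite_S by auto

lemma col_mono: "Z \<subseteq> Z' \<Longrightarrow> col Z \<subseteq> col Z'"
  using order_trans[OF _ card_mono[of "S i \<inter> Z'" "S i \<inter> Z" for i]] finite_S
  unfolding col_def by blast

lemma config_value_induced:
  assumes "Z \<subseteq> X"
  shows "config_value s t (induced_config (copy_config m S X) Z) = cval Z"
proof -
  have *: "S i \<inter> X \<inter> Z = S i \<inter> Z" for i using assms by blast
  have "colours (induced_config (copy_config m S X) Z) =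
        image_mset (\<lambda>i. S i \<inter> Z) (mset_set {i \<in> {i \<in> {1..m}. 2 \<le> card (S i \<inter> X)}. 2 \<le> card (S i \<inter> Z)})"
    by (simp add: induced_config_def copy_config_def filter_mset_image_mset multiset.map_comp comp_def *
        filter_mset_mset_set del: mem_Collect_eq)
  also have "{i \<in> {i \<in> {1..m}. 2 \<le> card (S i \<inter> X)}. 2 \<le> card (S i \<inter> Z)} = col Z"
    using col_mono[OF assms] by (auto simp: col_def)
  finally have c: "colours (induced_config (copy_config m S X) Z) = image_mset (\<lambda>i. S i \<inter> Z) (mset_set (col Z))" .
  have "nodes (induced_config (copy_config m S X) Z) = Z" by (simp add: induced_config_def)
  thus ?thesis unfolding config_value_def Let_def c cval_def
    by (simp add: multiset.map_comp comp_def sum_unfold_sum_mset)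
qed

context
  fixes X assumes X: "clique_copy t {1..n} E1 X"
begin

lemma copy_edge: "x \<in> X \<Longrightarrow> y \<in> X \<Longrightarrow> x \<noteq> y \<Longrightarrow> {x, y} \<in> E1"
  using X by (auto simp: clique_copy_def clique_def)

lemma copy_finite: "finite X"
  using X finite_subset unfolding clique_copy_def by blast

lemma copy_card: "card X = t"
  using X by (simp add: clique_copy_def)

text \<open>An edge of G_1 lies in a single colour, so the traces of the colours on \<open>X\<close>
  are the lines of a linear space. Two points of a trace are adjacent and hence have different
  labels, which bounds a line by \<open>s\<close>.\<close>

lemma cval_copy: "cval X \<le> 0"
  unfolding cval_def copy_card
proof (rule linear_space_value[where X = X])
  fix i assume "i \<in> col X"
  hence i: "i \<in> {1..m}" by (simp add: col_def)
  have "inj_on (lab i) (S i \<inter> X) \<and> lab i ` (S i \<inter> X) \<subseteq> {1..s} \<or> card (S i \<inter> X) \<le> 1"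
  proof (rule disjCI)
    assume "\<not> card (S i \<inter> X) \<le> 1"
    hence c2: "2 \<le> card (S i \<inter> X)" by simp
    have *: "lab i x \<noteq> lab i y" "lab i x \<in> {1..s}"
      if xy: "x \<in> S i \<inter> X" "y \<in> S i \<inter> X" "x \<noteq> y" for x y
    proof -
      have e: "{x, y} \<in> E1" using copy_edge xy by auto
      then obtain i' where i': "i' \<in> {1..m}" "x \<in> S i'" "y \<in> S i'" "lab i' x \<noteq> lab i' y" "lab i' x \<in> {1..s}"
        by (rule edge_colour)
      have "i = i'" using edge_in_unique_colour[OF e i i'(1)] i' xy by auto
      thus "lab i x \<noteq> lab i y" "lab i x \<in> {1..s}" using i' by auto
    qed
    have "lab i x \<in> {1..s}" if "x \<in> S i \<inter> X" for x
    proof -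
      have "\<exists>y. y \<in> S i \<inter> X \<and> y \<noteq> x"
      proof (rule ccontr)
        assume "\<not> ?thesis"
        hence "S i \<inter> X \<subseteq> {x}" by blast
        thus False using c2 card_mono[of "{x}" "S i \<inter> X"] by simp
      qed
      thus ?thesis using *[OF that] by blast
    qed
    thus "inj_on (lab i) (S i \<inter> X) \<and> lab i ` (S i \<inter> X) \<subseteq> {1..s}"
      using *(1) unfolding inj_on_def by blast
  qed
  thus "card (S i \<inter> X) \<le> s"
    using card_inj_on_le[of "lab i" "S i \<inter> X" "{1..s}"] s3 by auto
next
  fix x y assume xy: "x \<in> X" "y \<in> X" "x \<noteq> y"
  from copy_edge[OF this] obtain i where "i \<in> {1..m}" "x \<in> S i" "y \<in> S i" by (rule edge_colour)
  hence "i \<in> col X" using xy by (auto simp: col_iff)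
  thus "\<exists>i\<in>col X. x \<in> S i \<inter> X \<and> y \<in> S i \<inter> X" using xy \<open>x \<in> S i\<close> \<open>y \<in> S i\<close> by blast
next
  fix i j x y assume ij: "i \<in> col X" "j \<in> col X" "x \<noteq> y" "{x, y} \<subseteq> S i \<inter> X" "{x, y} \<subseteq> S j \<inter> X"
  show "i = j"
    by (rule edge_in_unique_colour[of x y]) (use ij copy_edge in \<open>auto simp: col_def\<close>)
qed (auto simp: copy_finite copy_card col_def)

lemma col_pair:
  assumes "x \<in> X" "y \<in> X" "x \<noteq> y"
  obtains i where "col {x, y} = {i}" "{x, y} \<subseteq> S i"
proof -
  from copy_edge[OF assms] obtain i where i: "i \<in> {1..m}" "x \<in> S i" "y \<in> S i" by (rule edge_colour)
  have "col {x, y} = {i}"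
  proof (rule set_eqI)
    fix j
    have "j = i" if "j \<in> {1..m}" "{x, y} \<subseteq> S j"
      by (rule edge_in_unique_colour[OF copy_edge[OF assms]]) (use i that in auto)
    thus "j \<in> col {x, y} \<longleftrightarrow> j \<in> {i}" using i assms(3) by (auto simp: col_iff)
  qed
  thus ?thesis using that i by blast
qed

lemma cval_pair:
  assumes "x \<in> X" "y \<in> X" "x \<noteq> y"
  shows "cval {x, y} = 0"
proof -
  obtain i where "col {x, y} = {i}" "{x, y} \<subseteq> S i" using col_pair[OF assms] .
  moreover from this have "S i \<inter> {x, y} = {x, y}" by blast
  ultimately show ?thesis using assms(3) by (simp add: cval_def)
qed

text \<open>A pair has value 0 and the whole copy at most 0. If the core were a pair,
  \<open>X\<close> would tie with it in value and win by its number of nodes; this is the purpose of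
  the rule of maximal size.\<close>

lemma core_props:
  defines "Y \<equiv> nodes (\<kappa> (copy_config m S X))"
  shows "Y \<subseteq> X" "3 \<le> card Y" "cval Y \<le> 0"
    "\<And>Z. Z \<subseteq> X \<Longrightarrow> 2 \<le> card Z \<Longrightarrow> cval Y \<le> cval Z"
proof -
  define W where "W = copy_config m S X"
  have nodesW: "nodes W = X" by (simp add: W_def copy_config_def)
  have "wf_config W"
    unfolding wf_config_def nodesW using copy_finite by (auto simp: W_def copy_config_def)
  moreover have "2 \<le> card (nodes W)" using copy_card st by (simp add: nodesW)
  ultimately have core: "is_core s t W (\<kappa> W)" using core_rule by (simp add: core_rule_def)
  have sub: "induced_subconfigs W = induced_config W ` {Z. Z \<subseteq> X \<and> 2 \<le> card Z}"
    by (auto simp: induced_subconfigs_def nodesW)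
  from core obtain Y' where Y': "\<kappa> W = induced_config W Y'" "Y' \<subseteq> X" "2 \<le> card Y'"
    unfolding is_core_def sub by auto
  have YY: "Y' = Y" using Y'(1) by (simp add: Y_def W_def induced_config_def)
  note val = config_value_induced[of _ X, folded W_def]
  show Y: "Y \<subseteq> X" using Y' YY by simp
  show min: "cval Y \<le> cval Z" if "Z \<subseteq> X" "2 \<le> card Z" for Z
  proof -
    have "config_value s t (\<kappa> W) \<le> config_value s t (induced_config W Z)"
      using core that unfolding is_core_def sub by blast
    thus ?thesis using val that Y' YY by simp
  qed
  have big: "card Z \<le> card Y" if "Z \<subseteq> X" "2 \<le> card Z" "cval Z = cval Y" for Z
  proof -
    have "config_value s t (induced_config W Z) = config_value s t (\<kappa> W)"
      using val that Y' YY by simp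
    hence "card (nodes (induced_config W Z)) \<le> card (nodes (\<kappa> W))"
      using core that unfolding is_core_def sub by blast
    thus ?thesis using Y' YY by (simp add: induced_config_def)
  qed
  have "cval Y \<le> cval X" using min[of X] copy_card st by simp
  thus "cval Y \<le> 0" using cval_copy by simp
  show "3 \<le> card Y"
  proof (rule ccontr)
    assume "\<not> 3 \<le> card Y"
    hence "card Y = 2" using Y' YY by simp
    then obtain x y where xy: "Y = {x, y}" "x \<noteq> y" by (auto simp: card_2_iff)
    hence "cval Y = 0" using cval_pair Y by simp
    hence "cval X = cval Y" using \<open>cval Y \<le> cval X\<close> cval_copy by simp
    hence "card X \<le> card Y" using big[of X] copy_card st by simp
    thus False using \<open>card Y = 2\<close> copy_card st s3 by simp
  qed
qed

end

section \<open>Sizes and exponents of cores\<close>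

lemma core_E:
  assumes "Y \<in> cores"
  obtains X where "clique_copy t {1..n} E1 X" "Y = nodes (\<kappa> (copy_config m S X))"
  using assms unfolding cores_def core_sets_def by blast

lemma core_card: "Y \<in> cores \<Longrightarrow> 3 \<le> card Y"
  using core_props(2) by (elim core_E) blast

lemma core_card_le: "Y \<in> cores \<Longrightarrow> card Y \<le> t"
  using core_props(1) by (elim core_E) (metis copy_card copy_finite card_mono)

lemma core_subset: "Y \<in> cores \<Longrightarrow> Y \<subseteq> {1..n}"
  using core_props(1) unfolding clique_copy_def by (elim core_E) (metis clique_copy_def order_trans)

lemma finite_core: "Y \<in> cores \<Longrightarrow> finite Y"
  using core_subset finite_subset by blast

lemma finite_cores: "finite cores"
  using core_subset by (intro finite_subset[of cores "Pow {1..n}"]) auto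

lemma core_edge: "Y \<in> cores \<Longrightarrow> x \<in> Y \<Longrightarrow> y \<in> Y \<Longrightarrow> x \<noteq> y \<Longrightarrow> {x, y} \<in> E1"
  using core_props(1) copy_edge by (elim core_E) blast

lemma delta_alpha: "\<delta> + (\<alpha> - 1) = u"
  using one_minus_alpha delta_eq by simp

text \<open>Inside one colour the value would be \<open>(card Y - 2) * \<alpha> > 0\<close>.
  Consequently a core that uses an edge of a \<open>K_s\<close> lying in one \<open>S i\<close> also
  has an edge that does not belong to this \<open>K_s\<close>, and making that edge late protects
  the \<open>K_s\<close>.\<close>

lemma core_not_monochromatic:
  assumes "Y \<in> cores" "i \<in> {1..m}"
  shows "\<not> Y \<subseteq> S i"
proof
  assume sub: "Y \<subseteq> S i"
  from assms obtain X where X: "clique_copy t {1..n} E1 X" "Y = nodes (\<kappa> (copy_config m S X))"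
    by (elim core_E)
  have card: "3 \<le> card Y" using assms core_card by blast
  have "col Y = {i}"
  proof -
    have "i \<in> col Y" using card sub assms(2) by (auto simp: col_def Int_absorb1)
    moreover have "j = i" if "j \<in> col Y" for j
    proof -
      from that obtain x y where "x \<noteq> y" "{x, y} \<subseteq> S j" "{x, y} \<subseteq> Y" "j \<in> {1..m}"
        by (auto simp: col_iff)
      thus ?thesis using edge_in_unique_colour[OF core_edge[OF assms(1), of x y]] sub assms(2) by blast
    qed
    ultimately show ?thesis by blast
  qed
  hence "cval Y = (real (card Y) - 2) * \<alpha>"
    using sub by (simp add: cval_def Int_absorb1 algebra_simps)
  also have "\<dots> > 0" using card alpha_pos by simp
  finally show False using core_props(3)[OF X(1)] X(2) by simp
qed

text \<open>The left-hand side is the exponent of the expected number of ways to extend the kernel with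
  nodes \<open>Z\<close> and colours \<open>J\<close> to a core.  The colours in \<open>J\<close> that meet \<open>Z\<close> in at most one node are not
  colours of the subconfiguration induced on \<open>Z\<close>; each contributes at least \<open>\<delta> + \<alpha> - 1 = u > 0\<close>.\<close>

lemma kernel_exponent:
  assumes Y: "Y \<in> cores" and Z: "Z \<subseteq> Y" "2 \<le> card Z" and J: "J \<subseteq> col Y" "col Z \<subseteq> J"
  shows "(real (card Y) - real (card Z)) + (real (card (col Y)) - real (card J)) * \<delta> +
    (real (\<Sum>i\<in>col Y. card (S i \<inter> Y)) - real (\<Sum>i\<in>J. card (S i \<inter> Z))) * (\<alpha> - 1) \<le> 0"
proof -
  from Y obtain X where X: "clique_copy t {1..n} E1 X" "Y = nodes (\<kappa> (copy_config m S X))"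
    by (elim core_E)
  have "Z \<subseteq> X" using core_props(1)[OF X(1)] X(2) Z by blast
  hence le: "cval Y \<le> cval Z" using core_props(4)[OF X(1)] X(2) Z(2) by blast
  have finJ: "finite J" using J(1) finite_subset by (metis finite_col)
  have "0 \<le> (\<Sum>i\<in>J - col Z. \<delta> + real (card (S i \<inter> Z)) * (\<alpha> - 1))"
  proof (intro sum_nonneg)
    fix i assume i: "i \<in> J - col Z"
    hence "i \<in> {1..m}" using J by (auto simp: col_def)
    hence "card (S i \<inter> Z) \<le> 1" using i by (auto simp: col_def)
    have "\<delta> + real (card (S i \<inter> Z)) * (\<alpha> - 1) = u + (real (card (S i \<inter> Z)) - 1) * (\<alpha> - 1)"
      unfolding delta_alpha[symmetric] by (simp add: algebra_simps)
    moreover have "(real (card (S i \<inter> Z)) - 1) * (\<alpha> - 1) \<ge> 0"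
      using \<open>card (S i \<inter> Z) \<le> 1\<close> alpha_less by (intro mult_nonpos_nonpos) auto
    ultimately show "0 \<le> \<delta> + real (card (S i \<inter> Z)) * (\<alpha> - 1)"
      using u_pos by simp
  qed
  also have "\<dots> = (real (card J) - real (card (col Z))) * \<delta> +
      (real (\<Sum>i\<in>J. card (S i \<inter> Z)) - real (\<Sum>i\<in>col Z. card (S i \<inter> Z))) * (\<alpha> - 1)"
  proof -
    have "real (card (J - col Z)) = real (card J) - real (card (col Z))"
      using J finJ by (simp add: card_Diff_subset card_mono of_nat_diff)
    moreover have "(\<Sum>i\<in>J - col Z. real (card (S i \<inter> Z))) =
        real (\<Sum>i\<in>J. card (S i \<inter> Z)) - real (\<Sum>i\<in>col Z. card (S i \<inter> Z))"
      using J finJ by (simp add: sum_diff)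
    ultimately show ?thesis
      by (simp add: sum.distrib sum_distrib_right[symmetric])
  qed
  finally show ?thesis using le unfolding cval_def by (simp add: algebra_simps)
qed

text \<open>Choose for each colour a pair of core nodes in it. Such a pair is an edge of G_1 and
  determines its colour, so the choice is injective.\<close>

lemma card_col_core: "Y \<in> cores \<Longrightarrow> card (col Y) \<le> t\<^sup>2"
proof -
  assume Y: "Y \<in> cores"
  have "\<exists>e. e \<in> nsets Y 2 \<and> e \<subseteq> S i" if "i \<in> col Y" for i
    using that unfolding col_iff by (metis doubleton_in_nsets_2 insert_subset)
  then obtain e where e: "\<And>i. i \<in> col Y \<Longrightarrow> e i \<in> nsets Y 2 \<and> e i \<subseteq> S i" by metis
  have "inj_on e (col Y)"
  proof (rule inj_onI)
    fix i j assume ij: "i \<in> col Y" "j \<in> col Y" "e i = e j"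
    obtain x y where xy: "e i = {x, y}" "x \<noteq> y" using e[OF ij(1)] by (auto elim: nsets2_E)
    have "x \<in> Y" "y \<in> Y" using e[OF ij(1)] xy by auto
    from core_edge[OF Y this xy(2)] show "i = j"
      by (rule edge_in_unique_colour) (use ij e[OF ij(1)] e[OF ij(2)] xy in \<open>auto simp: col_def\<close>)
  qed
  hence "card (col Y) \<le> card (nsets Y 2)"
    using e finite_core[OF Y] by (intro card_inj_on_le) (auto simp: finite_imp_finite_nsets)
  also have "\<dots> = card Y choose 2" using finite_core[OF Y] by (simp add: card_nsets)
  also have "\<dots> \<le> card Y * card Y" by (cases "card Y") (simp_all add: choose_two div_le_dividend le_trans[OF div_le_dividend])
  also have "\<dots> \<le> t\<^sup>2" using core_card_le[OF Y] by (simp add: power2_eq_square mult_le_mono)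
  finally show ?thesis .
qed

definition G :: "(nat set \<Rightarrow> real) \<Rightarrow> nat set set" where
  "G \<beta> = final_graph s t \<kappa> n m S P \<beta>"

lemma G_eq: "G \<beta> = process cores \<beta> (sort_key \<beta> (filter (\<lambda>e. e \<in> E1) (all_pairs n)))"
  by (simp add: G_def final_graph_def Let_def cores_def E1_def)

lemma G_clique_free: "\<not> clique_copy t {1..n} (G \<beta>) X"
proof
  assume X: "clique_copy t {1..n} (G \<beta>) X"
  have "G \<beta> \<subseteq> E1"
    unfolding G_eq using process_subset by (rule order_trans) auto
  hence X1: "clique_copy t {1..n} E1 X"
    using X by (auto simp: clique_copy_def clique_def)
  define Y where "Y = nodes (\<kappa> (copy_config m S X))"
  have Y: "Y \<in> cores" using X1 by (auto simp: Y_def cores_def core_sets_def)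
  have "nsets Y 2 \<noteq> {}"
    using core_card[OF Y] finite_core[OF Y] by (metis binomial_eq_0_iff card.empty card_nsets
        not_less one_le_numeral order_trans not_less_eq_eq numeral_2_eq_2 numeral_3_eq_3 Suc_leD)
  hence "\<not> nsets Y 2 \<subseteq> G \<beta>"
    unfolding G_eq using Y by (intro process_no_core) simp_all
  moreover have "nsets Y 2 \<subseteq> G \<beta>"
  proof
    fix e assume e: "e \<in> nsets Y 2"
    then obtain x y where xy: "e = {x, y}" "x \<noteq> y" by (auto elim: nsets2_E)
    moreover have "x \<in> X" "y \<in> X" using e xy core_props(1)[OF X1] by (auto simp: Y_def)
    ultimately show "e \<in> G \<beta>" using X by (auto simp: clique_copy_def clique_def)
  qed
  ultimately show False by blast
qed

text \<open>\<open>blocked\<close> requires all edges of the core to be no later than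
  \<open>e\<close>, so one edge outside \<open>F\<close> in each core through \<open>e\<close>
  suffices. Nothing is asked about the order of birthtimes within \<open>F\<close>.\<close>

lemma G_early:
  assumes e: "e \<in> E1" "e \<in> F" and F: "\<And>g. g \<in> nsets {1..n} 2 \<Longrightarrow> g \<notin> F \<Longrightarrow> \<beta> e < \<beta> g"
    and cores: "\<And>Y. Y \<in> cores \<Longrightarrow> e \<in> nsets Y 2 \<Longrightarrow> \<not> nsets Y 2 \<subseteq> F"
  shows "e \<in> G \<beta>"
  unfolding G_eq
proof (rule process_keeps)
  show "e \<in> set (sort_key \<beta> (filter (\<lambda>e. e \<in> E1) (all_pairs n)))"
    using e(1) E1_subset set_all_pairs by auto
next
  fix Y assume "Y \<in> cores" "e \<in> nsets Y 2"
  thus "\<exists>f\<in>nsets Y 2. \<beta> e < \<beta> f" using cores[of Y] F nsets_mono[OF core_subset, of Y 2] by blast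
qed

end

section \<open>Measurability and positive probability\<close>

lemma sort_key_cong_order:
  assumes "\<And>e f. e \<in> set xs \<Longrightarrow> f \<in> set xs \<Longrightarrow> \<beta> e \<le> \<beta> f \<longleftrightarrow> \<beta>' e \<le> \<beta>' f"
  shows "sort_key \<beta> xs = sort_key \<beta>' xs"
proof -
  have ins: "insort_key \<beta> x ys = insort_key \<beta>' x ys"
    if "\<And>y. y \<in> set ys \<Longrightarrow> \<beta> x \<le> \<beta> y \<longleftrightarrow> \<beta>' x \<le> \<beta>' y" for x ys
    using that by (induction ys) auto
  show ?thesis using assms
  proof (induction xs)
    case (Cons x xs)
    hence "sort_key \<beta> xs = sort_key \<beta>' xs" by simp
    moreover have "insort_key \<beta> x (sort_key \<beta>' xs) = insort_key \<beta>' x (sort_key \<beta>' xs)"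
      using Cons.prems by (intro ins) auto
    ultimately show ?case by simp
  qed simp
qed

lemma process_cong_order:
  assumes "\<And>Y. Y \<in> cores \<Longrightarrow> nsets Y 2 \<subseteq> U" "set es \<subseteq> U"
    and "\<And>e f. e \<in> U \<Longrightarrow> f \<in> U \<Longrightarrow> \<beta> e \<le> \<beta> f \<longleftrightarrow> \<beta>' e \<le> \<beta>' f"
  shows "process cores \<beta> es = process cores \<beta>' es"
  using assms(2)
proof (induction es rule: rev_induct)
  case (snoc e es)
  have "blocked cores \<beta> E e \<longleftrightarrow> blocked cores \<beta>' E e" for E
    unfolding blocked_def using assms(1,3) snoc.prems
    by (intro bex_cong conj_cong ball_cong refl) (auto dest!: subsetD)
  thus ?case using snoc by (simp add: process_snoc)
qed (simp add: process_def)

lemma graph1_cong: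
  assumes "\<And>i. i \<in> {1..m} \<Longrightarrow> S i = S' i" "\<And>i j. i \<in> {1..m} \<Longrightarrow> P i j = P' i j"
  shows "graph1 s m S P = graph1 s m S' P'"
proof -
  have "graph0 s m P = graph0 s m P'"
    unfolding graph0_def using assms(2) by blast
  moreover have "{{x, y} | x y i j. i \<in> {1..m} \<and> j \<in> {1..m} \<and> i \<noteq> j
                        \<and> x \<in> S i \<inter> S j \<and> y \<in> S i \<inter> S j} =
     {{x, y} | x y i j. i \<in> {1..m} \<and> j \<in> {1..m} \<and> i \<noteq> j
                        \<and> x \<in> S' i \<inter> S' j \<and> y \<in> S' i \<inter> S' j}"
    using assms(1) by blast
  ultimately show ?thesis unfolding graph1_def by simp
qed

lemma copy_config_cong:
  assumes "\<And>i. i \<in> {1..m} \<Longrightarrow> S i = S' i"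
  shows "copy_config m S X = copy_config m S' X"
proof -
  have "{i \<in> {1..m}. 2 \<le> card (S i \<inter> X)} = {i \<in> {1..m}. 2 \<le> card (S' i \<inter> X)}"
    using assms by auto
  thus ?thesis unfolding copy_config_def using assms by (auto intro!: image_mset_cong)
qed

text \<open>The graph depends on the outcome only through these countably many possible data.\<close>

definition order_data :: "nat \<Rightarrow> nat \<Rightarrow> outcome \<Rightarrow>
    (nat \<times> nat \<Rightarrow> bool) \<times> (nat \<times> nat \<Rightarrow> nat) \<times> (nat set \<times> nat set) set" where
  "order_data n m \<omega> = (restrict (fst \<omega>) ({1..m} \<times> {1..n}), restrict (fst (snd \<omega>)) ({1..m} \<times> {1..n}),
     {(e, f) \<in> nsets {1..n} 2 \<times> nsets {1..n} 2. snd (snd \<omega>) e \<le> snd (snd \<omega>) f})"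


lemma random_graph_cong:
  assumes "exponents s t" "core_rule s t \<kappa>" and eq: "order_data n m \<omega> = order_data n m \<omega>'"
  shows "random_graph s t \<kappa> n m \<omega> = random_graph s t \<kappa> n m \<omega>'"
proof -
  have 1: "fst \<omega> (i, v) = fst \<omega>' (i, v)" if "i \<in> {1..m}" "v \<in> {1..n}" for i v
    using eq that by (auto simp: order_data_def restrict_def fun_eq_iff split: if_splits)
  have 2: "fst (snd \<omega>) (i, v) = fst (snd \<omega>') (i, v)" if "i \<in> {1..m}" "v \<in> {1..n}" for i v
    using eq that by (auto simp: order_data_def restrict_def fun_eq_iff split: if_splits)
  have 3: "snd (snd \<omega>) e \<le> snd (snd \<omega>) f \<longleftrightarrow> snd (snd \<omega>') e \<le> snd (snd \<omega>') f"
    if "e \<in> nsets {1..n} 2" "f \<in> nsets {1..n} 2" for e f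
  proof -
    have "(e, f) \<in> snd (snd (order_data n m \<omega>)) \<longleftrightarrow> (e, f) \<in> snd (snd (order_data n m \<omega>'))"
      using eq by simp
    thus ?thesis using that by (simp add: order_data_def)
  qed
  have S: "random_set n \<omega> i = random_set n \<omega>' i" if "i \<in> {1..m}" for i
    using 1[OF that] by (auto simp: random_set_def)
  have P: "random_part n \<omega> i j = random_part n \<omega>' i j" if "i \<in> {1..m}" for i j
    using S[OF that] 2[OF that] by (auto simp: random_part_def random_set_def)
  interpret layout s t n m \<kappa> "random_set n \<omega>" "\<lambda>i v. fst (snd \<omega>) (i, v)"
    using assms by (auto simp: layout_def layout_axioms_def random_set_def)
  have part: "random_part n \<omega> = P" by (intro ext) (simp add: random_part_def P_def)
  have E1': "graph1 s m (random_set n \<omega>') (random_part n \<omega>') = E1"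
    unfolding E1_def part[symmetric] by (rule graph1_cong) (use S P in auto)
  have cores': "core_sets s t \<kappa> n m (random_set n \<omega>') E1 = cores"
  proof -
    have "copy_config m (random_set n \<omega>') X = copy_config m (random_set n \<omega>) X" for X
      by (rule copy_config_cong) (use S in auto)
    thus ?thesis unfolding cores_def core_sets_def by simp
  qed
  let ?es = "filter (\<lambda>e. e \<in> E1) (all_pairs n)"
  let ?b = "snd (snd \<omega>)" and ?b' = "snd (snd \<omega>')"
  have sub: "set ?es \<subseteq> nsets {1..n} 2" by (auto simp: set_all_pairs)
  have "sort_key ?b ?es = sort_key ?b' ?es"
    by (rule sort_key_cong_order) (use sub 3 in blast)
  moreover have "process cores ?b es = process cores ?b' es" if "set es \<subseteq> nsets {1..n} 2" for es
    using that 3 core_subset by (intro process_cong_order[where U = "nsets {1..n} 2"] nsets_mono) auto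
  ultimately have "process cores ?b (sort_key ?b ?es) = process cores ?b' (sort_key ?b' ?es)"
    using sub by simp
  thus ?thesis
    unfolding random_graph_def final_graph_def Let_def E1' cores' part
    by (simp add: E1_def[symmetric] cores_def[symmetric])
qed

lemma finite_pairs: "finite (nsets {1..n::nat} 2)"
  by (simp add: finite_imp_finite_nsets)

text \<open>An arbitrary predicate \<open>Q\<close> is possible because the event is a countable
  union of the sets on which \<open>order_data\<close> is constant.\<close>

lemma sets_order_data:
  "{\<omega> \<in> space (outcomes s n m \<gamma>). Q (order_data n m \<omega>)} \<in> sets (outcomes s n m \<gamma>)"
proof -
  let ?I = "{1..m} \<times> {1..n}" and ?U = "nsets {1..n} 2"
  let ?M = "outcomes s n m \<gamma>"
  define D :: "((nat \<times> nat \<Rightarrow> bool) \<times> (nat \<times> nat \<Rightarrow> nat) \<times> (nat set \<times> nat set) set) set"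
    where "D = PiE ?I (\<lambda>_. UNIV) \<times> PiE ?I (\<lambda>_. UNIV) \<times> Pow (?U \<times> ?U)"
  have "countable D"
  proof -
    have "countable (PiE ?I (\<lambda>_. UNIV :: bool set))" "countable (PiE ?I (\<lambda>_. UNIV :: nat set))"
      by (intro countable_PiE; simp)+
    moreover have "countable (Pow (?U \<times> ?U))"
      using finite_pairs by (intro countable_finite) (simp only: finite_Pow_iff finite_cartesian_product)
    ultimately show ?thesis unfolding D_def by (intro countable_SIGMA)
  qed
  have inD: "order_data n m \<omega> \<in> D" for \<omega>
    by (auto simp: order_data_def D_def)
  have m1: "(\<lambda>\<omega>. fst \<omega> p) \<in> measurable ?M (count_space UNIV)" if "p \<in> ?I" for p
  proof -
    have "(\<lambda>\<omega>. fst \<omega> p) \<in> measurable ?M (measure_pmf (bernoulli_pmf \<gamma>))"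
      unfolding outcomes_def using that by (intro measurable_compose[OF measurable_fst] measurable_component_singleton)
    thus ?thesis by simp
  qed
  have m2: "(\<lambda>\<omega>. fst (snd \<omega>) p) \<in> measurable ?M (count_space UNIV)" if "p \<in> ?I" for p
  proof -
    have "(\<lambda>\<omega>. fst (snd \<omega>) p) \<in> measurable ?M (measure_pmf (pmf_of_set {1..s}))"
      unfolding outcomes_def using that
      by (intro measurable_compose[OF measurable_compose[OF measurable_snd measurable_fst]] measurable_component_singleton)
    thus ?thesis by simp
  qed
  have m3: "(\<lambda>\<omega>. snd (snd \<omega>) e) \<in> borel_measurable ?M" if "e \<in> ?U" for e
  proof -
    have "(\<lambda>\<omega>. snd (snd \<omega>) e) \<in> measurable ?M (uniform_measure lborel {0..1})"
      unfolding outcomes_def using that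
      by (intro measurable_compose[OF measurable_compose[OF measurable_snd measurable_snd]] measurable_component_singleton)
    moreover have "measurable ?M (uniform_measure lborel {0..1}) = borel_measurable ?M"
      by (intro measurable_cong_sets refl) auto
    ultimately show ?thesis by blast
  qed
  have single: "{\<omega> \<in> space ?M. order_data n m \<omega> = d} \<in> sets ?M" if d: "d \<in> D" for d
  proof -
    obtain d1 d2 d3 where dd: "d = (d1, d2, d3)" by (cases d) auto
    have "order_data n m \<omega> = d \<longleftrightarrow> (\<forall>p\<in>?I. fst \<omega> p = d1 p) \<and> (\<forall>p\<in>?I. fst (snd \<omega>) p = d2 p) \<and>
       (\<forall>e\<in>?U. \<forall>f\<in>?U. (snd (snd \<omega>) e \<le> snd (snd \<omega>) f) = ((e, f) \<in> d3))" for \<omega>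
    proof -
      have "restrict (fst \<omega>) ?I = d1 \<longleftrightarrow> (\<forall>p\<in>?I. fst \<omega> p = d1 p)"
        using d unfolding dd D_def by (auto simp: fun_eq_iff restrict_def PiE_def extensional_def)
      moreover have "restrict (fst (snd \<omega>)) ?I = d2 \<longleftrightarrow> (\<forall>p\<in>?I. fst (snd \<omega>) p = d2 p)"
        using d unfolding dd D_def by (auto simp: fun_eq_iff restrict_def PiE_def extensional_def)
      moreover have "{(e, f) \<in> ?U \<times> ?U. snd (snd \<omega>) e \<le> snd (snd \<omega>) f} = d3 \<longleftrightarrow>
          (\<forall>e\<in>?U. \<forall>f\<in>?U. (snd (snd \<omega>) e \<le> snd (snd \<omega>) f) = ((e, f) \<in> d3))"
        using d unfolding dd D_def by auto
      ultimately show ?thesis unfolding order_data_def dd by simp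
    qed
    hence "{\<omega> \<in> space ?M. order_data n m \<omega> = d} = {\<omega> \<in> space ?M. (\<forall>p\<in>?I. fst \<omega> p = d1 p) \<and> (\<forall>p\<in>?I. fst (snd \<omega>) p = d2 p) \<and>
       (\<forall>e\<in>?U. \<forall>f\<in>?U. (snd (snd \<omega>) e \<le> snd (snd \<omega>) f) = ((e, f) \<in> d3))}" by simp
    also have "\<dots> \<in> sets ?M"
    proof (intro sets.sets_Collect_conj sets.sets_Collect_finite_All finite_pairs)
      show "{\<omega> \<in> space ?M. fst \<omega> p = d1 p} \<in> sets ?M" if "p \<in> ?I" for p
        using m1[OF that] by measurable
      show "{\<omega> \<in> space ?M. fst (snd \<omega>) p = d2 p} \<in> sets ?M" if "p \<in> ?I" for p
        using m2[OF that] by measurable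
      show "{\<omega> \<in> space ?M. (snd (snd \<omega>) e \<le> snd (snd \<omega>) f) = ((e, f) \<in> d3)} \<in> sets ?M"
        if [simp]: "e \<in> ?U" "f \<in> ?U" for e f
      proof -
        note [measurable] = m3[OF that(1)] m3[OF that(2)]
        show ?thesis by measurable
      qed
    qed auto
    finally show ?thesis .
  qed
  have "{\<omega> \<in> space ?M. Q (order_data n m \<omega>)} = (\<Union>d\<in>{d \<in> D. Q d}. {\<omega> \<in> space ?M. order_data n m \<omega> = d})"
    using inD by auto
  also have "\<dots> \<in> sets ?M"
    using \<open>countable D\<close> single by (intro sets.countable_UN') auto
  finally show ?thesis .
qed

lemma sets_random_graph:
  assumes "exponents s t" "core_rule s t \<kappa>"
  shows "{\<omega> \<in> space (outcomes s n m \<gamma>). Q (random_graph s t \<kappa> n m \<omega>)} \<in> sets (outcomes s n m \<gamma>)"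
proof -
  define R where "R d \<longleftrightarrow> (\<exists>\<omega>. order_data n m \<omega> = d \<and> Q (random_graph s t \<kappa> n m \<omega>))" for d
  have "R (order_data n m \<omega>) \<longleftrightarrow> Q (random_graph s t \<kappa> n m \<omega>)" for \<omega>
    unfolding R_def using random_graph_cong[OF assms] by metis
  thus ?thesis using sets_order_data[of s n m \<gamma> R] by simp
qed

text \<open>The event contains a product box: memberships and labels are prescribed, birthtimes lie
  below 1/2 on \<open>F\<close> and above 1/2 elsewhere. Its measure is a finite product of positive
  factors.\<close>

lemma positive_probability:
  assumes "exponents s t" "core_rule s t \<kappa>" "0 < \<gamma>" "\<gamma> < 1"
    and l: "\<And>p. l p \<in> {1..s}"
    and Q: "\<And>\<omega>. (\<And>i v. i \<in> {1..m} \<Longrightarrow> v \<in> {1..n} \<Longrightarrow> fst \<omega> (i, v) = h (i, v)) \<Longrightarrow>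
       (\<And>i v. i \<in> {1..m} \<Longrightarrow> v \<in> {1..n} \<Longrightarrow> fst (snd \<omega>) (i, v) = l (i, v)) \<Longrightarrow>
       (\<And>e f. e \<in> nsets {1..n} 2 \<Longrightarrow> f \<in> nsets {1..n} 2 \<Longrightarrow> e \<in> F \<Longrightarrow> f \<notin> F \<Longrightarrow> snd (snd \<omega>) e < snd (snd \<omega>) f) \<Longrightarrow>
       Q (random_graph s t \<kappa> n m \<omega>)"
  shows "measure (outcomes s n m \<gamma>) {\<omega> \<in> space (outcomes s n m \<gamma>). Q (random_graph s t \<kappa> n m \<omega>)} > 0"
proof -
  let ?I = "{1..m} \<times> {1..n}" and ?U = "nsets {1..n} 2"
  let ?M = "outcomes s n m \<gamma>"
  let ?E = "{\<omega> \<in> space ?M. Q (random_graph s t \<kappa> n m \<omega>)}"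
  define B :: "nat set \<Rightarrow> real set" where "B e = (if e \<in> F then {0<..<1/2} else {1/2<..<1})" for e
  define unif :: "real measure" where "unif = uniform_measure lborel {0..1}"
  interpret u: prob_space unif
    unfolding unif_def by (intro prob_space_uniform_measure) auto
  let ?M1 = "\<Pi>\<^sub>M p \<in> ?I. measure_pmf (bernoulli_pmf \<gamma>)"
  let ?M2 = "\<Pi>\<^sub>M p \<in> ?I. measure_pmf (pmf_of_set {1..s})"
  let ?M3 = "\<Pi>\<^sub>M e \<in> ?U. unif"
  interpret p1: finite_product_prob_space "\<lambda>p. measure_pmf (bernoulli_pmf \<gamma>)" ?I
    by unfold_locales auto
  interpret p2: finite_product_prob_space "\<lambda>p. measure_pmf (pmf_of_set {1..s})" ?I
    by unfold_locales auto
  interpret p3: finite_product_prob_space "\<lambda>_. unif" ?U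
    by unfold_locales (rule finite_pairs)
  interpret p23: pair_prob_space ?M2 ?M3 by unfold_locales
  interpret p123: pair_prob_space ?M1 "?M2 \<Otimes>\<^sub>M ?M3" by unfold_locales
  have M: "?M = ?M1 \<Otimes>\<^sub>M (?M2 \<Otimes>\<^sub>M ?M3)" by (simp add: outcomes_def unif_def)
  let ?R1 = "PiE ?I (\<lambda>p. {h p})" and ?R2 = "PiE ?I (\<lambda>p. {l p})" and ?R3 = "PiE ?U B"
  have s1: "s \<ge> 1" using assms(1) by (simp add: exponents_def)
  have setsB: "B e \<in> sets unif" for e by (simp add: B_def unif_def)
  have R1: "?R1 \<in> sets ?M1" "emeasure ?M1 ?R1 > 0"
  proof -
    show "?R1 \<in> sets ?M1" by (intro sets_PiM_I_finite) auto
    have "emeasure ?M1 ?R1 = (\<Prod>p\<in>?I. emeasure (measure_pmf (bernoulli_pmf \<gamma>)) {h p})"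
      by (intro p1.emeasure_PiM) auto
    also have "\<dots> = (\<Prod>p\<in>?I. ennreal (pmf (bernoulli_pmf \<gamma>) (h p)))"
      by (simp add: emeasure_pmf_single)
    also have "\<dots> > 0"
    proof -
      have "pmf (bernoulli_pmf \<gamma>) b > 0" for b using assms(3,4) by (cases b) auto
      thus ?thesis by (simp add: prod_ennreal less_imp_le prod_pos)
    qed
    finally show "emeasure ?M1 ?R1 > 0" .
  qed
  have R2: "?R2 \<in> sets ?M2" "emeasure ?M2 ?R2 > 0"
  proof -
    show "?R2 \<in> sets ?M2" by (intro sets_PiM_I_finite) auto
    have "emeasure ?M2 ?R2 = (\<Prod>p\<in>?I. emeasure (measure_pmf (pmf_of_set {1..s})) {l p})"
      by (intro p2.emeasure_PiM) auto
    also have "\<dots> = (\<Prod>p\<in>?I. ennreal (pmf (pmf_of_set {1..s}) (l p)))"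
      by (simp add: emeasure_pmf_single)
    also have "\<dots> > 0"
    proof -
      have "pmf (pmf_of_set {1..s}) (l p) > 0" for p using l[of p] s1 by (simp add: indicator_def)
      thus ?thesis by (simp add: prod_ennreal less_imp_le prod_pos)
    qed
    finally show "emeasure ?M2 ?R2 > 0" .
  qed
  have R3: "?R3 \<in> sets ?M3" "emeasure ?M3 ?R3 > 0"
  proof -
    show "?R3 \<in> sets ?M3" using setsB by (intro sets_PiM_I_finite) (auto simp: finite_imp_finite_nsets)
    have "emeasure ?M3 ?R3 = (\<Prod>e\<in>?U. emeasure unif (B e))"
      using setsB by (intro p3.emeasure_PiM) (auto simp: finite_imp_finite_nsets)
    also have "\<dots> = (\<Prod>e\<in>?U. ennreal (1 / 2))"
    proof (intro prod.cong refl)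
      fix e
      have "{0..1} \<inter> {0<..<1/2} = {0<..<1/2::real}" "{0..1} \<inter> {1/2<..<1} = {1/2<..<1::real}" by auto
      thus "emeasure unif (B e) = ennreal (1 / 2)"
        unfolding unif_def B_def by (auto simp: emeasure_uniform_measure divide_ennreal_def)
    qed
    also have "\<dots> > 0" by (subst prod_ennreal) (auto intro!: prod_pos)
    finally show "emeasure ?M3 ?R3 > 0" .
  qed
  let ?R = "?R1 \<times> (?R2 \<times> ?R3)"
  have sf3: "sigma_finite_measure ?M3" by unfold_locales
  have sf23: "sigma_finite_measure (?M2 \<Otimes>\<^sub>M ?M3)" by unfold_locales
  have "emeasure ?M ?R = emeasure ?M1 ?R1 * (emeasure ?M2 ?R2 * emeasure ?M3 ?R3)"
  proof -
    have "emeasure (?M2 \<Otimes>\<^sub>M ?M3) (?R2 \<times> ?R3) = emeasure ?M2 ?R2 * emeasure ?M3 ?R3"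
      by (rule sigma_finite_measure.emeasure_pair_measure_Times[OF sf3 R2(1) R3(1)])
    moreover have "emeasure (?M1 \<Otimes>\<^sub>M (?M2 \<Otimes>\<^sub>M ?M3)) ?R = emeasure ?M1 ?R1 * emeasure (?M2 \<Otimes>\<^sub>M ?M3) (?R2 \<times> ?R3)"
      by (rule sigma_finite_measure.emeasure_pair_measure_Times[OF sf23 R1(1) pair_measureI[OF R2(1) R3(1)]])
    ultimately show ?thesis unfolding M by (simp only:)
  qed
  hence pos: "emeasure ?M ?R > 0"
    using R1(2) R2(2) R3(2) by (simp add: ennreal_zero_less_mult_iff)
  have RM: "?R \<in> sets ?M" unfolding M by (intro pair_measureI R1(1) R2(1) R3(1))
  have "?R \<subseteq> ?E"
  proof
    fix \<omega> assume \<omega>: "\<omega> \<in> ?R"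
    have "Q (random_graph s t \<kappa> n m \<omega>)"
    proof (rule Q)
      show "fst \<omega> (i, v) = h (i, v)" if "i \<in> {1..m}" "v \<in> {1..n}" for i v
        using \<omega> that by (auto simp: PiE_iff)
      show "fst (snd \<omega>) (i, v) = l (i, v)" if "i \<in> {1..m}" "v \<in> {1..n}" for i v
        using \<omega> that by (auto simp: PiE_iff)
      show "snd (snd \<omega>) e < snd (snd \<omega>) f" if "e \<in> ?U" "f \<in> ?U" "e \<in> F" "f \<notin> F" for e f
      proof -
        have "snd (snd \<omega>) e \<in> B e" "snd (snd \<omega>) f \<in> B f" using \<omega> that by (auto simp: PiE_iff)
        thus ?thesis using that by (simp add: B_def)
      qed
    qed
    moreover have "\<omega> \<in> space ?M" using sets.sets_into_space[OF RM] \<omega> by blast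
    ultimately show "\<omega> \<in> ?E" by simp
  qed
  hence "emeasure ?M ?R \<le> emeasure ?M ?E"
    by (intro emeasure_mono sets_random_graph assms)
  hence "emeasure ?M ?E > 0" using pos by order
  moreover have "emeasure ?M ?E \<noteq> \<infinity>"
  proof -
    have "finite_measure (?M1 \<Otimes>\<^sub>M (?M2 \<Otimes>\<^sub>M ?M3))" by unfold_locales
    from finite_measure.emeasure_finite[OF this] show ?thesis unfolding M infinity_ennreal_def .
  qed
  ultimately show ?thesis
    by (simp add: measure_def enn2real_positive_iff top.not_eq_extremum)
qed

section \<open>Sunflowers and independent events\<close>

text \<open>Induction on the room \<open>d\<close> left above a kernel \<open>Z\<close>. A maximal
  family of members strictly above \<open>Z\<close> that pairwise meet exactly in \<open>Z\<close>
  has fewer than \<open>K\<close> sets. By maximality each member strictly above \<open>Z\<close>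
  contains one of the at most \<open>K * k\<close> further points of that family, and adding this
  point to \<open>Z\<close> reduces the room.\<close>

lemma sunflower_count:
  fixes F :: "'a set set"
  assumes fin: "finite F" "\<And>Y. Y \<in> F \<Longrightarrow> finite Y \<and> card Y \<le> k" and B: "\<And>Y. Y \<in> F \<Longrightarrow> B \<subseteq> Y"
    and no: "\<And>Gs Z. Gs \<subseteq> F \<Longrightarrow> card Gs = K \<Longrightarrow> B \<subseteq> Z \<Longrightarrow> (\<And>Y. Y \<in> Gs \<Longrightarrow> Z \<subset> Y) \<Longrightarrow>
      (\<And>Y Y'. Y \<in> Gs \<Longrightarrow> Y' \<in> Gs \<Longrightarrow> Y \<noteq> Y' \<Longrightarrow> Y \<inter> Y' = Z) \<Longrightarrow> False"
  shows "card F \<le> (K * k + 1) ^ k"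
proof -
  have claim: "card {Y \<in> F. Z \<subseteq> Y} \<le> (K * k + 1) ^ d" if "B \<subseteq> Z" "finite Z" "k \<le> card Z + d" for Z d
    using that
  proof (induction d arbitrary: Z)
    case 0
    have "Y = Z" if "Y \<in> F" "Z \<subseteq> Y" for Y
      using card_seteq[of Y Z] fin(2)[OF that(1)] that(2) 0 by simp
    hence "{Y \<in> F. Z \<subseteq> Y} \<subseteq> {Z}" by blast
    thus ?case using card_mono[of "{Z}" "{Y \<in> F. Z \<subseteq> Y}"] by simp
  next
    case (Suc d)
    define FZ where "FZ = {Y \<in> F. Z \<subset> Y}"
    define C where "C = {Gs. Gs \<subseteq> FZ \<and> (\<forall>Y\<in>Gs. \<forall>Y'\<in>Gs. Y \<noteq> Y' \<longrightarrow> Y \<inter> Y' = Z)}"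
    have finFZ: "finite FZ" using fin(1) by (simp add: FZ_def)
    have "finite C" by (rule finite_subset[of _ "Pow FZ"]) (use finFZ in \<open>auto simp: C_def\<close>)
    moreover have "{} \<in> C" by (simp add: C_def)
    ultimately obtain Gs where Gs: "Gs \<in> C" "\<And>Gs'. Gs' \<in> C \<Longrightarrow> Gs \<subseteq> Gs' \<Longrightarrow> Gs = Gs'"
      using finite_has_maximal[of C] by blast
    have finGs: "finite Gs" using Gs(1) finFZ finite_subset by (auto simp: C_def)
    have "card Gs < K"
    proof (rule ccontr)
      assume "\<not> card Gs < K"
      then obtain Gs' where Gs': "Gs' \<subseteq> Gs" "card Gs' = K"
        by (meson not_less obtain_subset_with_card_n)
      have "Y \<in> F" "Z \<subset> Y" if "Y \<in> Gs'" for Y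
        using that Gs' Gs(1) by (auto simp: C_def FZ_def)
      moreover have "Y \<inter> Y' = Z" if "Y \<in> Gs'" "Y' \<in> Gs'" "Y \<noteq> Y'" for Y Y'
      proof -
        have "Y \<in> Gs" "Y' \<in> Gs" using that Gs'(1) by auto
        thus ?thesis using Gs(1) that(3) unfolding C_def by blast
      qed
      ultimately show False using no[of Gs' Z] Gs'(2) Suc.prems(1) by blast
    qed
    define U where "U = \<Union>Gs - Z"
    have GsF: "Y \<in> F" if "Y \<in> Gs" for Y using Gs(1) that by (auto simp: C_def FZ_def)
    have "card U \<le> K * k"
    proof -
      have "card U \<le> card (\<Union>Gs)"
        unfolding U_def using finGs fin(2) GsF by (intro card_mono) auto
      also have "\<dots> \<le> (\<Sum>Y\<in>Gs. card Y)" by (rule card_Union_le_sum_card)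
      also have "\<dots> \<le> (\<Sum>Y\<in>Gs. k)" using fin(2) GsF by (intro sum_mono) auto
      also have "\<dots> \<le> K * k" using \<open>card Gs < K\<close> by simp
      finally show ?thesis .
    qed
    have finU: "finite U" unfolding U_def using finGs fin(2) GsF by auto
    have hit: "\<exists>u\<in>U. u \<in> Y" if Y: "Y \<in> FZ" for Y
    proof (cases "Y \<in> Gs")
      case True
      thus ?thesis using Y by (auto simp: FZ_def U_def)
    next
      case False
      hence "insert Y Gs \<notin> C" using Gs(2)[of "insert Y Gs"] by blast
      then obtain Y' where "Y' \<in> Gs" "Y \<inter> Y' \<noteq> Z"
        using Y Gs(1) unfolding C_def by blast
      moreover have "Z \<subseteq> Y \<inter> Y'" using \<open>Y' \<in> Gs\<close> Y Gs(1) by (auto simp: C_def FZ_def)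
      ultimately show ?thesis by (auto simp: U_def)
    qed
    have "card FZ \<le> (\<Sum>u\<in>U. card {Y \<in> F. insert u Z \<subseteq> Y})"
    proof -
      have "FZ \<subseteq> (\<Union>u\<in>U. {Y \<in> F. insert u Z \<subseteq> Y})" using hit by (auto simp: FZ_def)
      hence "card FZ \<le> card (\<Union>u\<in>U. {Y \<in> F. insert u Z \<subseteq> Y})"
        using finU fin(1) by (intro card_mono) auto
      also have "\<dots> \<le> (\<Sum>u\<in>U. card {Y \<in> F. insert u Z \<subseteq> Y})" using finU by (rule card_UN_le)
      finally show ?thesis .
    qed
    also have "\<dots> \<le> (\<Sum>u\<in>U. (K * k + 1) ^ d)"
    proof (intro sum_mono Suc.IH)
      fix u assume "u \<in> U"
      thus "k \<le> card (insert u Z) + d" using Suc.prems by (simp add: U_def)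
    qed (use Suc.prems in auto)
    also have "\<dots> \<le> K * k * (K * k + 1) ^ d" using \<open>card U \<le> K * k\<close> by simp
    finally have FZ: "card FZ \<le> K * k * (K * k + 1) ^ d" .
    have "{Y \<in> F. Z \<subseteq> Y} \<subseteq> insert Z FZ" by (auto simp: FZ_def)
    hence "card {Y \<in> F. Z \<subseteq> Y} \<le> card (insert Z FZ)" using finFZ by (intro card_mono) auto
    also have "\<dots> \<le> Suc (card FZ)" using finFZ by (simp add: card_insert_if)
    also have "\<dots> \<le> 1 * (K * k + 1) ^ d + K * k * (K * k + 1) ^ d" using FZ one_le_power[of "K * k + 1" d] by linarith
    also have "\<dots> = (K * k + 1) ^ Suc d" by (simp add: algebra_simps)
    finally show ?case .
  qed
  show ?thesis
  proof (cases "F = {}")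
    case False
    then obtain Y where Y: "Y \<in> F" by blast
    have "finite B" using B[OF Y] fin(2)[OF Y] finite_subset by blast
    hence "card {Y \<in> F. B \<subseteq> Y} \<le> (K * k + 1) ^ k" by (intro claim) auto
    moreover have "{Y \<in> F. B \<subseteq> Y} = F" using B by auto
    ultimately show ?thesis by simp
  qed simp
qed

text \<open>A maximal disjoint subfamily \<open>I'\<close> meets every \<open>D i\<close>; its union
  has at most \<open>card I' * b\<close> points, and each of them accounts for at most \<Delta>
  indices.\<close>

lemma disjoint_subfamily:
  assumes fin: "finite I" and D: "\<And>i. i \<in> I \<Longrightarrow> D i \<noteq> {} \<and> finite (D i) \<and> card (D i) \<le> b"
    and deg: "\<And>x. card {i \<in> I. x \<in> D i} \<le> \<Delta>"
  obtains I' where "I' \<subseteq> I" "disjoint_family_on D I'" "card I \<le> card I' * (b * \<Delta>)"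
proof -
  define C where "C = {I'. I' \<subseteq> I \<and> disjoint_family_on D I'}"
  have "finite C" by (rule finite_subset[of _ "Pow I"]) (use fin in \<open>auto simp: C_def\<close>)
  moreover have "{} \<in> C" by (simp add: C_def disjoint_family_on_def)
  ultimately obtain I' where I': "I' \<in> C" "\<And>J. J \<in> C \<Longrightarrow> I' \<subseteq> J \<Longrightarrow> I' = J"
    using finite_has_maximal[of C] by blast
  have sub: "I' \<subseteq> I" and dis: "disjoint_family_on D I'" using I'(1) by (auto simp: C_def)
  have finI': "finite I'" using sub fin finite_subset by blast
  define U where "U = (\<Union>i\<in>I'. D i)"
  have finU: "finite U" using finI' D sub by (auto simp: U_def)
  have "I \<subseteq> (\<Union>x\<in>U. {i \<in> I. x \<in> D i})"
  proof
    fix i assume i: "i \<in> I"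
    have "\<exists>x\<in>U. x \<in> D i"
    proof (cases "i \<in> I'")
      case True
      thus ?thesis using D[OF i] by (auto simp: U_def)
    next
      case False
      hence "insert i I' \<notin> C" using I'(2)[of "insert i I'"] by blast
      hence "\<not> disjoint_family_on D (insert i I')" using i sub by (auto simp: C_def)
      hence "\<exists>j\<in>I'. D i \<inter> D j \<noteq> {}"
        using dis unfolding disjoint_family_on_def by (metis Int_commute insert_iff)
      thus ?thesis by (auto simp: U_def)
    qed
    thus "i \<in> (\<Union>x\<in>U. {i \<in> I. x \<in> D i})" using i by blast
  qed
  hence "card I \<le> card (\<Union>x\<in>U. {i \<in> I. x \<in> D i})"
    using finU fin by (intro card_mono) auto
  also have "\<dots> \<le> (\<Sum>x\<in>U. card {i \<in> I. x \<in> D i})" by (rule card_UN_le[OF finU])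
  also have "\<dots> \<le> (\<Sum>x\<in>U. \<Delta>)" by (intro sum_mono deg)
  also have "\<dots> = card U * \<Delta>" by simp
  also have "card U \<le> (\<Sum>i\<in>I'. card (D i))" unfolding U_def by (rule card_UN_le[OF finI'])
  also have "(\<Sum>i\<in>I'. card (D i)) \<le> (\<Sum>i\<in>I'. b)" using D sub by (intro sum_mono) auto
  finally have "card I \<le> card I' * (b * \<Delta>)" by (simp add: mult.assoc)
  thus ?thesis using that sub dis by blast
qed

text \<open>Conditioning on the second coordinate: \<open>y\<close> is exposed first, and
  \<open>q\<close> bounds the conditional probability for every admissible \<open>y\<close>.\<close>

lemma prob_pair_pmf_le:
  assumes "\<And>y. y \<in> A \<Longrightarrow> measure_pmf.prob M {x. P x y} \<le> q" "q \<ge> 0"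
  shows "measure_pmf.prob (pair_pmf M N) {(x, y). y \<in> A \<and> P x y} \<le> q * measure_pmf.prob N A"
proof -
  have "emeasure (pair_pmf M N) {(x, y). y \<in> A \<and> P x y} =
        emeasure (pair_pmf N M) {(y, x). y \<in> A \<and> P x y}"
    by (subst pair_commute_pmf) (simp add: vimage_def case_prod_unfold)
  also have "\<dots> = (\<integral>\<^sup>+y. \<integral>\<^sup>+x. indicator A y * indicator {x. P x y} x \<partial>M \<partial>N)"
    by (subst nn_integral_indicator[symmetric], simp)
      (auto simp: nn_integral_pair_pmf' indicator_def intro!: nn_integral_cong)
  also have "\<dots> = (\<integral>\<^sup>+y. indicator A y * emeasure M {x. P x y} \<partial>N)"
    by (simp add: nn_integral_cmult)
  also have "\<dots> \<le> (\<integral>\<^sup>+y. ennreal q * indicator A y \<partial>N)"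
  proof (intro nn_integral_mono)
    fix y
    show "indicator A y * emeasure M {x. P x y} \<le> ennreal q * indicator A y"
      using assms by (cases "y \<in> A") (auto simp: measure_pmf.emeasure_eq_measure)
  qed
  also have "\<dots> = ennreal (q * measure_pmf.prob N A)"
    using assms(2) by (simp add: nn_integral_cmult measure_pmf.emeasure_eq_measure ennreal_mult)
  finally show ?thesis
    using assms(2) by (simp add: measure_pmf.emeasure_eq_measure)
qed

lemma prob_pair_pmf_le':
  assumes "\<And>x. x \<in> A \<Longrightarrow> measure_pmf.prob N {y. P x y} \<le> q" "q \<ge> 0"
  shows "measure_pmf.prob (pair_pmf M N) {(x, y). x \<in> A \<and> P x y} \<le> q * measure_pmf.prob M A"
proof -
  have "measure_pmf.prob (pair_pmf M N) {(x, y). x \<in> A \<and> P x y} =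
        measure_pmf.prob (pair_pmf N M) {(y, x). x \<in> A \<and> P x y}"
    by (subst pair_commute_pmf) (simp add: vimage_def case_prod_unfold)
  also have "\<dots> \<le> q * measure_pmf.prob M A"
    using assms by (rule prob_pair_pmf_le)
  finally show ?thesis .
qed

lemma prob_Pi_pmf_subset:
  assumes fin: "finite U" "D \<subseteq> U" and P: "\<And>f g. (\<And>x. x \<in> D \<Longrightarrow> f x = g x) \<Longrightarrow> P f \<longleftrightarrow> P g"
  shows "measure_pmf.prob (Pi_pmf U d p) {f. P f} = measure_pmf.prob (Pi_pmf D d p) {f. P f}"
proof -
  have "Pi_pmf D d p = map_pmf (\<lambda>f x. if x \<in> D then f x else d) (Pi_pmf U d p)"
    using fin by (rule Pi_pmf_subset)
  moreover have "P (\<lambda>x. if x \<in> D then f x else d) \<longleftrightarrow> P f" for f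
    by (rule P) simp
  ultimately show ?thesis by (simp add: vimage_def)
qed

lemma prob_disjoint_events_le:
  assumes fin: "finite U" "finite J" and D: "\<And>j. j \<in> J \<Longrightarrow> D j \<subseteq> U" "disjoint_family_on D J"
    and P: "\<And>j f g. j \<in> J \<Longrightarrow> (\<And>x. x \<in> D j \<Longrightarrow> f x = g x) \<Longrightarrow> P j f \<longleftrightarrow> P j g"
    and q: "\<And>j. j \<in> J \<Longrightarrow> measure_pmf.prob (Pi_pmf U d p) {f. P j f} \<le> q" "q \<ge> 0"
  shows "measure_pmf.prob (Pi_pmf U d p) {f. \<forall>j\<in>J. P j f} \<le> q ^ card J"
  using fin(2) D P q(1)
proof (induction J)
  case empty
  then show ?case by simp
next
  case (insert j J)
  define V where "V = U - D j"
  have U: "U = D j \<union> V" "finite (D j)" "finite V" "D j \<inter> V = {}"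
    using insert.prems(1)[of j] fin(1) finite_subset[of "D j" U] by (auto simp: V_def)
  have DV: "D i \<subseteq> V" if "i \<in> J" for i
  proof -
    have "i \<noteq> j" using that insert.hyps by blast
    hence "D i \<inter> D j = {}" using that by (intro disjoint_family_onD[OF insert.prems(2)]) auto
    thus ?thesis using insert.prems(1)[of i] that unfolding V_def by blast
  qed
  have P': "(\<forall>i\<in>J. P i f) \<longleftrightarrow> (\<forall>i\<in>J. P i g)" if "\<And>x. x \<in> V \<Longrightarrow> f x = g x" for f g
    using insert.prems(3)[of _ f g] DV that by blast
  have "measure_pmf.prob (Pi_pmf U d p) {f. \<forall>j\<in>insert j J. P j f} =
    measure_pmf.prob (pair_pmf (Pi_pmf (D j) d p) (Pi_pmf V d p)) {(f, g). f \<in> {f. P j f} \<and> (\<forall>i\<in>J. P i g)}"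
  proof -
    have "P j (\<lambda>x. if x \<in> D j then f x else g x) \<longleftrightarrow> P j f" for f g
      by (rule insert.prems(3)) auto
    moreover have "(\<forall>i\<in>J. P i (\<lambda>x. if x \<in> D j then f x else g x)) \<longleftrightarrow> (\<forall>i\<in>J. P i g)" for f g
      by (rule P') (use U(4) in auto)
    ultimately show ?thesis unfolding U(1)
      by (subst Pi_pmf_union[OF U(2-4)]) (simp add: vimage_def case_prod_unfold)
  qed
  also have "\<dots> \<le> q ^ card J * measure_pmf.prob (Pi_pmf (D j) d p) {f. P j f}"
  proof (rule prob_pair_pmf_le')
    have "measure_pmf.prob (Pi_pmf V d p) {f. \<forall>i\<in>J. P i f} = measure_pmf.prob (Pi_pmf U d p) {f. \<forall>i\<in>J. P i f}"
    proof (rule prob_Pi_pmf_subset[symmetric, OF fin(1)])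
      show "V \<subseteq> U" by (auto simp: V_def)
    qed (rule P')
    also have "\<dots> \<le> q ^ card J"
    proof (rule insert.IH)
      show "D i \<subseteq> U" if "i \<in> J" for i using insert.prems(1)[of i] that by simp
      show "disjoint_family_on D J"
        by (rule disjoint_family_on_mono[OF _ insert.prems(2)]) blast
      show "P i f = P i g" if "i \<in> J" "\<And>x. x \<in> D i \<Longrightarrow> f x = g x" for i f g
        by (rule insert.prems(3)) (use that in auto)
      show "measure_pmf.prob (Pi_pmf U d p) {f. P i f} \<le> q" if "i \<in> J" for i
        by (rule insert.prems(4)) (use that in auto)
    qed
    finally show "measure_pmf.prob (Pi_pmf V d p) {g. \<forall>i\<in>J. P i g} \<le> q ^ card J" .
  qed (use q(2) in auto)
  also have "measure_pmf.prob (Pi_pmf (D j) d p) {f. P j f} = measure_pmf.prob (Pi_pmf U d p) {f. P j f}"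
  proof (rule prob_Pi_pmf_subset[symmetric, OF fin(1)])
    show "D j \<subseteq> U" by (rule insert.prems(1)) simp
    show "P j f = P j g" if "\<And>x. x \<in> D j \<Longrightarrow> f x = g x" for f g
      by (rule insert.prems(3)) (use that in auto)
  qed
  also have "q ^ card J * \<dots> \<le> q ^ card J * q"
    using insert.prems(4)[of j] q(2) by (intro mult_left_mono) auto
  finally show ?case using insert.hyps by (simp add: mult.commute)
qed

lemma exists_of_prob_less_1:
  assumes "measure_pmf.prob M {x. P x} < 1"
  obtains x where "x \<in> set_pmf M" "\<not> P x"
proof -
  have "\<exists>x\<in>set_pmf M. \<not> P x"
  proof (rule ccontr)
    assume "\<not> ?thesis"
    hence "measure_pmf.prob M {x. P x} = 1" by (subst measure_pmf.prob_eq_1) (auto simp: AE_measure_pmf_iff)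
    thus False using assms by simp
  qed
  thus ?thesis using that by blast
qed

text \<open>\<open>F\<close> is random of density \<open>p\<close>. An index succeeds with
  probability at least \<open>p ^ c * (1 - p) ^ c'\<close>. The degree bound yields \<open>r\<close>
  indices in \<open>I A\<close> whose sets \<open>C A i \<union> N A i\<close> are disjoint, so
  their failures are independent, and a union bound over \<open>AA\<close> finishes.\<close>

lemma choose_subset:
  fixes p :: real
  assumes U: "finite U" and p: "0 < p" "p < 1" and A: "finite AA"
    and I: "\<And>A. A \<in> AA \<Longrightarrow> finite (I A) \<and> r * ((c + c') * \<Delta>) \<le> card (I A)"
    and pos: "0 < (c + c') * \<Delta>"
    and C: "\<And>A i. A \<in> AA \<Longrightarrow> i \<in> I A \<Longrightarrow> C A i \<subseteq> U \<and> C A i \<noteq> {} \<and> card (C A i) \<le> c"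
    and N: "\<And>A i. A \<in> AA \<Longrightarrow> i \<in> I A \<Longrightarrow> N A i \<subseteq> U \<and> card (N A i) \<le> c' \<and> C A i \<inter> N A i = {}"
    and deg: "\<And>A x. A \<in> AA \<Longrightarrow> card {i \<in> I A. x \<in> C A i \<union> N A i} \<le> \<Delta>"
    and small: "card AA * (1 - p ^ c * (1 - p) ^ c') ^ r < 1"
  obtains F where "\<And>A. A \<in> AA \<Longrightarrow> \<exists>i\<in>I A. C A i \<subseteq> F \<and> N A i \<inter> F = {}"
proof -
  define M where "M = Pi_pmf U False (\<lambda>_. bernoulli_pmf p)"
  define E where "E A i f \<longleftrightarrow> (\<forall>x\<in>C A i. f x) \<and> (\<forall>x\<in>N A i. \<not> f x)" for A i and f :: "'a \<Rightarrow> bool"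
  define x where "x = p ^ c * (1 - p) ^ c'"
  have x01: "0 \<le> x" "x \<le> 1" using p by (auto simp: x_def intro!: mult_le_one power_le_one)
  have single: "measure_pmf.prob M {f. \<not> E A i f} \<le> 1 - x" if Ai: "A \<in> AA" "i \<in> I A" for A i
  proof -
    let ?B = "\<lambda>x. if x \<in> C A i then {True} else if x \<in> N A i then {False} else UNIV"
    have fin: "finite (C A i)" "finite (N A i)" using C[OF Ai] N[OF Ai] U finite_subset by blast+
    have "Pi U ?B = {f. E A i f}"
      using C[OF Ai] N[OF Ai] unfolding E_def Pi_def by (auto split: if_splits)
    moreover have "measure_pmf.prob M (Pi U ?B) = (\<Prod>x\<in>U. measure_pmf.prob (bernoulli_pmf p) (?B x))"
      unfolding M_def by (rule measure_Pi_pmf_Pi[OF U])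
    ultimately have "measure_pmf.prob M {f. E A i f} = (\<Prod>x\<in>U. measure_pmf.prob (bernoulli_pmf p) (?B x))" by simp
    also have "\<dots> = (\<Prod>x\<in>C A i \<union> N A i. measure_pmf.prob (bernoulli_pmf p) (?B x))"
      using U C[OF Ai] N[OF Ai] by (intro prod.mono_neutral_right) auto
    also have "\<dots> = (\<Prod>x\<in>C A i. measure_pmf.prob (bernoulli_pmf p) (?B x)) * (\<Prod>x\<in>N A i. measure_pmf.prob (bernoulli_pmf p) (?B x))"
      using fin N[OF Ai] by (intro prod.union_disjoint) auto
    also have "(\<Prod>x\<in>C A i. measure_pmf.prob (bernoulli_pmf p) (?B x)) = (\<Prod>x\<in>C A i. p)"
      using p by (intro prod.cong) (auto simp: measure_pmf_single)
    also have "(\<Prod>x\<in>N A i. measure_pmf.prob (bernoulli_pmf p) (?B x)) = (\<Prod>x\<in>N A i. 1 - p)"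
      using p N[OF Ai] by (intro prod.cong) (auto simp: measure_pmf_single)
    finally have "measure_pmf.prob M {f. E A i f} = p ^ card (C A i) * (1 - p) ^ card (N A i)" by simp
    also have "\<dots> \<ge> x"
      unfolding x_def using p C[OF Ai] N[OF Ai] by (intro mult_mono power_decreasing) auto
    finally show ?thesis
      using measure_pmf.prob_compl[of "{f. E A i f}" M] by (simp add: Compl_eq_Diff_UNIV[symmetric] Collect_neg_eq)
  qed
  have fail: "measure_pmf.prob M {f. \<forall>i\<in>I A. \<not> E A i f} \<le> (1 - x) ^ r" if Am: "A \<in> AA" for A
  proof -
    obtain I' where I': "I' \<subseteq> I A" "disjoint_family_on (\<lambda>i. C A i \<union> N A i) I'"
      "card (I A) \<le> card I' * ((c + c') * \<Delta>)"
    proof (rule disjoint_subfamily[of "I A" "\<lambda>i. C A i \<union> N A i" "c + c'" \<Delta>])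
      fix i assume i: "i \<in> I A"
      have "card (C A i \<union> N A i) \<le> card (C A i) + card (N A i)" by (rule card_Un_le)
      thus "C A i \<union> N A i \<noteq> {} \<and> finite (C A i \<union> N A i) \<and> card (C A i \<union> N A i) \<le> c + c'"
        using C[OF Am i] N[OF Am i] U finite_subset[of _ U] by auto
    qed (use I[OF Am] deg[OF Am] in auto)
    have fin: "finite I'" using I'(1) I[OF Am] finite_subset by blast
    have "r * ((c + c') * \<Delta>) \<le> card I' * ((c + c') * \<Delta>)" using I[OF Am] I'(3) by linarith
    hence "r \<le> card I'" using pos by (simp only: mult_le_cancel2)
    have "measure_pmf.prob M {f. \<forall>i\<in>I A. \<not> E A i f} \<le> measure_pmf.prob M {f. \<forall>i\<in>I'. \<not> E A i f}"
      using I'(1) by (intro measure_pmf.finite_measure_mono) auto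
    also have "\<dots> \<le> (1 - x) ^ card I'"
      unfolding M_def
    proof (rule prob_disjoint_events_le[OF U fin _ I'(2)])
      fix i assume "i \<in> I'"
      hence i: "i \<in> I A" using I'(1) by blast
      show "C A i \<union> N A i \<subseteq> U" using C[OF Am i] N[OF Am i] by blast
      show "measure_pmf.prob (Pi_pmf U False (\<lambda>_. bernoulli_pmf p)) {f. \<not> E A i f} \<le> 1 - x"
        using single[OF Am i] by (simp add: M_def)
      show "(\<not> E A i f) = (\<not> E A i g)" if "\<And>x. x \<in> C A i \<union> N A i \<Longrightarrow> f x = g x" for f g
        using that unfolding E_def by auto
    qed (use x01 in auto)
    also have "\<dots> \<le> (1 - x) ^ r" using x01 \<open>r \<le> card I'\<close> by (intro power_decreasing) auto
    finally show ?thesis .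
  qed
  have "measure_pmf.prob M {f. \<exists>A\<in>AA. \<forall>i\<in>I A. \<not> E A i f} < 1"
  proof -
    have "{f. \<exists>A\<in>AA. \<forall>i\<in>I A. \<not> E A i f} = (\<Union>A\<in>AA. {f. \<forall>i\<in>I A. \<not> E A i f})" by auto
    hence "measure_pmf.prob M {f. \<exists>A\<in>AA. \<forall>i\<in>I A. \<not> E A i f} \<le> (\<Sum>A\<in>AA. measure_pmf.prob M {f. \<forall>i\<in>I A. \<not> E A i f})"
      using A by (auto intro!: measure_pmf.finite_measure_subadditive_finite)
    also have "\<dots> \<le> (\<Sum>A\<in>AA. (1 - x) ^ r)" by (intro sum_mono fail)
    also have "\<dots> < 1" using small by (simp add: x_def)
    finally show ?thesis .
  qed
  then obtain f where "\<not> (\<exists>A\<in>AA. \<forall>i\<in>I A. \<not> E A i f)" by (rule exists_of_prob_less_1)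
  thus ?thesis by (intro that[of "{x. f x}"]) (fastforce simp: E_def)
qed

section \<open>Random rows\<close>

text \<open>Markov's inequality for a product of independent factors, the common form of the
  exponential-moment bounds below.\<close>

lemma prob_Pi_pmf_Markov:
  fixes g :: "'b \<Rightarrow> real"
  assumes fin: "finite I" "finite (set_pmf p)" and g: "\<And>x. g x \<ge> 0" and c: "c > 0"
  shows "measure_pmf.prob (Pi_pmf I d (\<lambda>_. p)) {f. c \<le> (\<Prod>i\<in>I. g (f i))}
    \<le> measure_pmf.expectation p g ^ card I / c"
proof -
  let ?M = "Pi_pmf I d (\<lambda>_. p)"
  have int: "integrable (measure_pmf p) g" using fin(2) by (rule integrable_measure_pmf_finite)
  have "measure_pmf.prob ?M {f \<in> space ?M. c \<le> (\<Prod>i\<in>I. g (f i))}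
      \<le> measure_pmf.expectation ?M (\<lambda>f. \<Prod>i\<in>I. g (f i)) / c"
  proof (rule integral_Markov_inequality_measure[where A = "{}"])
    show "integrable ?M (\<lambda>f. \<Prod>i\<in>I. g (f i))"
      using fin(1) int by (rule integrable_prod_Pi_pmf)
  qed (use c g in \<open>auto intro!: AE_pmfI prod_nonneg\<close>)
  also have "measure_pmf.expectation ?M (\<lambda>f. \<Prod>i\<in>I. g (f i)) = (\<Prod>i\<in>I. measure_pmf.expectation p g)"
    using fin(1) int g by (intro expectation_prod_Pi_pmf) auto
  finally show ?thesis by simp
qed

text \<open>The coordinates are exposed in increasing order of \<open>r\<close>.\<close>

lemma prob_sequential:
  fixes r :: "'i \<Rightarrow> 'o :: linorder"
  assumes fin: "finite I" and J: "J \<subseteq> I" and r: "inj_on r I"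
    and dep: "\<And>i f g. i \<in> J \<Longrightarrow> (\<And>j. j \<in> I \<Longrightarrow> r j \<le> r i \<Longrightarrow> f j = g j) \<Longrightarrow> Q i f \<longleftrightarrow> Q i g"
    and q: "\<And>i f. i \<in> J \<Longrightarrow> measure_pmf.prob (p i) {x. Q i (f(i := x))} \<le> q" "q \<ge> 0"
  shows "measure_pmf.prob (Pi_pmf I d p) {f. \<forall>i\<in>J. Q i f} \<le> q ^ card J"
  using fin J r dep q(1)
proof (induction I arbitrary: J rule: finite_ranking_induct[where f = r])
  case empty
  then show ?case by simp
next
  case (insert i I)
  show ?case
  proof (cases "i \<in> I")
    case True
    hence eq: "insert i I = I" by blast
    from insert.prems show ?thesis unfolding eq by (rule insert.IH)
  next
    case False
    define J' where "J' = J - {i}"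
    have J': "J' \<subseteq> I" "finite J'" "i \<notin> J'"
      using insert.prems(1) insert.hyps(1) finite_subset unfolding J'_def by auto
    have less: "r j < r i" if "j \<in> I" for j
      using insert.hyps(2)[OF that] insert.prems(2) that False unfolding inj_on_def
      by (metis insertCI order_le_less)
    have dep': "Q k f \<longleftrightarrow> Q k g" if k: "k \<in> J'" and fg: "\<And>j. j \<in> I \<Longrightarrow> r j \<le> r k \<Longrightarrow> f j = g j" for k f g
    proof (rule insert.prems(3))
      show "k \<in> J" using k by (simp add: J'_def)
      show "f j = g j" if "j \<in> insert i I" "r j \<le> r k" for j
      proof -
        have "k \<in> I" using k J'(1) by blast
        hence "j \<noteq> i" using that(2) less[of k] by auto
        thus ?thesis using that fg by blast
      qed
    qed
    have IH: "measure_pmf.prob (Pi_pmf I d p) {f. \<forall>k\<in>J'. Q k f} \<le> q ^ card J'"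
    proof (rule insert.IH)
      show "inj_on r I" using insert.prems(2) by (simp add: inj_on_insert)
      show "measure_pmf.prob (p k) {x. Q k (f(k := x))} \<le> q" if "k \<in> J'" for k f
        by (rule insert.prems(4)) (use that in \<open>simp add: J'_def\<close>)
    qed (use J' in simp, rule dep', assumption+)
    have depI: "(\<forall>k\<in>J'. Q k f) \<longleftrightarrow> (\<forall>k\<in>J'. Q k g)" if fg: "\<And>j. j \<in> I \<Longrightarrow> f j = g j" for f g
      using dep'[of _ f g] fg by blast
    show ?thesis
    proof (cases "i \<in> J")
      case False
      hence "J = J'" by (simp add: J'_def)
      have "measure_pmf.prob (Pi_pmf (insert i I) d p) {f. \<forall>k\<in>J'. Q k f} =
          measure_pmf.prob (Pi_pmf I d p) {f. \<forall>k\<in>J'. Q k f}"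
        by (rule prob_Pi_pmf_subset[OF _ _ depI]) (use insert.hyps(1) in auto)
      thus ?thesis using IH \<open>J = J'\<close> by simp
    next
      case True
      hence JJ: "J = insert i J'" by (auto simp: J'_def)
      have "(\<forall>k\<in>J'. Q k (f(i := y))) \<longleftrightarrow> (\<forall>k\<in>J'. Q k f)" for f y
        by (rule depI) (use \<open>i \<notin> I\<close> in auto)
      hence "measure_pmf.prob (Pi_pmf (insert i I) d p) {f. \<forall>k\<in>J. Q k f} =
          measure_pmf.prob (pair_pmf (p i) (Pi_pmf I d p))
            {(y, f). f \<in> {f. \<forall>k\<in>J'. Q k f} \<and> Q i (f(i := y))}"
        unfolding JJ Pi_pmf_insert[OF insert.hyps(1) \<open>i \<notin> I\<close>]
        by (auto simp: vimage_def case_prod_unfold intro!: arg_cong[where f = "measure_pmf.prob (pair_pmf (p i) (Pi_pmf I d p))"])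
      also have "\<dots> \<le> q * measure_pmf.prob (Pi_pmf I d p) {f. \<forall>k\<in>J'. Q k f}"
        by (rule prob_pair_pmf_le[OF insert.prems(4)[OF True] q(2)])
      also have "\<dots> \<le> q * q ^ card J'" using IH q(2) by (rule mult_left_mono)
      finally show ?thesis using J' by (simp add: JJ)
    qed
  qed
qed

section \<open>Tail bounds from joint bounds on k events\<close>

lemma power_le_exp_fact: "real k ^ k \<le> exp (real k) * fact k"
proof -
  have "(\<Sum>i<Suc k. real k ^ i / fact i) \<le> exp (real k)"
  proof -
    have "summable (\<lambda>i. real k ^ i / fact i)"
      using summable_exp[of "real k"] by (simp add: field_simps)
    hence "(\<Sum>i<Suc k. real k ^ i / fact i) \<le> (\<Sum>i. real k ^ i / fact i)"
      by (intro sum_le_suminf) auto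
    thus ?thesis by (simp add: exp_def scaleR_conv_of_real divide_inverse mult.commute)
  qed
  moreover have "real k ^ k / fact k \<le> (\<Sum>i<Suc k. real k ^ i / fact i)"
    by (intro member_le_sum) auto
  ultimately have "real k ^ k / fact k \<le> exp (real k)" by linarith
  thus ?thesis by (simp add: field_simps)
qed

text \<open>The usual estimate of a binomial coefficient by \<open>(e * m / k) ^ k\<close>,
  multiplied out so that \<open>k = 0\<close> is covered.\<close>

lemma binomial_le_exp: "real (m choose k) * real k ^ k \<le> (exp 1 * real m) ^ k"
proof -
  have "real (m choose k) * real k ^ k \<le> real (m choose k) * (exp (real k) * fact k)"
    by (intro mult_left_mono power_le_exp_fact) auto
  also have "\<dots> = exp (real k) * real ((m choose k) * fact k)" by simp
  also have "\<dots> \<le> exp (real k) * real (m ^ k)"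
    by (intro mult_left_mono of_nat_mono binomial_fact_pow) auto
  also have "\<dots> = (exp 1 * real m) ^ k"
    by (simp add: power_mult_distrib exp_of_nat_mult[symmetric])
  finally show ?thesis .
qed

text \<open>A union bound over the \<open>k\<close>-subsets. It asks for a joint bound
  \<open>q ^ k\<close> rather than for independence, which is what sequential exposure
  delivers.\<close>

lemma prob_many_le:
  assumes fin: "finite I" and k: "k > 0"
    and bound: "\<And>J. J \<subseteq> I \<Longrightarrow> card J = k \<Longrightarrow> measure_pmf.prob M {f. \<forall>i\<in>J. Q i f} \<le> q ^ k"
    and q: "q \<ge> 0"
  shows "measure_pmf.prob M {f. k \<le> card {i \<in> I. Q i f}} \<le> (exp 1 * real (card I) * q / real k) ^ k"
proof -
  define C where "C = {J. J \<subseteq> I \<and> card J = k}"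
  have finC: "finite C" by (rule finite_subset[of _ "Pow I"]) (use fin in \<open>auto simp: C_def\<close>)
  have "{f. k \<le> card {i \<in> I. Q i f}} \<subseteq> (\<Union>J\<in>C. {f. \<forall>i\<in>J. Q i f})"
  proof
    fix f assume "f \<in> {f. k \<le> card {i \<in> I. Q i f}}"
    then obtain J where J: "J \<subseteq> {i \<in> I. Q i f}" "card J = k"
      by (auto intro: obtain_subset_with_card_n)
    hence "J \<in> C" by (auto simp: C_def)
    thus "f \<in> (\<Union>J\<in>C. {f. \<forall>i\<in>J. Q i f})" using J by blast
  qed
  hence "measure_pmf.prob M {f. k \<le> card {i \<in> I. Q i f}} \<le> measure_pmf.prob M (\<Union>J\<in>C. {f. \<forall>i\<in>J. Q i f})"
    by (intro measure_pmf.finite_measure_mono) auto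
  also have "\<dots> \<le> (\<Sum>J\<in>C. measure_pmf.prob M {f. \<forall>i\<in>J. Q i f})"
    using finC by (intro measure_pmf.finite_measure_subadditive_finite) auto
  also have "\<dots> \<le> (\<Sum>J\<in>C. q ^ k)" using bound by (intro sum_mono) (auto simp: C_def)
  also have "\<dots> = real (card I choose k) * q ^ k" using n_subsets[OF fin] by (simp add: C_def)
  also have "\<dots> \<le> (exp 1 * real (card I) / real k) ^ k * q ^ k"
    using binomial_le_exp[of "card I" k] k q
    by (intro mult_right_mono) (auto simp: power_divide field_simps)
  also have "\<dots> = (exp 1 * real (card I) * q / real k) ^ k"
    by (simp add: power_mult_distrib[symmetric])
  finally show ?thesis .
qed

text \<open>Membership and label in one number: the label \<open>0\<close> means \<open>v \<notin> S i\<close>.\<close>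

definition label_pmf :: "nat \<Rightarrow> real \<Rightarrow> nat pmf" where
  "label_pmf s \<gamma> = bernoulli_pmf \<gamma> \<bind> (\<lambda>b. if b then pmf_of_set {1..s} else return_pmf 0)"

definition row_pmf :: "nat \<Rightarrow> nat \<Rightarrow> real \<Rightarrow> (nat \<Rightarrow> nat) pmf" where
  "row_pmf s n \<gamma> = Pi_pmf {1..n} 0 (\<lambda>_. label_pmf s \<gamma>)"

definition rows_pmf :: "nat \<Rightarrow> nat \<Rightarrow> nat \<Rightarrow> real \<Rightarrow> (nat \<Rightarrow> nat \<Rightarrow> nat) pmf" where
  "rows_pmf s n m \<gamma> = Pi_pmf {1..m} (\<lambda>_. 0) (\<lambda>_. row_pmf s n \<gamma>)"

locale labels =
  fixes s :: nat and \<gamma> :: real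
  assumes s: "1 \<le> s" and \<gamma>: "0 < \<gamma>" "\<gamma> < 1"
begin

lemma set_label_pmf: "set_pmf (label_pmf s \<gamma>) \<subseteq> {0..s}"
  using s by (auto simp: label_pmf_def set_bind_pmf split: if_splits)

lemma pmf_label:
  "pmf (label_pmf s \<gamma>) 0 = 1 - \<gamma>" "j \<in> {1..s} \<Longrightarrow> pmf (label_pmf s \<gamma>) j = \<gamma> / s"
proof -
  have *: "pmf (label_pmf s \<gamma>) j = \<gamma> * pmf (pmf_of_set {1..s}) j + (1 - \<gamma>) * pmf (return_pmf 0) j" for j
    unfolding label_pmf_def pmf_bind using \<gamma> by simp
  show "pmf (label_pmf s \<gamma>) 0 = 1 - \<gamma>" "j \<in> {1..s} \<Longrightarrow> pmf (label_pmf s \<gamma>) j = \<gamma> / s"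
    unfolding * using s by (auto simp: indicator_def)
qed

lemma prob_label_nonzero: "measure_pmf.prob (label_pmf s \<gamma>) {x. x \<noteq> 0} = \<gamma>"
proof -
  have "measure_pmf.prob (label_pmf s \<gamma>) {x. x \<noteq> 0} = 1 - measure_pmf.prob (label_pmf s \<gamma>) {0}"
    using measure_pmf.prob_compl[of "{0}" "label_pmf s \<gamma>"]
    by (simp add: Collect_neg_eq Compl_eq_Diff_UNIV del: neq0_conv)
  thus ?thesis using pmf_label(1) by (simp add: measure_pmf_single)
qed

lemma finite_set_row: "finite (set_pmf (row_pmf s n \<gamma>))"
proof -
  have "finite (set_pmf (label_pmf s \<gamma>))" using set_label_pmf finite_subset by blast
  thus ?thesis unfolding row_pmf_def by (simp add: set_Pi_pmf finite_PiE_dflt)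
qed

lemma prob_row_supset:
  assumes "T \<subseteq> {1..n}"
  shows "measure_pmf.prob (row_pmf s n \<gamma>) {x. \<forall>v\<in>T. x v \<noteq> 0} = \<gamma> ^ card T"
proof -
  have fin: "finite T" using assms finite_subset by blast
  have eq: "{x. \<forall>v\<in>T. x v \<noteq> 0} = Pi {1..n} (\<lambda>v. if v \<in> T then {x. x \<noteq> 0} else UNIV)"
    using assms by (auto simp: Pi_def)
  have "measure_pmf.prob (row_pmf s n \<gamma>) {x. \<forall>v\<in>T. x v \<noteq> 0} =
     (\<Prod>v\<in>{1..n}. measure_pmf.prob (label_pmf s \<gamma>) (if v \<in> T then {x. x \<noteq> 0} else UNIV))"
    unfolding row_pmf_def eq by (rule measure_Pi_pmf_Pi) simp
  also have "\<dots> = (\<Prod>v\<in>T. measure_pmf.prob (label_pmf s \<gamma>) (if v \<in> T then {x. x \<noteq> 0} else UNIV))"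
    using assms by (intro prod.mono_neutral_right) auto
  also have "\<dots> = (\<Prod>v\<in>T. \<gamma>)" by (intro prod.cong) (auto simp: prob_label_nonzero simp del: neq0_conv)
  finally show ?thesis by simp
qed

lemma prob_rows_incidences:
  assumes "Q \<subseteq> {1..m} \<times> {1..n}"
  shows "measure_pmf.prob (rows_pmf s n m \<gamma>) {f. \<forall>(i, v)\<in>Q. f i v \<noteq> 0} = \<gamma> ^ card Q"
proof -
  have fin: "finite Q" using assms finite_subset by blast
  have eq: "{f. \<forall>(i, v)\<in>Q. f i v \<noteq> 0} = Pi {1..m} (\<lambda>i. {x. \<forall>v\<in>Q `` {i}. x v \<noteq> 0})"
    using assms by (fastforce simp: Pi_def)
  have "measure_pmf.prob (rows_pmf s n m \<gamma>) {f. \<forall>(i, v)\<in>Q. f i v \<noteq> 0} =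
     (\<Prod>i\<in>{1..m}. measure_pmf.prob (row_pmf s n \<gamma>) {x. \<forall>v\<in>Q `` {i}. x v \<noteq> 0})"
    unfolding rows_pmf_def eq by (rule measure_Pi_pmf_Pi) simp
  also have "\<dots> = (\<Prod>i\<in>{1..m}. \<gamma> ^ card (Q `` {i}))"
    using assms by (intro prod.cong refl prob_row_supset) auto
  also have "\<dots> = \<gamma> ^ (\<Sum>i\<in>{1..m}. card (Q `` {i}))" by (simp add: power_sum)
  also have "(\<Sum>i\<in>{1..m}. card (Q `` {i})) = card (Sigma {1..m} (\<lambda>i. Q `` {i}))"
    using fin by (subst card_SigmaI) (auto simp: finite_Image)
  also have "Sigma {1..m} (\<lambda>i. Q `` {i}) = Q" using assms by auto
  finally show ?thesis .
qed

text \<open>Disjoint sets of incidences are independent. Summing over disjoint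
  \<open>K\<close>-tuples of patterns and then extending the sum to all \<open>K\<close>-tuples
  gives the \<open>K\<close>-th power of the sum for one pattern.\<close>

lemma prob_disjoint_patterns:
  assumes fin: "finite P" and Q: "\<And>b. b \<in> P \<Longrightarrow> Q b \<subseteq> {1..m} \<times> {1..n}"
  shows "measure_pmf.prob (rows_pmf s n m \<gamma>)
     {f. \<exists>g. (\<forall>k<K. g k \<in> P \<and> (\<forall>(i, v)\<in>Q (g k). f i v \<noteq> (0::nat))) \<and> disjoint_family_on (\<lambda>k. Q (g k)) {..<K}}
     \<le> (\<Sum>b\<in>P. \<gamma> ^ card (Q b)) ^ K"
proof -
  let ?M = "rows_pmf s n m \<gamma>"
  define G where "G = {g \<in> PiE {..<K} (\<lambda>_. P). disjoint_family_on (\<lambda>k. Q (g k)) {..<K}}"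
  define E where "E g = {f. \<forall>(i, v)\<in>(\<Union>k<K. Q (g k)). f i v \<noteq> (0::nat)}" for g
  have finP: "finite (PiE {..<K} (\<lambda>_. P))" using fin by (intro finite_PiE) auto
  hence finG: "finite G" by (simp add: G_def)
  have finQ: "finite (Q b)" if "b \<in> P" for b using Q[OF that] finite_subset by blast
  have "{f. \<exists>g. (\<forall>k<K. g k \<in> P \<and> (\<forall>(i, v)\<in>Q (g k). f i v \<noteq> (0::nat))) \<and> disjoint_family_on (\<lambda>k. Q (g k)) {..<K}} \<subseteq> (\<Union>g\<in>G. E g)"
  proof
    fix f assume "f \<in> {f. \<exists>g. (\<forall>k<K. g k \<in> P \<and> (\<forall>(i, v)\<in>Q (g k). f i v \<noteq> (0::nat))) \<and> disjoint_family_on (\<lambda>k. Q (g k)) {..<K}}"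
    then obtain g where g: "\<forall>k<K. g k \<in> P \<and> (\<forall>(i, v)\<in>Q (g k). f i v \<noteq> 0)" "disjoint_family_on (\<lambda>k. Q (g k)) {..<K}" by blast
    have "restrict g {..<K} \<in> G" using g by (auto simp: G_def disjoint_family_on_def)
    moreover have "f \<in> E (restrict g {..<K})" using g(1) by (auto simp: E_def)
    ultimately show "f \<in> (\<Union>g\<in>G. E g)" by blast
  qed
  hence "measure_pmf.prob ?M {f. \<exists>g. (\<forall>k<K. g k \<in> P \<and> (\<forall>(i, v)\<in>Q (g k). f i v \<noteq> (0::nat))) \<and> disjoint_family_on (\<lambda>k. Q (g k)) {..<K}}
      \<le> measure_pmf.prob ?M (\<Union>g\<in>G. E g)"
    by (intro measure_pmf.finite_measure_mono) auto
  also have "\<dots> \<le> (\<Sum>g\<in>G. measure_pmf.prob ?M (E g))"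
    using finG by (intro measure_pmf.finite_measure_subadditive_finite) auto
  also have "\<dots> = (\<Sum>g\<in>G. \<Prod>k<K. \<gamma> ^ card (Q (g k)))"
  proof (intro sum.cong refl)
    fix g assume g: "g \<in> G"
    have gP: "g k \<in> P" if "k < K" for k using g that by (auto simp: G_def)
    have "measure_pmf.prob ?M (E g) = \<gamma> ^ card (\<Union>k<K. Q (g k))"
      unfolding E_def by (rule prob_rows_incidences) (use Q gP in blast)
    also have "card (\<Union>k<K. Q (g k)) = (\<Sum>k<K. card (Q (g k)))"
    proof (rule card_UN_disjoint)
      show "\<forall>k\<in>{..<K}. finite (Q (g k))" using gP finQ by blast
      show "\<forall>k\<in>{..<K}. \<forall>l\<in>{..<K}. k \<noteq> l \<longrightarrow> Q (g k) \<inter> Q (g l) = {}"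
        using g unfolding G_def disjoint_family_on_def by blast
    qed simp
    finally show "measure_pmf.prob ?M (E g) = (\<Prod>k<K. \<gamma> ^ card (Q (g k)))" by (simp add: power_sum)
  qed
  also have "\<dots> \<le> (\<Sum>g\<in>PiE {..<K} (\<lambda>_. P). \<Prod>k<K. \<gamma> ^ card (Q (g k)))"
  proof (rule sum_mono2[OF finP])
    show "G \<subseteq> PiE {..<K} (\<lambda>_. P)" by (auto simp: G_def)
    show "0 \<le> (\<Prod>k<K. \<gamma> ^ card (Q (g k)))" for g using \<gamma> by (intro prod_nonneg) simp
  qed
  also have "\<dots> = (\<Prod>k<K. \<Sum>b\<in>P. \<gamma> ^ card (Q b))"
    by (rule prod_sum_PiE[symmetric]) (simp_all add: fin)
  finally show ?thesis by simp
qed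

end

section \<open>Cores through an edge\<close>

lemma card_small_subsets: "card {Z. Z \<subseteq> {1..n::nat} \<and> card Z \<le> k} \<le> (n + 1) ^ k"
proof -
  let ?L = "{xs. set xs \<subseteq> {0..n} \<and> length xs = k}"
  have "{Z. Z \<subseteq> {1..n} \<and> card Z \<le> k} \<subseteq> (\<lambda>xs. set xs - {0}) ` ?L"
  proof
    fix Z assume Z: "Z \<in> {Z. Z \<subseteq> {1..n} \<and> card Z \<le> k}"
    hence fin: "finite Z" using finite_subset by blast
    define xs where "xs = sorted_list_of_set Z @ replicate (k - card Z) 0"
    have "length xs = k" using Z fin by (simp add: xs_def)
    moreover have "set xs \<subseteq> {0..n}" using Z fin by (auto simp: xs_def)
    moreover have "set xs - {0} = Z" using Z fin by (auto simp: xs_def)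
    ultimately show "Z \<in> (\<lambda>xs. set xs - {0}) ` ?L" by blast
  qed
  hence "card {Z. Z \<subseteq> {1..n} \<and> card Z \<le> k} \<le> card ?L"
    by (intro surj_card_le finite_lists_length_eq) auto
  also have "\<dots> = (n + 1) ^ k" by (simp add: card_lists_length_eq)
  finally show ?thesis .
qed

lemma sum_Pow_power:
  fixes x :: real
  assumes "finite A"
  shows "(\<Sum>X\<in>Pow A. x ^ card X) = (1 + x) ^ card A"
  using prod_add[OF assms, of "\<lambda>_. x" "\<lambda>_. 1"] by (simp add: add.commute)

lemma one_plus_inverse_power_le: "(1 + 1 / real n) ^ n \<le> 3"
proof (cases "n = 0")
  case False
  hence "(1 + 1 / real n) ^ n \<le> exp 1" by (intro exp_ge_one_plus_x_over_n_power_n) auto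
  also have "\<dots> \<le> 3" using exp_le by simp
  finally show ?thesis .
qed simp

context exponents
begin

text \<open>A petal extends the kernel \<open>(Z, J)\<close> by the nodes \<open>Y\<close> and the colours \<open>J'\<close>; \<open>Q\<close> is the set of new
  incidences.\<close>

definition petals :: "nat \<Rightarrow> nat \<Rightarrow> nat set \<Rightarrow> nat set \<Rightarrow> ((nat set \<times> nat set) \<times> (nat \<times> nat) set) set" where
  "petals n m Z J = {((Y, J'), Q). Y \<subseteq> {1..n} \<and> J' \<subseteq> {1..m} \<and> Q \<subseteq> (J \<union> J') \<times> (Z \<union> Y) \<and> Q \<noteq> {} \<and>
     card Y \<le> t \<and> card J' \<le> t\<^sup>2 \<and> real (card Y) + real (card J') * \<delta> + real (card Q) * (\<alpha> - 1) \<le> 0}"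

text \<open>Petals may overlap in nodes and colours; only their incidences have to be disjoint,
  since these are the independent choices. Cores do not occur, so the event depends on the
  memberships alone.\<close>

definition crowded :: "nat \<Rightarrow> nat \<Rightarrow> nat \<Rightarrow> (nat \<times> nat) set \<Rightarrow> bool" where
  "crowded n m K R \<longleftrightarrow> (\<exists>Z J g. Z \<subseteq> {1..n} \<and> card Z \<le> t \<and> J \<subseteq> {1..m} \<and> card J \<le> t\<^sup>2 \<and>
     (\<forall>k<K. g k \<in> petals n m Z J \<and> snd (g k) \<subseteq> R) \<and> disjoint_family_on (\<lambda>k. snd (g k)) {..<K})"

text \<open>The exponent condition bounds the weight of a petal by
  \<open>(1 / n) ^ card Y * (1 / m) ^ card J' / \<Lambda>\<close>, where one factor
  \<open>1 / \<Lambda>\<close> is available because \<open>Q\<close> is nonempty. Summing over all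
  \<open>Y\<close> and \<open>J'\<close> gives at most 3 * 3, by
  \<open>(1 + 1 / n) ^ n \<le> 3\<close>. For given \<open>Y\<close> and \<open>J'\<close> there are
  at most 2 to the \<open>(t^2 + t^2) * (t + t) = 4 * t^3\<close> choices of
  \<open>Q\<close>.\<close>

lemma petals_weight:
  assumes Z: "Z \<subseteq> {1..n}" "card Z \<le> t" and J: "J \<subseteq> {1..m}" "card J \<le> t\<^sup>2"
    and n: "1 \<le> n" and m: "1 \<le> m" "real m \<le> real n powr \<delta>"
    and \<gamma>: "0 \<le> \<gamma>" "\<gamma> \<le> real n powr (\<alpha> - 1) / \<Lambda>" and \<Lambda>: "1 \<le> \<Lambda>"
  shows "finite (petals n m Z J)" "(\<Sum>b\<in>petals n m Z J. \<gamma> ^ card (snd b)) \<le> 9 * 2 ^ (4 * t ^ 3) / \<Lambda>"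
proof -
  define B :: "(nat set \<times> nat set) set" where "B = Pow {1..n} \<times> Pow {1..m}"
  define Qs where "Qs b = (if card (fst b) \<le> t \<and> card (snd b) \<le> t\<^sup>2 then Pow ((J \<union> snd b) \<times> (Z \<union> fst b)) else {})"
    for b :: "nat set \<times> nat set"
  define wt where "wt b = (1 / real n) ^ card (fst b) * (1 / real m) ^ card (snd b) / \<Lambda>"
    for b :: "nat set \<times> nat set"
  have finB: "finite B" by (simp add: B_def)
  have fin: "finite Z" "finite J" using Z J finite_subset by blast+
  have finb: "finite (fst b)" "finite (snd b)" if "b \<in> B" for b
    using that finite_subset unfolding B_def by fastforce+
  have finQs: "finite (Qs b)" if "b \<in> B" for b
    unfolding Qs_def using fin finb[OF that] by auto
  have cardQs: "card (Qs b) \<le> 2 ^ (4 * t ^ 3)" if b: "b \<in> B" for b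
  proof (cases "card (fst b) \<le> t \<and> card (snd b) \<le> t\<^sup>2")
    case True
    have "card ((J \<union> snd b) \<times> (Z \<union> fst b)) \<le> (t\<^sup>2 + t\<^sup>2) * (t + t)"
      unfolding card_cartesian_product
      using True Z J card_Un_le[of J "snd b"] card_Un_le[of Z "fst b"] by (intro mult_le_mono) linarith+
    also have "\<dots> = 4 * t ^ 3" by (simp add: power2_eq_square power3_eq_cube algebra_simps)
    finally have "(2::nat) ^ card ((J \<union> snd b) \<times> (Z \<union> fst b)) \<le> 2 ^ (4 * t ^ 3)"
      by (intro power_increasing) auto
    thus ?thesis using True fin finb[OF b] by (simp add: Qs_def card_Pow)
  next
    case False
    hence "Qs b = {}" by (simp only: Qs_def if_False)
    thus ?thesis by simp
  qed
  have sub: "petals n m Z J \<subseteq> Sigma B Qs"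
    by (auto simp: petals_def B_def Qs_def)
  have finS: "finite (Sigma B Qs)" using finB finQs by (intro finite_SigmaI) auto
  show "finite (petals n m Z J)" using sub finS finite_subset by blast
  have each: "\<gamma> ^ card (snd b) \<le> wt (fst b)" if b: "b \<in> petals n m Z J" for b
  proof -
    obtain Y J' Q where bb: "b = ((Y, J'), Q)" by (metis surj_pair)
    have Q: "Q \<noteq> {}" "real (card Y) + real (card J') * \<delta> + real (card Q) * (\<alpha> - 1) \<le> 0"
      using b by (auto simp: bb petals_def)
    have "b \<in> Sigma B Qs" using b sub by blast
    hence "(Y, J') \<in> B" "Q \<subseteq> (J \<union> J') \<times> (Z \<union> Y)" by (auto simp: bb Qs_def split: if_splits)
    hence "finite Q" using fin finb[of "(Y, J')"] finite_subset by fastforce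
    hence l: "1 \<le> card Q" using Q(1) by (simp add: Suc_leI card_gt_0_iff)
    have "\<gamma> ^ card Q \<le> (real n powr (\<alpha> - 1) / \<Lambda>) ^ card Q" using \<gamma> by (rule power_mono[rotated])
    also have "\<dots> = (real n powr (\<alpha> - 1)) ^ card Q / \<Lambda> ^ card Q" by (rule power_divide)
    also have "\<dots> \<le> (real n powr (\<alpha> - 1)) ^ card Q / \<Lambda>"
      using \<Lambda> l self_le_power[of \<Lambda> "card Q"] by (intro divide_left_mono) auto
    also have "(real n powr (\<alpha> - 1)) ^ card Q = real n powr (real (card Q) * (\<alpha> - 1))"
      using n by (simp add: powr_realpow[symmetric] powr_powr mult.commute)
    also have "\<dots> \<le> real n powr (- real (card Y) + - (real (card J') * \<delta>))"
      using Q(2) n by (intro powr_mono) auto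
    also have "\<dots> = (1 / real n) ^ card Y * (1 / (real n powr \<delta>)) ^ card J'"
    proof -
      have "real n powr (- real (card Y)) = (1 / real n) ^ card Y"
        using n by (simp add: powr_minus powr_realpow power_one_over divide_inverse power_inverse)
      moreover have "real n powr (- (real (card J') * \<delta>)) = (1 / (real n powr \<delta>)) ^ card J'"
        using n by (simp add: powr_minus powr_realpow[symmetric] powr_powr mult.commute divide_inverse power_inverse)
      ultimately show ?thesis unfolding powr_add by simp
    qed
    also have "\<dots> \<le> (1 / real n) ^ card Y * (1 / real m) ^ card J'"
      using m n by (intro mult_left_mono power_mono divide_left_mono) auto
    finally show ?thesis using \<Lambda> by (simp add: bb wt_def divide_right_mono)
  qed
  have wt_nn: "wt b \<ge> 0" for b using \<Lambda> by (simp add: wt_def)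
  have "(\<Sum>b\<in>petals n m Z J. \<gamma> ^ card (snd b)) \<le> (\<Sum>b\<in>petals n m Z J. wt (fst b))"
    by (intro sum_mono each)
  also have "\<dots> \<le> (\<Sum>b\<in>Sigma B Qs. wt (fst b))"
    using sub finS wt_nn by (intro sum_mono2) auto
  also have "\<dots> = (\<Sum>b\<in>B. \<Sum>Q\<in>Qs b. wt b)"
    using finB finQs by (subst sum.Sigma) (auto simp: case_prod_unfold)
  also have "\<dots> = (\<Sum>b\<in>B. real (card (Qs b)) * wt b)" by simp
  also have "\<dots> \<le> (\<Sum>b\<in>B. 2 ^ (4 * t ^ 3) * wt b)"
  proof (intro sum_mono mult_right_mono wt_nn)
    fix b assume "b \<in> B"
    hence "real (card (Qs b)) \<le> real (2 ^ (4 * t ^ 3))" by (intro of_nat_mono cardQs)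
    thus "real (card (Qs b)) \<le> 2 ^ (4 * t ^ 3)" by simp
  qed
  also have "\<dots> = 2 ^ (4 * t ^ 3) / \<Lambda> * (\<Sum>(Y, J')\<in>Pow {1..n} \<times> Pow {1..m}. (1 / real n) ^ card Y * (1 / real m) ^ card J')"
    by (simp add: B_def wt_def sum_distrib_left case_prod_unfold field_simps)
  also have "(\<Sum>(Y, J')\<in>Pow {1..n} \<times> Pow {1..m}. (1 / real n) ^ card Y * (1 / real m) ^ card J') =
      (1 + 1 / real n) ^ n * (1 + 1 / real m) ^ m"
    using sum_Pow_power[of "{1..n}" "1 / real n"] sum_Pow_power[of "{1..m}" "1 / real m"]
    by (simp add: sum.cartesian_product[symmetric] sum_product[symmetric])
  also have "2 ^ (4 * t ^ 3) / \<Lambda> * \<dots> \<le> 2 ^ (4 * t ^ 3) / \<Lambda> * (3 * 3)"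
    using \<Lambda> by (intro mult_left_mono mult_mono one_plus_inverse_power_le) auto
  finally show "(\<Sum>b\<in>petals n m Z J. \<gamma> ^ card (snd b)) \<le> 9 * 2 ^ (4 * t ^ 3) / \<Lambda>" by (simp add: mult.commute)
qed

text \<open>The first factor counts the kernels \<open>(Z, J)\<close>. It is polynomial in
  \<open>n\<close> when \<open>m\<close> is, so a \<open>K\<close> of order log n makes the second
  factor win.\<close>

lemma prob_crowded:
  assumes n: "1 \<le> n" and m: "1 \<le> m" "real m \<le> real n powr \<delta>"
    and gam: "0 < \<gamma>" "\<gamma> < 1" "\<gamma> \<le> real n powr (\<alpha> - 1) / \<Lambda>" and \<Lambda>: "1 \<le> \<Lambda>"
  shows "measure_pmf.prob (rows_pmf s n m \<gamma>)
      {f. crowded n m K {(i, v). i \<in> {1..m} \<and> v \<in> {1..n} \<and> f i v \<noteq> 0}}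
    \<le> real ((n + 1) ^ t * (m + 1) ^ t\<^sup>2) * (9 * 2 ^ (4 * t ^ 3) / \<Lambda>) ^ K"
proof -
  let ?M = "rows_pmf s n m \<gamma>"
  interpret labels s \<gamma> using s3 gam by unfold_locales auto
  define C where "C = {Z. Z \<subseteq> {1..n} \<and> card Z \<le> t} \<times> {J. J \<subseteq> {1..m} \<and> card J \<le> t\<^sup>2}"
  define E where "E ZJ = {f. \<exists>g. (\<forall>k<K. g k \<in> petals n m (fst ZJ) (snd ZJ) \<and> (\<forall>(i, v)\<in>snd (g k). f i v \<noteq> (0::nat))) \<and>
     disjoint_family_on (\<lambda>k. snd (g k)) {..<K}}" for ZJ
  have finC: "finite C"
  proof -
    have "finite {Z. Z \<subseteq> {1..n} \<and> card Z \<le> k}" for n k :: nat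
      by (rule finite_subset[of _ "Pow {1..n}"]) auto
    thus ?thesis by (simp add: C_def)
  qed
  have E: "measure_pmf.prob ?M (E ZJ) \<le> (9 * 2 ^ (4 * t ^ 3) / \<Lambda>) ^ K" if ZJ: "ZJ \<in> C" for ZJ
  proof -
    have *: "fst ZJ \<subseteq> {1..n}" "card (fst ZJ) \<le> t" "snd ZJ \<subseteq> {1..m}" "card (snd ZJ) \<le> t\<^sup>2"
      using ZJ by (auto simp: C_def)
    note pw = petals_weight[OF * n m less_imp_le[OF gam(1)] gam(3) \<Lambda>]
    have "measure_pmf.prob ?M (E ZJ) \<le> (\<Sum>b\<in>petals n m (fst ZJ) (snd ZJ). \<gamma> ^ card (snd b)) ^ K"
      unfolding E_def
    proof (rule prob_disjoint_patterns[OF pw(1)])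
      fix b assume "b \<in> petals n m (fst ZJ) (snd ZJ)"
      then obtain Y J' Q where b: "b = ((Y, J'), Q)" "Y \<subseteq> {1..n}" "J' \<subseteq> {1..m}"
        "Q \<subseteq> (snd ZJ \<union> J') \<times> (fst ZJ \<union> Y)" by (auto simp: petals_def)
      have "(snd ZJ \<union> J') \<times> (fst ZJ \<union> Y) \<subseteq> {1..m} \<times> {1..n}"
        using b(2,3) * by (intro Sigma_mono) blast+
      with b(4) show "snd b \<subseteq> {1..m} \<times> {1..n}" unfolding b(1) by (simp only: snd_conv order_trans)
    qed
    also have "\<dots> \<le> (9 * 2 ^ (4 * t ^ 3) / \<Lambda>) ^ K"
      using gam by (intro power_mono pw(2) sum_nonneg) auto
    finally show ?thesis .
  qed
  have "{f. crowded n m K {(i, v). i \<in> {1..m} \<and> v \<in> {1..n} \<and> f i v \<noteq> 0}} \<subseteq> (\<Union>ZJ\<in>C. E ZJ)"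
  proof
    fix f :: "nat \<Rightarrow> nat \<Rightarrow> nat"
    assume "f \<in> {f. crowded n m K {(i, v). i \<in> {1..m} \<and> v \<in> {1..n} \<and> f i v \<noteq> 0}}"
    then obtain Z J g where *: "Z \<subseteq> {1..n}" "card Z \<le> t" "J \<subseteq> {1..m}" "card J \<le> t\<^sup>2"
      "\<And>k. k < K \<Longrightarrow> g k \<in> petals n m Z J \<and> snd (g k) \<subseteq> {(i, v). i \<in> {1..m} \<and> v \<in> {1..n} \<and> f i v \<noteq> 0}"
      "disjoint_family_on (\<lambda>k. snd (g k)) {..<K}" unfolding crowded_def by blast
    have "f \<in> E (Z, J)" unfolding E_def using *(5,6) by fastforce
    moreover have "(Z, J) \<in> C" using * by (simp add: C_def)
    ultimately show "f \<in> (\<Union>ZJ\<in>C. E ZJ)" by blast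
  qed
  hence "measure_pmf.prob ?M {f. crowded n m K {(i, v). i \<in> {1..m} \<and> v \<in> {1..n} \<and> f i v \<noteq> 0}}
      \<le> measure_pmf.prob ?M (\<Union>ZJ\<in>C. E ZJ)"
    by (rule measure_pmf.finite_measure_mono) simp
  also have "\<dots> \<le> (\<Sum>ZJ\<in>C. measure_pmf.prob ?M (E ZJ))"
    by (rule measure_pmf.finite_measure_subadditive_finite[OF finC]) simp
  also have "\<dots> \<le> (\<Sum>ZJ\<in>C. (9 * 2 ^ (4 * t ^ 3) / \<Lambda>) ^ K)" by (intro sum_mono E)
  also have "\<dots> = real (card C) * (9 * 2 ^ (4 * t ^ 3) / \<Lambda>) ^ K" by simp
  also have "\<dots> \<le> real ((n + 1) ^ t * (m + 1) ^ t\<^sup>2) * (9 * 2 ^ (4 * t ^ 3) / \<Lambda>) ^ K"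
    unfolding C_def card_cartesian_product using \<Lambda>
    by (intro mult_right_mono of_nat_mono mult_le_mono card_small_subsets) auto
  finally show ?thesis .
qed

end

context layout
begin

definition incidences :: "(nat \<times> nat) set" where
  "incidences = {(i, v). i \<in> {1..m} \<and> v \<in> S i}"

text \<open>\<open>kernel_exponent\<close> is the exponent condition of a petal. New incidences
  exist: a colour missing from \<open>J\<close> has nodes in \<open>Y\<close>, and a node missing
  from \<open>Z\<close> is joined to a node of \<open>Z\<close> by an edge, whose colour contains
  it.\<close>

lemma core_petal:
  assumes Y: "Y \<in> cores" and Z: "Z \<subseteq> Y" "2 \<le> card Z" and J: "J \<subseteq> col Y" "col Z \<subseteq> J"
    and ne: "Z \<noteq> Y \<or> J \<noteq> col Y"
  shows "((Y - Z, col Y - J), Sigma (col Y) (\<lambda>i. S i \<inter> Y) - J \<times> Z) \<in> petals n m Z J"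
proof -
  let ?Q = "Sigma (col Y) (\<lambda>i. S i \<inter> Y)"
  have fin: "finite Y" "finite Z" "finite J"
    using finite_core[OF Y] Z(1) J(1) finite_subset finite_col by metis+
  have finQ: "finite ?Q" using fin by (intro finite_SigmaI) auto
  have Qint: "?Q \<inter> J \<times> Z = Sigma J (\<lambda>i. S i \<inter> Z)" using Z J by auto
  have "card (?Q - J \<times> Z) = card ?Q - card (?Q \<inter> J \<times> Z)"
    using finQ by (simp add: card_Diff_subset_Int)
  moreover have "card (?Q \<inter> J \<times> Z) \<le> card ?Q" using finQ by (intro card_mono) auto
  ultimately have "real (card (?Q - J \<times> Z)) = real (card ?Q) - real (card (?Q \<inter> J \<times> Z))" by simp
  also have "card (?Q \<inter> J \<times> Z) = (\<Sum>i\<in>J. card (S i \<inter> Z))"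
    unfolding Qint using fin by (intro card_SigmaI) auto
  also have "card ?Q = (\<Sum>i\<in>col Y. card (S i \<inter> Y))"
    using fin by (intro card_SigmaI) auto
  finally have cQ: "real (card (?Q - J \<times> Z)) =
     real (\<Sum>i\<in>col Y. card (S i \<inter> Y)) - real (\<Sum>i\<in>J. card (S i \<inter> Z))" .
  have cY: "real (card (Y - Z)) = real (card Y) - real (card Z)"
    using Z(1) fin by (simp add: card_Diff_subset card_mono of_nat_diff)
  have cJ: "real (card (col Y - J)) = real (card (col Y)) - real (card J)"
    using J(1) fin by (simp add: card_Diff_subset card_mono of_nat_diff)
  have exponent: "real (card (Y - Z)) + real (card (col Y - J)) * \<delta> + real (card (?Q - J \<times> Z)) * (\<alpha> - 1) \<le> 0"
    unfolding cQ cY cJ by (rule kernel_exponent[OF Y Z J])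
  have nonempty: "?Q - J \<times> Z \<noteq> {}"
  proof (cases "Z = Y")
    case True
    then obtain i where i: "i \<in> col Y" "i \<notin> J" using ne J by blast
    then obtain x where "x \<in> S i" "x \<in> Y" by (auto simp: col_iff)
    thus ?thesis using i by blast
  next
    case False
    then obtain v where v: "v \<in> Y" "v \<notin> Z" using Z(1) by blast
    obtain z where z: "z \<in> Z" using Z(2) by fastforce
    have "v \<noteq> z" using v z by blast
    from core_edge[OF Y v(1) _ this] z Z(1) obtain i where i: "i \<in> {1..m}" "v \<in> S i" "z \<in> S i"
      by (metis edge_colour subsetD)
    hence "i \<in> col Y" using v z Z(1) \<open>v \<noteq> z\<close> unfolding col_iff by blast
    thus ?thesis using i v by blast
  qed
  have "card (Y - Z) \<le> t" using core_card_le[OF Y] card_mono[OF fin(1), of "Y - Z"] by auto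
  moreover have "card (col Y - J) \<le> t\<^sup>2"
    using card_col_core[OF Y] card_mono[of "col Y" "col Y - J"] by auto
  moreover have "?Q - J \<times> Z \<subseteq> (J \<union> (col Y - J)) \<times> (Z \<union> (Y - Z))" by auto
  moreover have "Y - Z \<subseteq> {1..n}" using core_subset[OF Y] by blast
  moreover have "col Y - J \<subseteq> {1..m}" by (auto simp: col_def)
  ultimately show ?thesis
    using exponent nonempty unfolding petals_def by blast
qed

text \<open>The sunflower is formed by nodes and colours together, encoded in a sum type. Sets of
  nodes alone would not do: two cores that are disjoint outside \<open>Z\<close> could share a
  colour, and with it an incidence at a node of \<open>Z\<close>.\<close>

lemma core_degree:
  assumes nc: "\<not> crowded n m K incidences" and K: "2 \<le> K" and xy: "x \<noteq> y"
  shows "card {Y \<in> cores. {x, y} \<subseteq> Y} \<le> (K * (t + t\<^sup>2) + 1) ^ (t + t\<^sup>2)"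
proof -
  define h :: "nat set \<Rightarrow> (nat + nat) set" where "h Y = Inl ` Y \<union> Inr ` col Y" for Y
  define B :: "(nat + nat) set" where "B = Inl ` {x, y}"
  let ?C = "{Y \<in> cores. {x, y} \<subseteq> Y}"
  have inj: "inj_on h ?C"
    by (rule inj_on_inverseI[where g = "\<lambda>W. {v. Inl v \<in> W}"]) (auto simp: h_def)
  have "card (h ` ?C) \<le> (K * (t + t\<^sup>2) + 1) ^ (t + t\<^sup>2)"
  proof (rule sunflower_count)
    show "finite (h ` ?C)" using finite_cores by simp
    show "finite W \<and> card W \<le> t + t\<^sup>2" if "W \<in> h ` ?C" for W
    proof -
      from \<open>W \<in> h ` ?C\<close> obtain Y where Y: "Y \<in> cores" "W = h Y" by blast
      have "card W \<le> card (Inl ` Y :: (nat + nat) set) + card (Inr ` col Y :: (nat + nat) set)"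
        unfolding Y(2) h_def by (rule card_Un_le)
      also have "\<dots> = card Y + card (col Y)" by (simp add: card_image)
      also have "\<dots> \<le> t + t\<^sup>2" using core_card_le[OF Y(1)] card_col_core[OF Y(1)] by simp
      finally show ?thesis using finite_core[OF Y(1)] by (simp add: Y(2) h_def)
    qed
    show "B \<subseteq> W" if "W \<in> h ` ?C" for W using that by (auto simp: B_def h_def)
  next
    fix Gs W
    assume Gs: "Gs \<subseteq> h ` ?C" "card Gs = K" and W: "B \<subseteq> W"
      and lt: "\<And>U. U \<in> Gs \<Longrightarrow> W \<subset> U"
      and cap: "\<And>U U'. U \<in> Gs \<Longrightarrow> U' \<in> Gs \<Longrightarrow> U \<noteq> U' \<Longrightarrow> U \<inter> U' = W"
    define Z where "Z = {v. Inl v \<in> W}"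
    define J where "J = {i. Inr i \<in> W}"
    have finGs: "finite Gs" using Gs(2) K by (metis card.infinite not_numeral_le_zero)
    then obtain e where e: "bij_betw e {..<K} Gs" using Gs(2) by (metis lessThan_atLeast0 ex_bij_betw_nat_finite)
    have eG: "e k \<in> Gs" if "k < K" for k
      using bij_betwE[OF e] that by simp
    have "\<exists>Y. Y \<in> ?C \<and> e k = h Y" if "k < K" for k
      using subsetD[OF Gs(1) eG[OF that]] by blast
    then obtain Yk where Yk: "\<And>k. k < K \<Longrightarrow> Yk k \<in> ?C \<and> e k = h (Yk k)" by metis
    have ek: "e k \<noteq> e l" if "k < K" "l < K" "k \<noteq> l" for k l
      using inj_onD[OF bij_betw_imp_inj_on[OF e], of k l] that by auto
    have Wk: "W \<subset> h (Yk k)" if "k < K" for k using lt[OF eG[OF that]] Yk[OF that] by simp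
    have "v \<in> Yk k" if "k < K" "Inl v \<in> W" for k v
      using Wk[OF that(1)] that(2) unfolding h_def by blast
    hence ZY: "Z \<subseteq> Yk k" if "k < K" for k using that by (auto simp: Z_def)
    have "i \<in> col (Yk k)" if "k < K" "Inr i \<in> W" for k i
      using Wk[OF that(1)] that(2) unfolding h_def by blast
    hence JY: "J \<subseteq> col (Yk k)" if "k < K" for k using that by (auto simp: J_def)
    have WZJ: "W = Inl ` Z \<union> Inr ` J"
    proof (rule set_eqI)
      fix a show "a \<in> W \<longleftrightarrow> a \<in> Inl ` Z \<union> Inr ` J" by (cases a) (auto simp: Z_def J_def)
    qed
    have meet: "Yk k \<inter> Yk l = Z" "col (Yk k) \<inter> col (Yk l) = J" if "k < K" "l < K" "k \<noteq> l" for k l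
    proof -
      have "h (Yk k) \<inter> h (Yk l) = W"
        using cap[OF eG[OF that(1)] eG[OF that(2)] ek[OF that]] Yk[OF that(1)] Yk[OF that(2)] by simp
      hence "W = (Inl ` Yk k \<union> Inr ` col (Yk k)) \<inter> (Inl ` Yk l \<union> Inr ` col (Yk l))" by (simp add: h_def)
      thus "Yk k \<inter> Yk l = Z" "col (Yk k) \<inter> col (Yk l) = J"
        unfolding Z_def J_def by auto
    qed
    have xyZ: "{x, y} \<subseteq> Z" using W by (auto simp: B_def Z_def)
    have cores: "Yk k \<in> cores" if "k < K" for k using Yk[OF that] by blast
    have finZ: "finite Z" using ZY[of 0] cores[of 0] K finite_core finite_subset by (metis order_less_le_trans pos2)
    have Z2: "2 \<le> card Z" using card_mono[OF finZ xyZ] xy by simp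
    \<comment> \<open>\<open>2 \<le> K\<close> provides two different petals. A colour with two
      nodes in \<open>Z\<close> is a colour of both cores, hence belongs to the kernel.\<close>
    have colZ: "col Z \<subseteq> J"
    proof -
      have "col Z \<subseteq> col (Yk 0) \<inter> col (Yk 1)"
        using col_mono[OF ZY[of 0]] col_mono[OF ZY[of 1]] K by auto
      moreover have "col (Yk 0) \<inter> col (Yk 1) = J" by (rule meet(2)) (use K in auto)
      ultimately show ?thesis by (simp only:)
    qed
    define g where "g k = ((Yk k - Z, col (Yk k) - J), Sigma (col (Yk k)) (\<lambda>i. S i \<inter> Yk k) - J \<times> Z)" for k
    have "g k \<in> petals n m Z J" if k: "k < K" for k
      unfolding g_def
    proof (rule core_petal[OF cores[OF k] ZY[OF k] Z2 JY[OF k] colZ])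
      show "Z \<noteq> Yk k \<or> J \<noteq> col (Yk k)" using Wk[OF k] unfolding WZJ h_def by blast
    qed
    moreover have "snd (g k) \<subseteq> incidences" for k
      by (auto simp: g_def incidences_def col_def)
    moreover have "disjoint_family_on (\<lambda>k. snd (g k)) {..<K}"
      unfolding disjoint_family_on_def
    proof (intro ballI impI)
      fix k l assume kl: "k \<in> {..<K}" "l \<in> {..<K}" "k \<noteq> l"
      hence "Yk k \<inter> Yk l = Z" "col (Yk k) \<inter> col (Yk l) = J" using meet[of k l] by auto
      thus "snd (g k) \<inter> snd (g l) = {}" unfolding g_def by auto
    qed
    moreover have "Z \<subseteq> {1..n}" "card Z \<le> t"
      using ZY[of 0] cores[of 0] K core_subset[of "Yk 0"] core_card_le[of "Yk 0"] card_mono[of "Yk 0" Z] finite_core[of "Yk 0"]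
      by auto
    moreover have "J \<subseteq> {1..m}" "card J \<le> t\<^sup>2"
      using JY[of 0] cores[of 0] K card_col_core[of "Yk 0"] card_mono[of "col (Yk 0)" J]
      by (auto simp: col_def)
    ultimately have "crowded n m K incidences" unfolding crowded_def by blast
    thus False using nc by blast
  qed
  thus ?thesis using card_image[OF inj] by simp
qed

end

section \<open>Clean copies of \<open>K\<^sub>s\<close> in every vertex set\<close>

definition supp_on :: "'a set \<Rightarrow> ('a \<Rightarrow> nat) \<Rightarrow> 'a set" where
  "supp_on A x = {v \<in> A. x v \<noteq> 0}"

lemma finite_supp_on [simp]: "finite A \<Longrightarrow> finite (supp_on A x)"
  by (simp add: supp_on_def)

definition good_row :: "nat \<Rightarrow> nat set \<Rightarrow> (nat \<Rightarrow> nat) \<Rightarrow> bool" where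
  "good_row s A x \<longleftrightarrow> card (supp_on A x) = s \<and> inj_on x (supp_on A x)"

context labels
begin

lemma expectation_label:
  "measure_pmf.expectation (label_pmf s \<gamma>) (\<lambda>y. if y \<noteq> 0 then z else 1) = 1 + \<gamma> * (z - 1)"
proof -
  have "(\<lambda>y::nat. if y \<noteq> 0 then z else 1) = (\<lambda>y. 1 + (z - 1) * indicator {y. y \<noteq> 0} y)"
    by (auto simp: indicator_def)
  hence "measure_pmf.expectation (label_pmf s \<gamma>) (\<lambda>y. if y \<noteq> 0 then z else 1)
     = measure_pmf.expectation (label_pmf s \<gamma>) (\<lambda>y. 1 + (z - 1) * indicator {y. y \<noteq> 0} y)" by (rule arg_cong)
  also have "\<dots> = 1 + (z - 1) * measure_pmf.prob (label_pmf s \<gamma>) {y. y \<noteq> 0}"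
    by (subst Bochner_Integration.integral_add) (auto intro: measure_pmf.integrable_const_bound[where B = 1])
  finally show ?thesis unfolding prob_label_nonzero by simp
qed

lemma finite_set_label: "finite (set_pmf (label_pmf s \<gamma>))"
  using set_label_pmf finite_subset by blast

lemma expectation_row_supp:
  assumes A: "A \<subseteq> {1..n}" and z: "z \<ge> 0"
  shows "measure_pmf.expectation (row_pmf s n \<gamma>) (\<lambda>x. z ^ card (supp_on A x)) = (1 + \<gamma> * (z - 1)) ^ card A"
proof -
  define h where "h v y = (if v \<in> A then (if y \<noteq> 0 then z else 1) else 1)" for v and y :: nat
  have "z ^ card (supp_on A x) = (\<Prod>v\<in>{1..n}. h v (x v))" for x
  proof -
    have "(\<Prod>v\<in>{1..n}. h v (x v)) = (\<Prod>v\<in>supp_on A x. h v (x v))"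
      using A by (intro prod.mono_neutral_right) (auto simp: supp_on_def h_def)
    also have "\<dots> = (\<Prod>v\<in>supp_on A x. z)" by (intro prod.cong) (auto simp: supp_on_def h_def)
    finally show ?thesis by simp
  qed
  hence "measure_pmf.expectation (row_pmf s n \<gamma>) (\<lambda>x. z ^ card (supp_on A x)) =
      measure_pmf.expectation (Pi_pmf {1..n} 0 (\<lambda>_. label_pmf s \<gamma>)) (\<lambda>x. \<Prod>v\<in>{1..n}. h v (x v))"
    by (simp add: row_pmf_def)
  also have "\<dots> = (\<Prod>v\<in>{1..n}. measure_pmf.expectation (label_pmf s \<gamma>) (h v))"
  proof (rule expectation_prod_Pi_pmf)
    show "integrable (measure_pmf (label_pmf s \<gamma>)) (h v)" for v
      by (rule integrable_measure_pmf_finite[OF finite_set_label])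
  qed (auto simp: h_def z)
  also have "\<dots> = (\<Prod>v\<in>{1..n}. if v \<in> A then 1 + \<gamma> * (z - 1) else 1)"
  proof (intro prod.cong refl)
    fix v
    show "measure_pmf.expectation (label_pmf s \<gamma>) (h v) = (if v \<in> A then 1 + \<gamma> * (z - 1) else 1)"
      unfolding h_def expectation_label[symmetric] by simp
  qed
  also have "\<dots> = (\<Prod>v\<in>A. 1 + \<gamma> * (z - 1))"
    using A by (intro prod.mono_neutral_cong_right) auto
  finally show ?thesis by simp
qed

text \<open>For every \<open>s\<close>-subset \<open>T\<close> of \<open>A\<close> one fixed
  bijection to the labels is enough for a lower bound. The events are disjoint because the support
  in \<open>A\<close> has to be exactly \<open>T\<close>.\<close>

lemma prob_good_row:
  assumes A: "A \<subseteq> {1..n}"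
  shows "real (card A choose s) * (\<gamma> / s) ^ s * (1 - \<gamma>) ^ card A
    \<le> measure_pmf.prob (row_pmf s n \<gamma>) {x. good_row s A x}"
proof -
  let ?M = "row_pmf s n \<gamma>"
  have finA: "finite A" using A finite_subset by blast
  define TT where "TT = {T. T \<subseteq> A \<and> card T = s}"
  have finTT: "finite TT" by (rule finite_subset[of _ "Pow A"]) (use finA in \<open>auto simp: TT_def\<close>)
  have "\<exists>b. bij_betw b T {1..s}" if "T \<in> TT" for T
  proof (rule finite_same_card_bij)
    show "finite T" using that finA finite_subset unfolding TT_def by blast
    show "card T = card {1..s}" using that by (simp add: TT_def)
  qed simp
  then obtain b where b: "\<And>T. T \<in> TT \<Longrightarrow> bij_betw (b T) T {1..s}" by metis
  define B where "B T v = (if v \<in> T then {b T v} else if v \<in> A then {0} else UNIV)" for T v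
  define E where "E T = Pi {1..n} (B T)" for T
  have supp: "supp_on A x = T \<and> (\<forall>v\<in>T. x v = b T v)" if "T \<in> TT" "x \<in> E T" for T x
  proof -
    have T: "T \<subseteq> A" using that(1) by (simp add: TT_def)
    have x: "x v \<in> B T v" if "v \<in> A" for v using \<open>x \<in> E T\<close> A that by (auto simp: E_def Pi_def)
    have 1: "x v = b T v" if "v \<in> T" for v using x[of v] T that by (auto simp: B_def)
    have 2: "x v = 0" if "v \<in> A - T" for v using x[of v] that by (auto simp: B_def)
    have "b T v \<noteq> 0" if "v \<in> T" for v using bij_betwE[OF b[OF \<open>T \<in> TT\<close>]] that by fastforce
    hence nz: "x v \<noteq> 0" if "v \<in> T" for v using 1 that by simp
    have "supp_on A x = T"
    proof (rule set_eqI)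
      fix v
      show "v \<in> supp_on A x \<longleftrightarrow> v \<in> T"
        using nz[of v] 2[of v] T by (cases "v \<in> T") (auto simp: supp_on_def)
    qed
    thus ?thesis using 1 by blast
  qed
  have "(\<gamma> / s) ^ s * (1 - \<gamma>) ^ card A \<le> measure_pmf.prob ?M (E T)" if T: "T \<in> TT" for T
  proof -
    have TA: "T \<subseteq> A" "card T = s" using T by (auto simp: TT_def)
    have "measure_pmf.prob ?M (E T) = (\<Prod>v\<in>{1..n}. measure_pmf.prob (label_pmf s \<gamma>) (B T v))"
      unfolding E_def row_pmf_def by (rule measure_Pi_pmf_Pi) simp
    also have "\<dots> = (\<Prod>v\<in>A. measure_pmf.prob (label_pmf s \<gamma>) (B T v))"
      using A TA by (intro prod.mono_neutral_right) (auto simp: B_def)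
    also have "\<dots> = (\<Prod>v\<in>T. measure_pmf.prob (label_pmf s \<gamma>) (B T v)) * (\<Prod>v\<in>A - T. measure_pmf.prob (label_pmf s \<gamma>) (B T v))"
      using finA TA by (simp add: prod.subset_diff mult.commute)
    also have "(\<Prod>v\<in>T. measure_pmf.prob (label_pmf s \<gamma>) (B T v)) = (\<Prod>v\<in>T. \<gamma> / s)"
    proof (intro prod.cong refl)
      fix v assume v: "v \<in> T"
      hence "b T v \<in> {1..s}" using bij_betwE[OF b[OF T]] by blast
      thus "measure_pmf.prob (label_pmf s \<gamma>) (B T v) = \<gamma> / s"
        using v pmf_label(2)[of "b T v"] by (simp add: B_def measure_pmf_single)
    qed
    also have "(\<Prod>v\<in>A - T. measure_pmf.prob (label_pmf s \<gamma>) (B T v)) = (\<Prod>v\<in>A - T. 1 - \<gamma>)"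
      by (intro prod.cong) (auto simp: B_def measure_pmf_single pmf_label(1))
    finally have "measure_pmf.prob ?M (E T) = (\<gamma> / s) ^ s * (1 - \<gamma>) ^ card (A - T)" using TA by simp
    also have "\<dots> \<ge> (\<gamma> / s) ^ s * (1 - \<gamma>) ^ card A"
      using \<gamma> finA by (intro mult_left_mono power_decreasing card_mono) auto
    finally show ?thesis .
  qed
  hence "(\<Sum>T\<in>TT. (\<gamma> / s) ^ s * (1 - \<gamma>) ^ card A) \<le> (\<Sum>T\<in>TT. measure_pmf.prob ?M (E T))"
    by (rule sum_mono)
  also have "\<dots> = measure_pmf.prob ?M (\<Union>T\<in>TT. E T)"
  proof (rule measure_pmf.finite_measure_finite_Union[symmetric, OF finTT])
    show "disjoint_family_on E TT"
      unfolding disjoint_family_on_def using supp by blast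
  qed simp
  also have "\<dots> \<le> measure_pmf.prob ?M {x. good_row s A x}"
  proof (rule measure_pmf.finite_measure_mono)
    show "(\<Union>T\<in>TT. E T) \<subseteq> {x. good_row s A x}"
    proof
      fix x assume "x \<in> (\<Union>T\<in>TT. E T)"
      then obtain T where T: "T \<in> TT" "x \<in> E T" by blast
      have "inj_on x T = inj_on (b T) T" using supp[OF T] by (intro inj_on_cong) blast
      hence "inj_on x T" using b[OF T(1)] by (simp add: bij_betw_def)
      thus "x \<in> {x. good_row s A x}" using supp[OF T] T(1) by (simp add: good_row_def TT_def)
    qed
  qed simp
  finally show ?thesis using n_subsets[OF finA, of s] by (simp add: TT_def mult.assoc)
qed

text \<open>A lower-tail Chernoff bound: a row contributes the factor \<open>exp (- 1)\<close> if it
  is good, and \<open>exp (- 1) \<le> 1 / 2\<close> bounds the mean of this factor by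
  \<open>exp (- p / 2)\<close>.\<close>

lemma prob_few_good:
  assumes p: "0 \<le> p" "p \<le> measure_pmf.prob (row_pmf s n \<gamma>) {x. good_row s A x}"
  shows "measure_pmf.prob (rows_pmf s n m \<gamma>)
    {f. real (card {i \<in> {1..m}. good_row s A (f i)}) \<le> real m * p / 4} \<le> exp (- real m * p / 4)"
proof -
  define P where "P = measure_pmf.prob (row_pmf s n \<gamma>) {x. good_row s A x}"
  define g :: "(nat \<Rightarrow> nat) \<Rightarrow> real" where "g x = (if good_row s A x then exp (-1) else 1)" for x
  have Eg: "measure_pmf.expectation (row_pmf s n \<gamma>) g \<le> exp (- p / 2)"
  proof -
    have "g = (\<lambda>x. 1 + (exp (-1) - 1) * indicator {x. good_row s A x} x)"
      by (auto simp: g_def indicator_def)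
    hence "measure_pmf.expectation (row_pmf s n \<gamma>) g =
       measure_pmf.expectation (row_pmf s n \<gamma>) (\<lambda>x. 1 + (exp (-1) - 1) * indicator {x. good_row s A x} x)" by simp
    also have "\<dots> = 1 + (exp (-1) - 1) * P"
      unfolding P_def by (subst Bochner_Integration.integral_add) (auto intro: measure_pmf.integrable_const_bound[where B = 1])
    also have "\<dots> \<le> 1 + (- (1 / 2)) * P"
    proof -
      have "exp (-1) \<le> (1 / 2 :: real)"
        using exp_ge_add_one_self[of "1::real"] by (simp add: exp_minus field_simps)
      thus ?thesis by (intro add_left_mono mult_right_mono) (auto simp: P_def)
    qed
    also have "\<dots> \<le> 1 + (- p / 2)" using p by (simp add: P_def)
    also have "\<dots> \<le> exp (- p / 2)" by (rule exp_ge_add_one_self)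
    finally show ?thesis .
  qed
  have "(\<Prod>i\<in>{1..m}. g (f i)) = exp (- real (card {i \<in> {1..m}. good_row s A (f i)}))" for f
  proof -
    have "(\<Prod>i\<in>{1..m}. g (f i)) = (\<Prod>i\<in>{i \<in> {1..m}. good_row s A (f i)}. exp (-1))"
      by (rule prod.mono_neutral_cong_right) (auto simp: g_def)
    thus ?thesis by (simp add: exp_of_nat_mult[symmetric])
  qed
  hence "{f. real (card {i \<in> {1..m}. good_row s A (f i)}) \<le> real m * p / 4} =
     {f. exp (- (real m * p / 4)) \<le> (\<Prod>i\<in>{1..m}. g (f i))}" by simp
  also have "measure_pmf.prob (rows_pmf s n m \<gamma>) \<dots> \<le>
     measure_pmf.expectation (row_pmf s n \<gamma>) g ^ card {1..m} / exp (- (real m * p / 4))"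
    unfolding rows_pmf_def by (rule prob_Pi_pmf_Markov) (auto simp: finite_set_row g_def)
  also have "\<dots> \<le> exp (- p / 2) ^ m / exp (- (real m * p / 4))"
    using Eg by (intro divide_right_mono) (auto intro!: power_mono integral_nonneg_AE simp: g_def)
  also have "\<dots> = exp (- real m * p / 4)"
    by (simp add: exp_of_nat_mult[symmetric] exp_diff[symmetric] field_simps)
  finally show ?thesis .
qed

lemma prob_large_set:
  "measure_pmf.prob (rows_pmf s n m \<gamma>) {f. \<exists>i\<in>{1..m}. real (card (supp_on {1..n} (f i))) > \<rho>}
    \<le> real m * (exp (\<gamma> * real n) / 2 powr \<rho>)"
proof -
  have "measure_pmf.prob (rows_pmf s n m \<gamma>) {f. real (card (supp_on {1..n} (f i))) > \<rho>}
     \<le> exp (\<gamma> * real n) / 2 powr \<rho>" if i: "i \<in> {1..m}" for i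
  proof -
    define g where "g y = (if y \<noteq> 0 then 2 else 1 :: real)" for y :: nat
    have eq: "row_pmf s n \<gamma> = map_pmf (\<lambda>f. f i) (rows_pmf s n m \<gamma>)"
      unfolding rows_pmf_def using i by (subst Pi_pmf_component) auto
    have "measure_pmf.prob (rows_pmf s n m \<gamma>) {f. real (card (supp_on {1..n} (f i))) > \<rho>} =
       measure_pmf.prob (row_pmf s n \<gamma>) {x. real (card (supp_on {1..n} x)) > \<rho>}"
      unfolding eq by (simp add: vimage_def)
    also have "\<dots> \<le> measure_pmf.prob (row_pmf s n \<gamma>) {x. 2 powr \<rho> \<le> (\<Prod>v\<in>{1..n}. g (x v))}"
    proof (rule measure_pmf.finite_measure_mono)
      show "{x. real (card (supp_on {1..n} x)) > \<rho>} \<subseteq> {x. 2 powr \<rho> \<le> (\<Prod>v\<in>{1..n}. g (x v))}"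
      proof clarify
        fix x :: "nat \<Rightarrow> nat" assume "real (card (supp_on {1..n} x)) > \<rho>"
        hence "2 powr \<rho> \<le> 2 powr real (card (supp_on {1..n} x))" by simp
        also have "\<dots> = (\<Prod>v\<in>supp_on {1..n} x. 2)" by (simp add: powr_realpow)
        also have "\<dots> = (\<Prod>v\<in>{1..n}. g (x v))"
          by (rule prod.mono_neutral_cong_left) (auto simp: supp_on_def g_def)
        finally show "2 powr \<rho> \<le> (\<Prod>v\<in>{1..n}. g (x v))" .
      qed
    qed simp
    also have "\<dots> \<le> measure_pmf.expectation (label_pmf s \<gamma>) g ^ card {1..n} / 2 powr \<rho>"
      unfolding row_pmf_def by (rule prob_Pi_pmf_Markov) (auto simp: finite_set_label g_def)
    also have "measure_pmf.expectation (label_pmf s \<gamma>) g = 1 + \<gamma>"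
      unfolding g_def expectation_label by simp
    also have "(1 + \<gamma>) ^ card {1..n} / 2 powr \<rho> \<le> exp \<gamma> ^ n / 2 powr \<rho>"
      using \<gamma> by (intro divide_right_mono) (auto intro!: power_mono exp_ge_add_one_self)
    finally show ?thesis by (simp add: exp_of_nat_mult[symmetric] mult.commute)
  qed
  hence "(\<Sum>i\<in>{1..m}. measure_pmf.prob (rows_pmf s n m \<gamma>) {f. real (card (supp_on {1..n} (f i))) > \<rho>})
     \<le> (\<Sum>i\<in>{1..m}. exp (\<gamma> * real n) / 2 powr \<rho>)" by (rule sum_mono)
  moreover have "{f. \<exists>i\<in>{1..m}. real (card (supp_on {1..n} (f i))) > \<rho>} =
     (\<Union>i\<in>{1..m}. {f. real (card (supp_on {1..n} (f i))) > \<rho>})" by auto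
  moreover have "measure_pmf.prob (rows_pmf s n m \<gamma>) (\<Union>i\<in>{1..m}. {f. real (card (supp_on {1..n} (f i))) > \<rho>})
     \<le> (\<Sum>i\<in>{1..m}. measure_pmf.prob (rows_pmf s n m \<gamma>) {f. real (card (supp_on {1..n} (f i))) > \<rho>})"
    by (rule measure_pmf.finite_measure_subadditive_finite) auto
  ultimately show ?thesis by simp
qed

lemma prob_row_contains:
  assumes H: "finite H" "\<And>T. T \<in> H \<Longrightarrow> T \<subseteq> {1..n} \<and> card T = k"
  shows "measure_pmf.prob (row_pmf s n \<gamma>) {x. \<exists>T\<in>H. \<forall>v\<in>T. x v \<noteq> 0} \<le> real (card H) * \<gamma> ^ k"
proof -
  have "{x. \<exists>T\<in>H. \<forall>v\<in>T. x v \<noteq> (0::nat)} = (\<Union>T\<in>H. {x. \<forall>v\<in>T. x v \<noteq> 0})" by auto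
  hence "measure_pmf.prob (row_pmf s n \<gamma>) {x. \<exists>T\<in>H. \<forall>v\<in>T. x v \<noteq> 0}
     \<le> (\<Sum>T\<in>H. measure_pmf.prob (row_pmf s n \<gamma>) {x. \<forall>v\<in>T. x v \<noteq> 0})"
    using H(1) by (simp add: measure_pmf.finite_measure_subadditive_finite)
  also have "\<dots> = (\<Sum>T\<in>H. \<gamma> ^ k)"
  proof (intro sum.cong refl)
    fix T assume "T \<in> H"
    thus "measure_pmf.prob (row_pmf s n \<gamma>) {x. \<forall>v\<in>T. x v \<noteq> 0} = \<gamma> ^ k"
      using prob_row_supset[of T n] H(2)[of T] by simp
  qed
  finally show ?thesis by simp
qed

lemma prob_many_two:
  assumes A: "A \<subseteq> {1..n}" and k: "k > 0"
  shows "measure_pmf.prob (rows_pmf s n m \<gamma>) {f. k \<le> card {i \<in> {1..m}. 2 \<le> card (supp_on A (f i))}}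
    \<le> (exp 1 * real m * (real (card A) * \<gamma>)\<^sup>2 / real k) ^ k"
proof -
  have finA: "finite A" using A finite_subset by blast
  let ?q = "(real (card A) * \<gamma>)\<^sup>2"
  have single: "measure_pmf.prob (row_pmf s n \<gamma>) {x. 2 \<le> card (supp_on A x)} \<le> ?q"
  proof -
    have "measure_pmf.prob (row_pmf s n \<gamma>) {x. 2 \<le> card (supp_on A x)}
        \<le> measure_pmf.prob (row_pmf s n \<gamma>) {x. \<exists>T\<in>nsets A 2. \<forall>v\<in>T. x v \<noteq> 0}"
    proof (rule measure_pmf.finite_measure_mono)
      show "{x. 2 \<le> card (supp_on A x)} \<subseteq> {x. \<exists>T\<in>nsets A 2. \<forall>v\<in>T. x v \<noteq> 0}"
      proof clarify
        fix x assume "2 \<le> card (supp_on A x)"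
        then obtain T where "T \<subseteq> supp_on A x" "card T = 2" by (meson obtain_subset_with_card_n)
        hence "T \<in> nsets A 2 \<and> (\<forall>v\<in>T. x v \<noteq> 0)"
          using finA finite_subset[of T A] by (auto simp: nsets_def supp_on_def)
        thus "\<exists>T\<in>nsets A 2. \<forall>v\<in>T. x v \<noteq> 0" by blast
      qed
    qed simp
    also have "\<dots> \<le> real (card (nsets A 2)) * \<gamma> ^ 2"
      using finA A by (intro prob_row_contains) (auto simp: finite_imp_finite_nsets nsets_def)
    also have "\<dots> \<le> real (card A ^ 2) * \<gamma> ^ 2"
    proof -
      have "card (nsets A 2) * 1 \<le> (card A choose 2) * fact 2" using finA by (simp add: card_nsets)
      also have "\<dots> \<le> card A ^ 2" by (rule binomial_fact_pow)
      finally have "real (card (nsets A 2)) \<le> real (card A ^ 2)" by (intro of_nat_mono) simp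
      thus ?thesis by (rule mult_right_mono) simp
    qed
    finally show ?thesis by (simp add: power_mult_distrib)
  qed
  have "measure_pmf.prob (rows_pmf s n m \<gamma>) {f. k \<le> card {i \<in> {1..m}. 2 \<le> card (supp_on A (f i))}}
      \<le> (exp 1 * real (card {1..m}) * ?q / real k) ^ k"
  proof (rule prob_many_le)
    fix J assume J: "J \<subseteq> {1..m}" "card J = k"
    have "measure_pmf.prob (rows_pmf s n m \<gamma>) {f. \<forall>i\<in>J. 2 \<le> card (supp_on A (f i))} \<le> ?q ^ card J"
      unfolding rows_pmf_def
    proof (rule prob_sequential[where r = id])
      show "measure_pmf.prob (row_pmf s n \<gamma>) {x. 2 \<le> card (supp_on A ((f(i := x)) i))} \<le> ?q" for i f
        using single by simp
      show "(2 \<le> card (supp_on A (f i))) = (2 \<le> card (supp_on A (g i)))"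
        if "i \<in> J" "\<And>j. j \<in> {1..m} \<Longrightarrow> id j \<le> id i \<Longrightarrow> f j = g j" for i and f g :: "nat \<Rightarrow> nat \<Rightarrow> nat"
        using that(2)[of i] that(1) J(1) by auto
    qed (use J in auto)
    thus "measure_pmf.prob (rows_pmf s n m \<gamma>) {f. \<forall>i\<in>J. 2 \<le> card (supp_on A (f i))} \<le> ?q ^ k"
      using J by simp
  qed (use k in auto)
  thus ?thesis by simp
qed

text \<open>If \<open>r \<ge> r0\<close>, then \<open>z ^ r \<le> (z * y) ^ r / y ^ r0\<close>, which turns the truncated moment into a full one.\<close>

lemma prob_large_sum:
  assumes A: "A \<subseteq> {1..n}" and y: "1 \<le> y" "1 \<le> z" and small: "\<gamma> * real (card A) * (z * y) \<le> 1"
  shows "measure_pmf.prob (rows_pmf s n m \<gamma>)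
      {f. W \<le> (\<Sum>i\<in>{i \<in> {1..m}. r0 \<le> card (supp_on A (f i))}. real (card (supp_on A (f i))))}
    \<le> (1 + 3 / y ^ r0) ^ m / z powr W"
proof -
  have finA: "finite A" using A finite_subset by blast
  define g where "g x = (if r0 \<le> card (supp_on A x) then z ^ card (supp_on A x) else 1)" for x :: "nat \<Rightarrow> nat"
  have Eg: "measure_pmf.expectation (row_pmf s n \<gamma>) g \<le> 1 + 3 / y ^ r0"
  proof -
    have int: "integrable (row_pmf s n \<gamma>) h" for h :: "_ \<Rightarrow> real"
      by (rule integrable_measure_pmf_finite[OF finite_set_row])
    have "measure_pmf.expectation (row_pmf s n \<gamma>) g
      \<le> measure_pmf.expectation (row_pmf s n \<gamma>) (\<lambda>x. 1 + (z * y) ^ card (supp_on A x) / y ^ r0)"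
    proof (rule integral_mono[OF int int])
      fix x
      have "z ^ card (supp_on A x) \<le> (z * y) ^ card (supp_on A x) / y ^ r0" if "r0 \<le> card (supp_on A x)"
      proof -
        have "z ^ card (supp_on A x) * y ^ r0 \<le> z ^ card (supp_on A x) * y ^ card (supp_on A x)"
          using y that by (intro mult_left_mono power_increasing) auto
        thus ?thesis using y by (simp add: power_mult_distrib pos_le_divide_eq)
      qed
      thus "g x \<le> 1 + (z * y) ^ card (supp_on A x) / y ^ r0"
        using y by (auto simp: g_def intro: add_increasing)
    qed
    also have "\<dots> = 1 + measure_pmf.expectation (row_pmf s n \<gamma>) (\<lambda>x. (z * y) ^ card (supp_on A x)) / y ^ r0"
      by (subst Bochner_Integration.integral_add[OF int int]) simp
    also have "measure_pmf.expectation (row_pmf s n \<gamma>) (\<lambda>x. (z * y) ^ card (supp_on A x)) = (1 + \<gamma> * (z * y - 1)) ^ card A"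
      using y by (intro expectation_row_supp A) auto
    also have "\<dots> \<le> exp (\<gamma> * (z * y)) ^ card A"
    proof (rule power_mono)
      have "1 + \<gamma> * (z * y - 1) \<le> 1 + \<gamma> * (z * y)" using \<gamma> by (simp add: algebra_simps)
      also have "\<dots> \<le> exp (\<gamma> * (z * y))" by (rule exp_ge_add_one_self)
      finally show "1 + \<gamma> * (z * y - 1) \<le> exp (\<gamma> * (z * y))" .
      have "1 * 1 \<le> z * y" using y by (intro mult_mono) auto
      thus "0 \<le> 1 + \<gamma> * (z * y - 1)" using \<gamma> by (intro add_nonneg_nonneg mult_nonneg_nonneg) auto
    qed
    also have "\<dots> = exp (\<gamma> * real (card A) * (z * y))" by (simp add: exp_of_nat_mult[symmetric] mult_ac)
    also have "\<dots> \<le> exp 1" using small by simp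
    also have "\<dots> \<le> 3" by (rule exp_le)
    finally show ?thesis using y by (simp add: divide_right_mono)
  qed
  have "{f. W \<le> (\<Sum>i\<in>{i \<in> {1..m}. r0 \<le> card (supp_on A (f i))}. real (card (supp_on A (f i))))} \<subseteq>
     {f. z powr W \<le> (\<Prod>i\<in>{1..m}. g (f i))}"
  proof clarify
    fix f :: "nat \<Rightarrow> nat \<Rightarrow> nat"
    let ?B = "{i \<in> {1..m}. r0 \<le> card (supp_on A (f i))}"
    assume "W \<le> (\<Sum>i\<in>?B. real (card (supp_on A (f i))))"
    hence "z powr W \<le> z powr (real (\<Sum>i\<in>?B. card (supp_on A (f i))))"
      using y by (intro powr_mono) auto
    also have "\<dots> = z ^ (\<Sum>i\<in>?B. card (supp_on A (f i)))" using y by (subst powr_realpow) auto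
    also have "\<dots> = (\<Prod>i\<in>?B. z ^ card (supp_on A (f i)))" by (simp add: power_sum)
    also have "\<dots> = (\<Prod>i\<in>{1..m}. g (f i))"
      by (rule prod.mono_neutral_cong_left) (auto simp: g_def)
    finally show "z powr W \<le> (\<Prod>i\<in>{1..m}. g (f i))" .
  qed
  hence "measure_pmf.prob (rows_pmf s n m \<gamma>)
      {f. W \<le> (\<Sum>i\<in>{i \<in> {1..m}. r0 \<le> card (supp_on A (f i))}. real (card (supp_on A (f i))))}
     \<le> measure_pmf.prob (rows_pmf s n m \<gamma>) {f. z powr W \<le> (\<Prod>i\<in>{1..m}. g (f i))}"
    by (rule measure_pmf.finite_measure_mono) simp
  also have "\<dots> \<le> measure_pmf.expectation (row_pmf s n \<gamma>) g ^ card {1..m} / z powr W"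
    unfolding rows_pmf_def using y by (intro prob_Pi_pmf_Markov) (auto simp: finite_set_row g_def)
  also have "\<dots> \<le> (1 + 3 / y ^ r0) ^ m / z powr W"
    using y Eg by (intro divide_right_mono) (auto intro!: power_mono integral_nonneg_AE simp: g_def)
  finally show ?thesis .
qed

end

text \<open>\<open>r\<close> gives the order of exposure; it is used with \<open>int\<close> and
  with its negative, the reversed order.\<close>

definition pairs_before :: "('i \<Rightarrow> 'o :: linorder) \<Rightarrow> 'i set \<Rightarrow> nat set \<Rightarrow> ('i \<Rightarrow> nat \<Rightarrow> nat) \<Rightarrow> 'i \<Rightarrow> nat set set" where
  "pairs_before r I A f i = {e \<in> nsets A 2. \<exists>j\<in>I. r j < r i \<and> (\<forall>v\<in>e. f j v \<noteq> 0)}"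

definition covered_pairs :: "'i set \<Rightarrow> nat set \<Rightarrow> ('i \<Rightarrow> nat \<Rightarrow> nat) \<Rightarrow> nat set set" where
  "covered_pairs I A f = {e \<in> nsets A 2. \<exists>j\<in>I. \<forall>v\<in>e. f j v \<noteq> 0}"

text \<open>The bound \<open>h\<close> is part of the event, because it makes the conditional probability of a hit
  small for every outcome of the earlier rows.\<close>

definition hit_row :: "nat \<Rightarrow> ('i \<Rightarrow> 'o :: linorder) \<Rightarrow> 'i set \<Rightarrow> real \<Rightarrow> nat set \<Rightarrow> ('i \<Rightarrow> nat \<Rightarrow> nat) \<Rightarrow> 'i \<Rightarrow> bool" where
  "hit_row s r I h A f i \<longleftrightarrow> card (supp_on A (f i)) = s \<and> real (card (pairs_before r I A f i)) \<le> h \<and>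
     (\<exists>e\<in>pairs_before r I A f i. \<forall>v\<in>e. f i v \<noteq> 0)"

text \<open>With labels up to \<open>s\<close>, a clean row meets \<open>A\<close> in the vertex set
  of a \<open>K_s\<close> of G_1: its nodes have different labels and none of its pairs is
  deleted.\<close>

definition clean_rows :: "nat \<Rightarrow> 'i set \<Rightarrow> nat set \<Rightarrow> ('i \<Rightarrow> nat \<Rightarrow> nat) \<Rightarrow> 'i set" where
  "clean_rows s I A f = {i \<in> I. good_row s A (f i) \<and>
     (\<forall>j\<in>I. j \<noteq> i \<longrightarrow> (\<forall>e\<in>nsets A 2. (\<forall>v\<in>e. f i v \<noteq> 0) \<longrightarrow> \<not> (\<forall>v\<in>e. f j v \<noteq> 0)))}"

section \<open>Covered pairs and damaged rows\<close>

lemma card_supersets_le: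
  assumes A: "finite A" and H: "H \<subseteq> nsets A 2"
  shows "card {T. T \<subseteq> A \<and> card T = k + 2 \<and> (\<exists>e\<in>H. e \<subseteq> T)} \<le> card H * card A ^ k"
proof -
  have finH: "finite H" using H A finite_subset finite_imp_finite_nsets by metis
  have each: "card {T. T \<subseteq> A \<and> card T = k + 2 \<and> e \<subseteq> T} \<le> card A ^ k" if e: "e \<in> H" for e
  proof -
    have e2: "card e = 2" "finite e" using e H by (auto simp: nsets_def)
    have "card {T. T \<subseteq> A \<and> card T = k + 2 \<and> e \<subseteq> T} \<le> card {U. U \<subseteq> A \<and> card U = k}"
    proof (rule card_inj_on_le)
      show "inj_on (\<lambda>T. T - e) {T. T \<subseteq> A \<and> card T = k + 2 \<and> e \<subseteq> T}"
        by (rule inj_onI) blast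
      show "(\<lambda>T. T - e) ` {T. T \<subseteq> A \<and> card T = k + 2 \<and> e \<subseteq> T} \<subseteq> {U. U \<subseteq> A \<and> card U = k}"
        using e2 by (auto simp: card_Diff_subset)
      show "finite {U. U \<subseteq> A \<and> card U = k}"
        by (rule finite_subset[of _ "Pow A"]) (use A in auto)
    qed
    also have "\<dots> = card A choose k" using n_subsets[OF A] by simp
    also have "\<dots> \<le> (card A choose k) * fact k" by simp
    also have "\<dots> \<le> card A ^ k" by (rule binomial_fact_pow)
    finally show ?thesis .
  qed
  have "{T. T \<subseteq> A \<and> card T = k + 2 \<and> (\<exists>e\<in>H. e \<subseteq> T)} = (\<Union>e\<in>H. {T. T \<subseteq> A \<and> card T = k + 2 \<and> e \<subseteq> T})"
    by auto
  hence "card {T. T \<subseteq> A \<and> card T = k + 2 \<and> (\<exists>e\<in>H. e \<subseteq> T)} \<le> (\<Sum>e\<in>H. card {T. T \<subseteq> A \<and> card T = k + 2 \<and> e \<subseteq> T})"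
    using card_UN_le[OF finH] by simp
  also have "\<dots> \<le> (\<Sum>e\<in>H. card A ^ k)" by (intro sum_mono each)
  finally show ?thesis by simp
qed

text \<open>A row with \<open>r\<close> nodes in \<open>A\<close> covers at most
  \<open>r * r\<close> pairs. This is at most \<open>r0 ^ 2\<close> for a small row and at most
  \<open>\<rho> * r\<close> for a large one, so only the number of rows with two nodes and the total
  size of the large rows matter.\<close>

lemma card_covered_pairs_le:
  fixes f :: "'i \<Rightarrow> nat \<Rightarrow> nat"
  assumes I: "finite I" and A: "finite A"
    and \<rho>: "\<And>i. i \<in> I \<Longrightarrow> real (card (supp_on A (f i))) \<le> \<rho>"
    and k: "card {i \<in> I. 2 \<le> card (supp_on A (f i))} \<le> k"
    and W: "(\<Sum>i\<in>{i \<in> I. r0 \<le> card (supp_on A (f i))}. real (card (supp_on A (f i)))) \<le> W"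
    and \<rho>0: "0 \<le> \<rho>"
  shows "real (card (covered_pairs I A f)) \<le> real r0 ^ 2 * real k + \<rho> * W"
proof -
  define r where "r i = card (supp_on A (f i))" for i
  let ?I2 = "{i \<in> I. 2 \<le> r i}" and ?B = "{i \<in> I. r0 \<le> r i}"
  have "covered_pairs I A f \<subseteq> (\<Union>i\<in>?I2. nsets (supp_on A (f i)) 2)"
  proof
    fix e assume "e \<in> covered_pairs I A f"
    then obtain i where i: "i \<in> I" "e \<in> nsets A 2" "\<forall>v\<in>e. f i v \<noteq> 0"
      by (auto simp: covered_pairs_def)
    hence e: "e \<in> nsets (supp_on A (f i)) 2" by (auto simp: nsets_def supp_on_def)
    hence "card e = 2" "e \<subseteq> supp_on A (f i)" by (auto simp: nsets_def)
    hence "2 \<le> r i" using card_mono[of "supp_on A (f i)" e] A by (simp add: r_def)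
    thus "e \<in> (\<Union>i\<in>?I2. nsets (supp_on A (f i)) 2)" using i e by blast
  qed
  hence "card (covered_pairs I A f) \<le> card (\<Union>i\<in>?I2. nsets (supp_on A (f i)) 2)"
    using I A by (intro card_mono) (auto simp: finite_imp_finite_nsets)
  also have "\<dots> \<le> (\<Sum>i\<in>?I2. card (nsets (supp_on A (f i)) 2))" using I by (intro card_UN_le) auto
  also have "\<dots> \<le> (\<Sum>i\<in>?I2. r i ^ 2)"
  proof (rule sum_mono)
    fix i
    have "card (nsets (supp_on A (f i)) 2) \<le> (r i choose 2) * fact 2"
      using A by (simp add: card_nsets r_def)
    also have "\<dots> \<le> r i ^ 2" by (rule binomial_fact_pow)
    finally show "card (nsets (supp_on A (f i)) 2) \<le> r i ^ 2" .
  qed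
  finally have "real (card (covered_pairs I A f)) \<le> (\<Sum>i\<in>?I2. real (r i) ^ 2)"
    by (simp flip: of_nat_power of_nat_sum)
  also have "\<dots> \<le> (\<Sum>i\<in>?I2. real r0 ^ 2 + (if r0 \<le> r i then \<rho> * real (r i) else 0))"
  proof (rule sum_mono)
    fix i assume i: "i \<in> ?I2"
    show "real (r i) ^ 2 \<le> real r0 ^ 2 + (if r0 \<le> r i then \<rho> * real (r i) else 0)"
    proof (cases "r0 \<le> r i")
      case True
      have "real (r i) * real (r i) \<le> \<rho> * real (r i)"
        using \<rho>[of i] i by (intro mult_right_mono) (auto simp: r_def)
      thus ?thesis using True by (simp add: power2_eq_square add_increasing)
    next
      case False
      hence "real (r i) ^ 2 \<le> real r0 ^ 2" by (intro power_mono) auto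
      thus ?thesis using False by simp
    qed
  qed
  also have "\<dots> = real (card ?I2) * real r0 ^ 2 + (\<Sum>i\<in>?I2. if r0 \<le> r i then \<rho> * real (r i) else 0)"
    by (simp add: sum.distrib)
  also have "(\<Sum>i\<in>?I2. if r0 \<le> r i then \<rho> * real (r i) else 0) \<le> (\<Sum>i\<in>I. if r0 \<le> r i then \<rho> * real (r i) else 0)"
    using I \<rho>0 by (intro sum_mono2) auto
  also have "\<dots> = (\<Sum>i\<in>?B. \<rho> * real (r i))"
    using I by (rule sum.inter_filter[symmetric])
  also have "\<dots> = \<rho> * (\<Sum>i\<in>?B. real (r i))" by (simp add: sum_distrib_left)
  also have "\<dots> \<le> \<rho> * W" using W \<rho>0 by (intro mult_left_mono) (auto simp: r_def)
  also have "real (card ?I2) * real r0 ^ 2 \<le> real k * real r0 ^ 2"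
    using k by (intro mult_right_mono) (auto simp: r_def)
  finally show ?thesis by (simp add: mult.commute)
qed

text \<open>A row sharing a pair with row \<open>i\<close> precedes it in one of the two orders, and
  \<open>h\<close> bounds the pairs seen before \<open>i\<close> in either of them.\<close>

lemma good_minus_clean:
  fixes f :: "nat \<Rightarrow> nat \<Rightarrow> nat"
  assumes A: "finite A" and h: "real (card (covered_pairs {1..m} A f)) \<le> h"
  shows "{i \<in> {1..m}. good_row s A (f i)} \<subseteq> clean_rows s {1..m} A f \<union>
    ({i \<in> {1..m}. hit_row s int {1..m} h A f i} \<union> {i \<in> {1..m}. hit_row s (\<lambda>i. - int i) {1..m} h A f i})"
proof
  fix i assume "i \<in> {i \<in> {1..m}. good_row s A (f i)}"
  hence i: "i \<in> {1..m}" "good_row s A (f i)" by auto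
  show "i \<in> clean_rows s {1..m} A f \<union>
    ({i \<in> {1..m}. hit_row s int {1..m} h A f i} \<union> {i \<in> {1..m}. hit_row s (\<lambda>i. - int i) {1..m} h A f i})"
  proof (cases "i \<in> clean_rows s {1..m} A f")
    case False
    then obtain j e where je: "j \<in> {1..m}" "j \<noteq> i" "e \<in> nsets A 2" "\<forall>v\<in>e. f i v \<noteq> 0" "\<forall>v\<in>e. f j v \<noteq> 0"
      using i unfolding clean_rows_def by blast
    have small: "real (card (pairs_before r {1..m} A f i)) \<le> h" for r :: "nat \<Rightarrow> int"
    proof -
      have "pairs_before r {1..m} A f i \<subseteq> covered_pairs {1..m} A f"
        unfolding pairs_before_def covered_pairs_def by blast
      moreover have "finite (covered_pairs {1..m} A f)"
        unfolding covered_pairs_def using A by (simp add: finite_imp_finite_nsets)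
      ultimately have "card (pairs_before r {1..m} A f i) \<le> card (covered_pairs {1..m} A f)"
        by (rule card_mono[rotated])
      thus ?thesis using h by linarith
    qed
    have "e \<in> pairs_before int {1..m} A f i \<or> e \<in> pairs_before (\<lambda>i. - int i) {1..m} A f i"
    proof (cases "j < i")
      case True
      hence "int j < int i" by simp
      thus ?thesis using je unfolding pairs_before_def by blast
    next
      case False
      hence "- int j < - int i" using je(2) by simp
      thus ?thesis using je unfolding pairs_before_def by blast
    qed
    hence "hit_row s int {1..m} h A f i \<or> hit_row s (\<lambda>i. - int i) {1..m} h A f i"
      using small i(2) je(4) unfolding hit_row_def good_row_def by blast
    thus ?thesis using i(1) by blast
  qed simp
qed

context labels
begin

text \<open>Given the earlier rows, a hit needs one of at most \<open>h * card A ^ (s - 2)\<close>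
  determined \<open>s\<close>-sets to lie in the new row, and each does so with probability
  \<open>\<gamma> ^ s\<close>.\<close>

lemma prob_many_hit:
  fixes r :: "nat \<Rightarrow> 'o :: linorder"
  assumes A: "A \<subseteq> {1..n}" and k: "k > 0" and r: "inj_on r {1..m}" and h: "h \<ge> 0" and s2: "2 \<le> s"
  shows "measure_pmf.prob (rows_pmf s n m \<gamma>) {f. k \<le> card {i \<in> {1..m}. hit_row s r {1..m} h A f i}}
    \<le> (exp 1 * real m * (h * real (card A) ^ (s - 2) * \<gamma> ^ s) / real k) ^ k"
proof -
  have finA: "finite A" using A finite_subset by blast
  let ?I = "{1..m}" and ?q = "h * real (card A) ^ (s - 2) * \<gamma> ^ s"
  have q0: "?q \<ge> 0" using h \<gamma> by simp
  have single: "measure_pmf.prob (row_pmf s n \<gamma>) {x. hit_row s r ?I h A (f(i := x)) i} \<le> ?q" for f i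
  proof -
    define H where "H = pairs_before r ?I A f i"
    have H: "pairs_before r ?I A (f(i := x)) i = H" for x
      unfolding pairs_before_def H_def by (intro Collect_cong conj_cong bex_cong refl) (auto simp: fun_upd_def)
    show ?thesis
    proof (cases "real (card H) \<le> h")
      case True
      define TT where "TT = {T. T \<subseteq> A \<and> card T = s - 2 + 2 \<and> (\<exists>e\<in>H. e \<subseteq> T)}"
      have "{x. hit_row s r ?I h A (f(i := x)) i} \<subseteq> {x. \<exists>T\<in>TT. \<forall>v\<in>T. x v \<noteq> 0}"
      proof clarify
        fix x assume "hit_row s r ?I h A (f(i := x)) i"
        then obtain e where e: "card (supp_on A x) = s" "e \<in> H" "\<forall>v\<in>e. x v \<noteq> 0"
          unfolding hit_row_def H by auto
        have "e \<subseteq> A" using e(2) unfolding H_def pairs_before_def nsets_def by blast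
        hence "e \<subseteq> supp_on A x" using e(3) unfolding supp_on_def by blast
        hence "supp_on A x \<in> TT"
          using e s2 unfolding TT_def by (auto simp: supp_on_def)
        moreover have "\<forall>v\<in>supp_on A x. x v \<noteq> 0" by (simp add: supp_on_def)
        ultimately show "\<exists>T\<in>TT. \<forall>v\<in>T. x v \<noteq> 0" by blast
      qed
      hence "measure_pmf.prob (row_pmf s n \<gamma>) {x. hit_row s r ?I h A (f(i := x)) i}
          \<le> measure_pmf.prob (row_pmf s n \<gamma>) {x. \<exists>T\<in>TT. \<forall>v\<in>T. x v \<noteq> 0}"
        by (rule measure_pmf.finite_measure_mono) simp
      also have "\<dots> \<le> real (card TT) * \<gamma> ^ s"
      proof (rule prob_row_contains)
        show "finite TT" unfolding TT_def by (rule finite_subset[of _ "Pow A"]) (use finA in auto)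
        show "T \<subseteq> {1..n} \<and> card T = s" if "T \<in> TT" for T
          using that A s2 unfolding TT_def by auto
      qed
      also have "\<dots> \<le> ?q"
      proof (rule mult_right_mono)
        have "card TT \<le> card H * card A ^ (s - 2)"
          unfolding TT_def by (rule card_supersets_le[OF finA]) (auto simp: H_def pairs_before_def)
        hence "real (card TT) \<le> real (card H * card A ^ (s - 2))" by (rule of_nat_mono)
        also have "\<dots> \<le> h * real (card A) ^ (s - 2)" using True by (simp add: mult_right_mono)
        finally show "real (card TT) \<le> h * real (card A) ^ (s - 2)" .
      qed (use \<gamma> in simp)
      finally show ?thesis .
    next
      case False
      hence "{x. hit_row s r ?I h A (f(i := x)) i} = {}" unfolding hit_row_def H by blast
      thus ?thesis using q0 by simp
    qed
  qed
  have "measure_pmf.prob (rows_pmf s n m \<gamma>) {f. k \<le> card {i \<in> ?I. hit_row s r ?I h A f i}}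
      \<le> (exp 1 * real (card ?I) * ?q / real k) ^ k"
  proof (rule prob_many_le)
    fix J assume J: "J \<subseteq> ?I" "card J = k"
    have "measure_pmf.prob (rows_pmf s n m \<gamma>) {f. \<forall>i\<in>J. hit_row s r ?I h A f i} \<le> ?q ^ card J"
      unfolding rows_pmf_def
    proof (rule prob_sequential[where r = r])
      fix i and f g :: "nat \<Rightarrow> nat \<Rightarrow> nat"
      assume i: "i \<in> J" and fg: "\<And>j. j \<in> ?I \<Longrightarrow> r j \<le> r i \<Longrightarrow> f j = g j"
      have "f i = g i" using fg[of i] i J(1) by blast
      moreover have "pairs_before r ?I A f i = pairs_before r ?I A g i"
        unfolding pairs_before_def using fg by (intro Collect_cong conj_cong bex_cong refl) auto
      ultimately show "hit_row s r ?I h A f i \<longleftrightarrow> hit_row s r ?I h A g i"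
        unfolding hit_row_def by simp
    qed (use J r single q0 in auto)
    thus "measure_pmf.prob (rows_pmf s n m \<gamma>) {f. \<forall>i\<in>J. hit_row s r ?I h A f i} \<le> ?q ^ k"
      using J by simp
  qed (use k q0 in auto)
  thus ?thesis by simp
qed

text \<open>At least \<open>m * p / 4\<close> rows are good, and fewer than \<open>k\<close> of them
  are hit in each order. The size bound \<rho> stays inside the event because it does not depend on
  \<open>A\<close>: its failure is charged once, not for each of the many sets
  \<open>A\<close>.\<close>

lemma prob_few_clean:
  fixes h \<rho> W p y z :: real and k k2 r0 :: nat
  assumes A: "A \<subseteq> {1..n}" and s2: "2 \<le> s" and k: "k > 0" "k2 > 0"
    and p: "0 \<le> p" "p \<le> real (card A choose s) * (\<gamma> / s) ^ s * (1 - \<gamma>) ^ card A"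
    and yz: "1 \<le> y" "1 \<le> z" "\<gamma> * real (card A) * (z * y) \<le> 1"
    and h: "real r0 ^ 2 * real k2 + \<rho> * W \<le> h" and \<rho>: "0 \<le> \<rho>" "0 \<le> W"
  shows "measure_pmf.prob (rows_pmf s n m \<gamma>)
      {f. (\<forall>i\<in>{1..m}. real (card (supp_on {1..n} (f i))) \<le> \<rho>) \<and>
          real (card (clean_rows s {1..m} A f)) < real m * p / 4 - 2 * real k}
    \<le> exp (- real m * p / 4) + (exp 1 * real m * (real (card A) * \<gamma>)\<^sup>2 / real k2) ^ k2
      + (1 + 3 / y ^ r0) ^ m / z powr W
      + 2 * (exp 1 * real m * (h * real (card A) ^ (s - 2) * \<gamma> ^ s) / real k) ^ k"
proof -
  let ?M = "rows_pmf s n m \<gamma>" and ?I = "{1..m}"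
  have finA: "finite A" using A finite_subset by blast
  have h0: "h \<ge> 0" using h \<rho> by (smt (verit) mult_nonneg_nonneg of_nat_0_le_iff zero_le_power)
  define E1 where "E1 = {f :: nat \<Rightarrow> nat \<Rightarrow> nat. real (card {i \<in> ?I. good_row s A (f i)}) \<le> real m * p / 4}"
  define E2 where "E2 = {f :: nat \<Rightarrow> nat \<Rightarrow> nat. k2 \<le> card {i \<in> ?I. 2 \<le> card (supp_on A (f i))}}"
  define E3 where "E3 = {f :: nat \<Rightarrow> nat \<Rightarrow> nat. W \<le> (\<Sum>i\<in>{i \<in> ?I. r0 \<le> card (supp_on A (f i))}. real (card (supp_on A (f i))))}"
  define E4 where "E4 = {f. k \<le> card {i \<in> ?I. hit_row s int ?I h A f i}}"
  define E5 where "E5 = {f. k \<le> card {i \<in> ?I. hit_row s (\<lambda>i. - int i) ?I h A f i}}"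
  have "{f. (\<forall>i\<in>?I. real (card (supp_on {1..n} (f i))) \<le> \<rho>) \<and>
          real (card (clean_rows s ?I A f)) < real m * p / 4 - 2 * real k} \<subseteq> E1 \<union> E2 \<union> E3 \<union> (E4 \<union> E5)"
  proof (rule subsetI, rule ccontr)
    fix f :: "nat \<Rightarrow> nat \<Rightarrow> nat"
    assume f: "f \<in> {f. (\<forall>i\<in>?I. real (card (supp_on {1..n} (f i))) \<le> \<rho>) \<and>
          real (card (clean_rows s ?I A f)) < real m * p / 4 - 2 * real k}"
      and nE: "f \<notin> E1 \<union> E2 \<union> E3 \<union> (E4 \<union> E5)"
    have covered: "real (card (covered_pairs ?I A f)) \<le> real r0 ^ 2 * real k2 + \<rho> * W"
    proof (rule card_covered_pairs_le)
      fix i assume i: "i \<in> ?I"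
      have "card (supp_on A (f i)) \<le> card (supp_on {1..n} (f i))"
        using A by (intro card_mono) (auto simp: supp_on_def)
      hence "real (card (supp_on A (f i))) \<le> real (card (supp_on {1..n} (f i)))" by (rule of_nat_mono)
      also have "\<dots> \<le> \<rho>" using f i by blast
      finally show "real (card (supp_on A (f i))) \<le> \<rho>" .
    qed (use finA nE \<rho> in \<open>auto simp: E2_def E3_def\<close>)
    hence "real (card (covered_pairs ?I A f)) \<le> h" using h by linarith
    note sub = good_minus_clean[OF finA this, of s]
    have "card {i \<in> ?I. good_row s A (f i)} \<le> card (clean_rows s ?I A f \<union>
      ({i \<in> ?I. hit_row s int ?I h A f i} \<union> {i \<in> ?I. hit_row s (\<lambda>i. - int i) ?I h A f i}))"
      by (rule card_mono[OF _ sub]) (auto simp: clean_rows_def)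
    also have "\<dots> \<le> card (clean_rows s ?I A f) +
        (card {i \<in> ?I. hit_row s int ?I h A f i} + card {i \<in> ?I. hit_row s (\<lambda>i. - int i) ?I h A f i})"
      by (rule order_trans[OF card_Un_le add_left_mono[OF card_Un_le]])
    also have "\<dots> \<le> card (clean_rows s ?I A f) + (k + k)"
      using nE by (intro add_mono) (auto simp: E4_def E5_def)
    finally have "real (card {i \<in> ?I. good_row s A (f i)}) \<le> real (card (clean_rows s ?I A f)) + 2 * real k"
      by linarith
    moreover have "real (card {i \<in> ?I. good_row s A (f i)}) > real m * p / 4" using nE by (simp add: E1_def)
    ultimately show False using f by simp
  qed
  hence "measure_pmf.prob ?M {f. (\<forall>i\<in>?I. real (card (supp_on {1..n} (f i))) \<le> \<rho>) \<and>
          real (card (clean_rows s ?I A f)) < real m * p / 4 - 2 * real k}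
     \<le> measure_pmf.prob ?M (E1 \<union> E2 \<union> E3 \<union> (E4 \<union> E5))"
    by (rule measure_pmf.finite_measure_mono) simp
  also have "\<dots> \<le> measure_pmf.prob ?M E1 + measure_pmf.prob ?M E2 + measure_pmf.prob ?M E3 +
      (measure_pmf.prob ?M E4 + measure_pmf.prob ?M E5)"
  proof -
    have sub: "measure_pmf.prob ?M (X \<union> Y) \<le> measure_pmf.prob ?M X + measure_pmf.prob ?M Y" for X Y
      by (rule measure_Un_le) simp_all
    show ?thesis using sub[of "E1 \<union> E2 \<union> E3" "E4 \<union> E5"] sub[of "E1 \<union> E2" E3] sub[of E1 E2] sub[of E4 E5]
      by linarith
  qed
  also have "\<dots> \<le> exp (- real m * p / 4) + (exp 1 * real m * (real (card A) * \<gamma>)\<^sup>2 / real k2) ^ k2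
      + (1 + 3 / y ^ r0) ^ m / z powr W
      + ((exp 1 * real m * (h * real (card A) ^ (s - 2) * \<gamma> ^ s) / real k) ^ k
        + (exp 1 * real m * (h * real (card A) ^ (s - 2) * \<gamma> ^ s) / real k) ^ k)"
  proof (intro add_mono)
    show "measure_pmf.prob ?M E1 \<le> exp (- real m * p / 4)"
      unfolding E1_def using prob_good_row[OF A] p by (intro prob_few_good) auto
    show "measure_pmf.prob ?M E2 \<le> (exp 1 * real m * (real (card A) * \<gamma>)\<^sup>2 / real k2) ^ k2"
      unfolding E2_def by (rule prob_many_two[OF A k(2)])
    show "measure_pmf.prob ?M E3 \<le> (1 + 3 / y ^ r0) ^ m / z powr W"
      unfolding E3_def by (rule prob_large_sum[OF A yz])
    show "measure_pmf.prob ?M E4 \<le> (exp 1 * real m * (h * real (card A) ^ (s - 2) * \<gamma> ^ s) / real k) ^ k"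
      unfolding E4_def by (rule prob_many_hit[OF A k(1) _ h0 s2]) (auto simp: inj_on_def)
    show "measure_pmf.prob ?M E5 \<le> (exp 1 * real m * (h * real (card A) ^ (s - 2) * \<gamma> ^ s) / real k) ^ k"
      unfolding E5_def by (rule prob_many_hit[OF A k(1) _ h0 s2]) (auto simp: inj_on_def)
  qed
  finally show ?thesis by simp
qed

end

context exponents
begin

text \<open>Crowding and oversized random sets are excluded once each, so constant bounds suffice
  for them. Only the five events behind \<open>5 * \<epsilon>\<close> are multiplied by the number
  of sets \<open>A\<close>.\<close>

lemma rows_exist:
  fixes \<gamma> h \<rho> W p y z \<Lambda> \<epsilon> :: real and n m a K k k2 r0 :: nat
  assumes n: "1 \<le> n" and m: "1 \<le> m" "real m \<le> real n powr \<delta>"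
    and gam: "0 < \<gamma>" "\<gamma> < 1" "\<gamma> \<le> real n powr (\<alpha> - 1) / \<Lambda>" and \<Lambda>: "1 \<le> \<Lambda>"
    and k: "k > 0" "k2 > 0"
    and p: "0 \<le> p" "p \<le> real (a choose s) * (\<gamma> / s) ^ s * (1 - \<gamma>) ^ a"
    and yz: "1 \<le> y" "1 \<le> z" "\<gamma> * real a * (z * y) \<le> 1"
    and h: "real r0 ^ 2 * real k2 + \<rho> * W \<le> h" and \<rho>: "0 \<le> \<rho>" "0 \<le> W"
    and crowd: "real ((n + 1) ^ t * (m + 1) ^ t\<^sup>2) * (9 * 2 ^ (4 * t ^ 3) / \<Lambda>) ^ K < 1 / 3"
    and large: "real m * (exp (\<gamma> * real n) / 2 powr \<rho>) < 1 / 3"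
    and fail: "exp (- real m * p / 4) \<le> \<epsilon>"
      "(exp 1 * real m * (real a * \<gamma>)\<^sup>2 / real k2) ^ k2 \<le> \<epsilon>"
      "(1 + 3 / y ^ r0) ^ m / z powr W \<le> \<epsilon>"
      "(exp 1 * real m * (h * real a ^ (s - 2) * \<gamma> ^ s) / real k) ^ k \<le> \<epsilon>"
      "real n ^ a * (5 * \<epsilon>) < 1 / 3"
  obtains f :: "nat \<Rightarrow> nat \<Rightarrow> nat" where
    "\<And>i v. f i v \<le> s"
    "\<not> crowded n m K {(i, v). i \<in> {1..m} \<and> v \<in> {1..n} \<and> f i v \<noteq> 0}"
    "\<And>A. A \<subseteq> {1..n} \<Longrightarrow> card A = a \<Longrightarrow>
       real m * p / 4 - 2 * real k \<le> real (card (clean_rows s {1..m} A f))"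
proof -
  let ?M = "rows_pmf s n m \<gamma>"
  interpret labels s \<gamma> using s3 gam by unfold_locales auto
  define AA where "AA = {A. A \<subseteq> {1..n} \<and> card A = a}"
  have finAA: "finite AA" unfolding AA_def by (rule finite_subset[of _ "Pow {1..n}"]) auto
  define C where "C = {f :: nat \<Rightarrow> nat \<Rightarrow> nat. crowded n m K {(i, v). i \<in> {1..m} \<and> v \<in> {1..n} \<and> f i v \<noteq> 0}}"
  define L where "L = {f :: nat \<Rightarrow> nat \<Rightarrow> nat. \<exists>i\<in>{1..m}. real (card (supp_on {1..n} (f i))) > \<rho>}"
  define E where "E A = {f. (\<forall>i\<in>{1..m}. real (card (supp_on {1..n} (f i))) \<le> \<rho>) \<and>
          real (card (clean_rows s {1..m} A f)) < real m * p / 4 - 2 * real k}" for A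
  have E: "measure_pmf.prob ?M (E A) \<le> 5 * \<epsilon>" if A: "A \<in> AA" for A
  proof -
    have A': "A \<subseteq> {1..n}" "card A = a" using A by (auto simp: AA_def)
    have "measure_pmf.prob ?M (E A) \<le> exp (- real m * p / 4) + (exp 1 * real m * (real (card A) * \<gamma>)\<^sup>2 / real k2) ^ k2
      + (1 + 3 / y ^ r0) ^ m / z powr W
      + 2 * (exp 1 * real m * (h * real (card A) ^ (s - 2) * \<gamma> ^ s) / real k) ^ k"
      unfolding E_def by (rule prob_few_clean[OF A'(1) _ k _ _ yz(1,2) _ h \<rho>]) (use s3 p yz A'(2) in auto)
    thus ?thesis using fail(1-4) unfolding A'(2) by linarith
  qed
  have "measure_pmf.prob ?M (\<Union>A\<in>AA. E A) \<le> (\<Sum>A\<in>AA. measure_pmf.prob ?M (E A))"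
    by (rule measure_pmf.finite_measure_subadditive_finite[OF finAA]) simp
  also have "\<dots> \<le> (\<Sum>A\<in>AA. 5 * \<epsilon>)" by (intro sum_mono E)
  also have "\<dots> = real (card AA) * (5 * \<epsilon>)" by simp
  also have "\<dots> \<le> real (n ^ a) * (5 * \<epsilon>)"
  proof (intro mult_right_mono of_nat_mono)
    have "card AA = n choose a" unfolding AA_def by (subst n_subsets) auto
    also have "\<dots> \<le> (n choose a) * fact a" by simp
    also have "\<dots> \<le> n ^ a" by (rule binomial_fact_pow)
    finally show "card AA \<le> n ^ a" .
    show "0 \<le> 5 * \<epsilon>" using fail(1) exp_ge_zero[of "- real m * p / 4"] by linarith
  qed
  finally have 1: "measure_pmf.prob ?M (\<Union>A\<in>AA. E A) < 1 / 3" using fail(5) by simp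
  have 2: "measure_pmf.prob ?M C < 1 / 3"
    unfolding C_def by (rule le_less_trans[OF prob_crowded[OF n m gam \<Lambda>] crowd])
  have 3: "measure_pmf.prob ?M L < 1 / 3"
    unfolding L_def by (rule le_less_trans[OF prob_large_set large])
  have sub: "measure_pmf.prob ?M (X \<union> Y) \<le> measure_pmf.prob ?M X + measure_pmf.prob ?M Y" for X Y
    by (rule measure_Un_le) simp_all
  have "measure_pmf.prob ?M {f. f \<in> C \<union> L \<union> (\<Union>A\<in>AA. E A)} < 1"
    using sub[of "C \<union> L" "\<Union>A\<in>AA. E A"] sub[of C L] 1 2 3 unfolding Collect_mem_eq by linarith
  then obtain f where f: "f \<in> set_pmf ?M" "f \<notin> C \<union> L \<union> (\<Union>A\<in>AA. E A)"
    by (rule exists_of_prob_less_1)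
  have "f i v \<le> s" for i v
  proof -
    have row: "x v \<le> s" if "x \<in> set_pmf (row_pmf s n \<gamma>)" for x v
    proof (cases "v \<in> {1..n}")
      case True
      have "x v \<in> set_pmf (label_pmf s \<gamma>)"
        using that True unfolding row_pmf_def by (auto simp: set_Pi_pmf PiE_dflt_def)
      thus ?thesis using set_label_pmf by auto
    next
      case False
      hence "x v = 0" using that unfolding row_pmf_def by (auto simp: set_Pi_pmf PiE_dflt_def)
      thus ?thesis by simp
    qed
    show ?thesis
    proof (cases "i \<in> {1..m}")
      case True
      have "f i \<in> set_pmf (row_pmf s n \<gamma>)"
        using f(1) True unfolding rows_pmf_def by (auto simp: set_Pi_pmf PiE_dflt_def)
      thus ?thesis by (rule row)
    next
      case False
      hence "f i = (\<lambda>_. 0)" using f(1) unfolding rows_pmf_def by (auto simp: set_Pi_pmf PiE_dflt_def)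
      thus ?thesis by simp
    qed
  qed
  moreover have "\<not> crowded n m K {(i, v). i \<in> {1..m} \<and> v \<in> {1..n} \<and> f i v \<noteq> 0}"
    using f(2) by (simp add: C_def)
  moreover have "real m * p / 4 - 2 * real k \<le> real (card (clean_rows s {1..m} A f))"
    if "A \<subseteq> {1..n}" "card A = a" for A
  proof -
    have "f \<notin> L" "f \<notin> E A" using f(2) that by (auto simp: AA_def)
    thus ?thesis unfolding L_def E_def by force
  qed
  ultimately show ?thesis by (rule that)
qed

end

section \<open>Early edges\<close>

context layout
begin

text \<open>For a clean row \<open>i\<close>, \<open>C A i\<close> holds the edges of its
  \<open>K_s\<close>, which should be early, and \<open>N A i\<close> the other edges of all cores
  meeting it, which should be late. Since an edge lies in at most \<open>D\<close> cores, these sets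
  are small and overlap little, as \<open>choose_subset\<close> demands.\<close>

lemma early_set:
  fixes f :: "nat \<Rightarrow> nat \<Rightarrow> nat" and K a r :: nat and p :: real
  assumes S: "\<And>i. S i = {v \<in> {1..n}. f i v \<noteq> 0}" and lab: "\<And>i v. v \<in> S i \<Longrightarrow> lab i v = f i v"
    and fs: "\<And>i v. f i v \<le> s"
    and nc: "\<not> crowded n m K incidences" and K: "2 \<le> K"
    and D_def: "D = (K * (t + t\<^sup>2) + 1) ^ (t + t\<^sup>2)"
    and many: "\<And>A. A \<subseteq> {1..n} \<Longrightarrow> card A = a \<Longrightarrow>
      r * ((s\<^sup>2 + s\<^sup>2 * (D * t\<^sup>2)) * (1 + D * t\<^sup>2)) \<le> card (clean_rows s {1..m} A f)"
    and p: "0 < p" "p < 1"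
    and small: "real (n choose a) * (1 - p ^ (s\<^sup>2) * (1 - p) ^ (s\<^sup>2 * (D * t\<^sup>2))) ^ r < 1"
  obtains F where "\<And>\<beta> A. (\<And>e g. e \<in> nsets {1..n} 2 \<Longrightarrow> g \<in> nsets {1..n} 2 \<Longrightarrow> e \<in> F \<Longrightarrow> g \<notin> F \<Longrightarrow> \<beta> e < \<beta> g) \<Longrightarrow>
     A \<subseteq> {1..n} \<Longrightarrow> card A = a \<Longrightarrow> \<exists>T. clique_copy s A (G \<beta>) T"
proof -
  let ?U = "nsets {1..n} 2"
  define AA where "AA = {A. A \<subseteq> {1..n} \<and> card A = a}"
  define I where "I A = clean_rows s {1..m} A f" for A
  define T where "T A i = supp_on A (f i)" for A i
  define C where "C A i = nsets (T A i) 2" for A i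
  define N where "N A i = (\<Union>Y\<in>{Y \<in> cores. nsets Y 2 \<inter> C A i \<noteq> {}}. nsets Y 2) - C A i" for A i
  have finU: "finite ?U" by (rule finite_pairs)
  have finAA: "finite AA" unfolding AA_def by (rule finite_subset[of _ "Pow {1..n}"]) auto
  have degree: "card {Y \<in> cores. e \<in> nsets Y 2} \<le> D" for e
  proof (cases "\<exists>x y. e = {x, y} \<and> x \<noteq> y")
    case True
    then obtain x y where xy: "e = {x, y}" "x \<noteq> y" by blast
    have "{Y \<in> cores. e \<in> nsets Y 2} = {Y \<in> cores. {x, y} \<subseteq> Y}" using xy by auto
    thus ?thesis using core_degree[OF nc K xy(2)] by (simp add: D_def)
  next
    case False
    hence "{Y \<in> cores. e \<in> nsets Y 2} = {}" by (auto elim: nsets2_E)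
    thus ?thesis by (simp only: card.empty)
  qed
  have finUN: "finite (\<Union>Y\<in>{Y \<in> cores. e \<in> nsets Y 2}. nsets Y 2)" for e
  proof (rule finite_UN_I)
    show "finite {Y \<in> cores. e \<in> nsets Y 2}" using finite_cores by simp
    show "finite (nsets Y 2)" if "Y \<in> {Y \<in> cores. e \<in> nsets Y 2}" for Y
      using that finite_core[of Y] by (simp add: finite_imp_finite_nsets)
  qed
  have card_nsets_core: "card (nsets Y 2) \<le> t\<^sup>2" if "Y \<in> cores" for Y
  proof -
    have "card (nsets Y 2) \<le> (card Y choose 2) * fact 2"
      using finite_core[OF that] by (simp add: card_nsets)
    also have "\<dots> \<le> card Y ^ 2" by (rule binomial_fact_pow)
    also have "\<dots> \<le> t\<^sup>2" using core_card_le[OF that] by (intro power_mono) auto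
    finally show ?thesis .
  qed
  have TS: "T A i \<subseteq> S i" "T A i \<subseteq> A" if "A \<in> AA" for A i
    using that by (auto simp: AA_def T_def supp_on_def S)
  have row: "i \<in> {1..m}" "card (T A i) = s" "inj_on (f i) (T A i)"
    and lone: "\<And>j e. j \<in> {1..m} \<Longrightarrow> e \<in> C A i \<Longrightarrow> e \<subseteq> S j \<Longrightarrow> j = i"
    if Ai: "A \<in> AA" "i \<in> I A" for A i
  proof -
    have i: "i \<in> {1..m}" "good_row s A (f i)"
      "\<And>j e. j \<in> {1..m} \<Longrightarrow> j \<noteq> i \<Longrightarrow> e \<in> nsets A 2 \<Longrightarrow> \<forall>v\<in>e. f i v \<noteq> 0 \<Longrightarrow> \<not> (\<forall>v\<in>e. f j v \<noteq> 0)"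
      using Ai(2) unfolding I_def clean_rows_def by blast+
    show "i \<in> {1..m}" "card (T A i) = s" "inj_on (f i) (T A i)"
      using i(1,2) by (simp_all add: good_row_def T_def)
    fix j e assume j: "j \<in> {1..m}" and e: "e \<in> C A i" and eS: "e \<subseteq> S j"
    have "e \<in> nsets A 2" "\<forall>v\<in>e. f i v \<noteq> 0"
      using e unfolding C_def T_def nsets_def supp_on_def by auto
    moreover have "\<forall>v\<in>e. f j v \<noteq> 0" using eS by (auto simp: S)
    ultimately show "j = i" using i(3)[OF j] by blast
  qed
  have edge: "e \<in> E1" if Ai: "A \<in> AA" "i \<in> I A" and e: "e \<in> C A i" for A i e
  proof -
    obtain x y where xy: "e = {x, y}" "x \<noteq> y" "x \<in> T A i" "y \<in> T A i"
      using e unfolding C_def by (auto elim: nsets2_E)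
    have xS: "x \<in> S i" "y \<in> S i" using TS(1)[OF Ai(1)] xy by auto
    have nz: "f i x \<noteq> 0" "f i y \<noteq> 0" using xy(3,4) by (simp_all add: T_def supp_on_def)
    show ?thesis unfolding xy(1)
    proof (rule E1_I[OF row(1)[OF Ai] xS])
      show "lab i x \<noteq> lab i y"
        using inj_onD[OF row(3)[OF Ai]] xy lab[OF xS(1)] lab[OF xS(2)] by metis
      show "lab i x \<in> {1..s}" "lab i y \<in> {1..s}"
        using fs[of i x] fs[of i y] nz lab[OF xS(1)] lab[OF xS(2)] by auto
      fix j assume "j \<in> {1..m}" "x \<in> S j" "y \<in> S j"
      thus "j = i" using lone[OF Ai, of j e] e xy(1) by simp
    qed
  qed
  \<comment> \<open>An edge in the supports of two clean rows would contradict cleanness, so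
    different rows have disjoint edge sets \<open>C A i\<close>.\<close>
  have deg1: "card {i \<in> I A. x \<in> C A i} \<le> 1" if A: "A \<in> AA" for A x
  proof -
    have same: "i = j" if "i \<in> I A" "j \<in> I A" "x \<in> C A i" "x \<in> C A j" for i j
    proof -
      have "x \<subseteq> S j" using that(4) TS(1)[OF A, of j] unfolding C_def nsets_def by blast
      thus ?thesis using lone[OF A that(1) row(1)[OF A that(2)] that(3)] by simp
    qed
    have fin: "finite {i \<in> I A. x \<in> C A i}" by (simp add: I_def clean_rows_def)
    have "card {i \<in> I A. x \<in> C A i} \<le> Suc 0"
      unfolding card_le_Suc0_iff_eq[OF fin] by (intro ballI same) simp_all
    thus ?thesis by simp
  qed
  have finI: "finite (I A)" for A by (simp add: I_def clean_rows_def)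
  have finT: "finite (T A i)" if "A \<in> AA" for A i
    using TS(2)[OF that] that finite_subset[of _ "{1..n}"] unfolding AA_def
    by (metis (no_types, lifting) finite_atLeastAtMost mem_Collect_eq order_trans)
  have cC: "card (C A i) \<le> s\<^sup>2" if Ai: "A \<in> AA" "i \<in> I A" for A i
  proof -
    have "card (C A i) \<le> (card (T A i) choose 2) * fact 2"
      using finT[OF Ai(1)] by (simp add: C_def card_nsets)
    also have "\<dots> \<le> card (T A i) ^ 2" by (rule binomial_fact_pow)
    finally show ?thesis using row(2)[OF Ai] by simp
  qed
  have finC: "finite (C A i)" if "A \<in> AA" for A i
    unfolding C_def using finT[OF that] by (simp add: finite_imp_finite_nsets)
  have cN: "card (N A i) \<le> s\<^sup>2 * (D * t\<^sup>2)" if Ai: "A \<in> AA" "i \<in> I A" for A i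
  proof -
    have "N A i \<subseteq> (\<Union>e\<in>C A i. \<Union>Y\<in>{Y \<in> cores. e \<in> nsets Y 2}. nsets Y 2)"
      unfolding N_def by blast
    hence "card (N A i) \<le> card (\<Union>e\<in>C A i. \<Union>Y\<in>{Y \<in> cores. e \<in> nsets Y 2}. nsets Y 2)"
      by (rule card_mono[OF finite_UN_I[OF finC[OF Ai(1)] finUN]])
    also have "\<dots> \<le> (\<Sum>e\<in>C A i. card (\<Union>Y\<in>{Y \<in> cores. e \<in> nsets Y 2}. nsets Y 2))"
      by (rule card_UN_le[OF finC[OF Ai(1)]])
    also have "\<dots> \<le> (\<Sum>e\<in>C A i. D * t\<^sup>2)"
    proof (rule sum_mono)
      fix e
      have "card (\<Union>Y\<in>{Y \<in> cores. e \<in> nsets Y 2}. nsets Y 2) \<le> (\<Sum>Y\<in>{Y \<in> cores. e \<in> nsets Y 2}. card (nsets Y 2))"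
        using finite_cores by (intro card_UN_le) auto
      also have "\<dots> \<le> (\<Sum>Y\<in>{Y \<in> cores. e \<in> nsets Y 2}. t\<^sup>2)" using card_nsets_core by (intro sum_mono) blast
      also have "\<dots> \<le> D * t\<^sup>2" using degree[of e] by simp
      finally show "card (\<Union>Y\<in>{Y \<in> cores. e \<in> nsets Y 2}. nsets Y 2) \<le> D * t\<^sup>2" .
    qed
    also have "\<dots> \<le> s\<^sup>2 * (D * t\<^sup>2)" using cC[OF Ai] by simp
    finally show ?thesis .
  qed
  \<comment> \<open>If \<open>x\<close> is in \<open>N A i\<close>, then \<open>x\<close> shares a
    core with some edge of \<open>C A i\<close>. At most \<open>D * t^2\<close> edges share a core
    with \<open>x\<close>, and each lies in \<open>C A i\<close> for at most one
    \<open>i\<close>.\<close>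
  have deg: "card {i \<in> I A. x \<in> C A i \<union> N A i} \<le> 1 + D * t\<^sup>2" if A: "A \<in> AA" for A x
  proof -
    let ?V = "\<Union>Y\<in>{Y \<in> cores. x \<in> nsets Y 2}. nsets Y 2"
    have finV: "finite ?V" by (rule finUN)
    have "{i \<in> I A. x \<in> C A i \<union> N A i} \<subseteq> {i \<in> I A. x \<in> C A i} \<union> (\<Union>e\<in>?V. {i \<in> I A. e \<in> C A i})"
      unfolding N_def by blast
    hence "card {i \<in> I A. x \<in> C A i \<union> N A i} \<le> card ({i \<in> I A. x \<in> C A i} \<union> (\<Union>e\<in>?V. {i \<in> I A. e \<in> C A i}))"
    proof (rule card_mono[rotated])
      have "finite {i \<in> I A. P i}" for P using finI by simp
      thus "finite ({i \<in> I A. x \<in> C A i} \<union> (\<Union>e\<in>?V. {i \<in> I A. e \<in> C A i}))"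
        by (intro finite_UnI finite_UN_I[OF finV])
    qed
    also have "\<dots> \<le> card {i \<in> I A. x \<in> C A i} + card (\<Union>e\<in>?V. {i \<in> I A. e \<in> C A i})" by (rule card_Un_le)
    also have "card (\<Union>e\<in>?V. {i \<in> I A. e \<in> C A i}) \<le> (\<Sum>e\<in>?V. card {i \<in> I A. e \<in> C A i})"
      by (rule card_UN_le[OF finV])
    also have "\<dots> \<le> (\<Sum>e\<in>?V. 1)" by (intro sum_mono deg1[OF A])
    also have "\<dots> = card ?V" by simp
    also have "card ?V \<le> (\<Sum>Y\<in>{Y \<in> cores. x \<in> nsets Y 2}. card (nsets Y 2))"
      using finite_cores by (intro card_UN_le) auto
    also have "\<dots> \<le> (\<Sum>Y\<in>{Y \<in> cores. x \<in> nsets Y 2}. t\<^sup>2)" using card_nsets_core by (intro sum_mono) blast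
    also have "\<dots> \<le> D * t\<^sup>2" using degree[of x] by simp
    finally show ?thesis using deg1[OF A, of x] by linarith
  qed
  have CU: "C A i \<subseteq> ?U" if "A \<in> AA" for A i
    unfolding C_def using TS(2)[OF that] that by (intro nsets_mono) (auto simp: AA_def)
  have NU: "N A i \<subseteq> ?U" for A i
    unfolding N_def using nsets_mono[OF core_subset] by blast
  obtain F where F: "\<And>A. A \<in> AA \<Longrightarrow> \<exists>i\<in>I A. C A i \<subseteq> F \<and> N A i \<inter> F = {}"
  proof (rule choose_subset[OF finU p finAA, of I r "s\<^sup>2" "s\<^sup>2 * (D * t\<^sup>2)" "1 + D * t\<^sup>2" C N])
    show "finite (I A) \<and> r * ((s\<^sup>2 + s\<^sup>2 * (D * t\<^sup>2)) * (1 + D * t\<^sup>2)) \<le> card (I A)" if "A \<in> AA" for A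
      using finI many that by (simp add: AA_def I_def)
    show "0 < (s\<^sup>2 + s\<^sup>2 * (D * t\<^sup>2)) * (1 + D * t\<^sup>2)" using s3 by simp
    show "C A i \<subseteq> ?U \<and> C A i \<noteq> {} \<and> card (C A i) \<le> s\<^sup>2" if Ai: "A \<in> AA" "i \<in> I A" for A i
    proof -
      have "card (C A i) = s choose 2" using row(2)[OF Ai] finT[OF Ai(1)] by (simp add: C_def card_nsets)
      hence "card (C A i) \<noteq> 0" using s3 by (simp add: binomial_eq_0_iff)
      hence "C A i \<noteq> {}" by (metis card.empty)
      thus ?thesis using CU[OF Ai(1)] cC[OF Ai] by blast
    qed
    show "N A i \<subseteq> ?U \<and> card (N A i) \<le> s\<^sup>2 * (D * t\<^sup>2) \<and> C A i \<inter> N A i = {}" if "A \<in> AA" "i \<in> I A" for A i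
      using NU cN[OF that] by (auto simp: N_def)
    show "card {i \<in> I A. x \<in> C A i \<union> N A i} \<le> 1 + D * t\<^sup>2" if "A \<in> AA" for A x by (rule deg[OF that])
    fix F assume "\<And>A. A \<in> AA \<Longrightarrow> \<exists>i\<in>I A. C A i \<subseteq> F \<and> N A i \<inter> F = {}"
    thus thesis by (rule that)
  next
    have "card AA = n choose a" unfolding AA_def by (subst n_subsets) auto
    thus "real (card AA) * (1 - p ^ s\<^sup>2 * (1 - p) ^ (s\<^sup>2 * (D * t\<^sup>2))) ^ r < 1" using small by simp
  qed
  show ?thesis
  proof (rule that)
    fix \<beta> :: "nat set \<Rightarrow> real" and A
    assume \<beta>: "\<And>e g. e \<in> ?U \<Longrightarrow> g \<in> ?U \<Longrightarrow> e \<in> F \<Longrightarrow> g \<notin> F \<Longrightarrow> \<beta> e < \<beta> g"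
      and "A \<subseteq> {1..n}" "card A = a"
    hence A: "A \<in> AA" by (simp add: AA_def)
    then obtain i where i: "i \<in> I A" "C A i \<subseteq> F" "N A i \<inter> F = {}" using F by blast
    have "e \<in> G \<beta>" if e: "e \<in> C A i" for e
    proof (rule G_early[OF edge[OF A i(1) e]])
      show "e \<in> F" using e i(2) by blast
      show "\<beta> e < \<beta> g" if "g \<in> ?U" "g \<notin> F" for g
        using \<beta>[OF _ that(1) _ that(2), of e] e i(2) CU[OF A, of i] by blast
      fix Y assume Y: "Y \<in> cores" "e \<in> nsets Y 2"
      obtain x y where xy: "e = {x, y}" "x \<noteq> y" using Y(2) by (auto elim: nsets2_E)
      \<comment> \<open>A core leaves the colour \<open>S i\<close>, hence has a node
        \<open>v\<close> outside the \<open>K_s\<close>. The edge from \<open>x\<close> to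
        \<open>v\<close> is one of the late edges in \<open>N A i\<close>.\<close>
      have "\<not> Y \<subseteq> T A i"
        using core_not_monochromatic[OF Y(1) row(1)[OF A i(1)]] TS(1)[OF A, of i] by blast
      then obtain v where v: "v \<in> Y" "v \<notin> T A i" by blast
      have xT: "x \<in> T A i" using e xy unfolding C_def by simp
      hence "{x, v} \<in> nsets Y 2" using v Y(2) xy by auto
      moreover have "{x, v} \<notin> C A i" using v(2) unfolding C_def by auto
      ultimately have "{x, v} \<in> N A i" unfolding N_def using Y e by blast
      thus "\<not> nsets Y 2 \<subseteq> F" using \<open>{x, v} \<in> nsets Y 2\<close> i(3) by blast
    qed
    hence "clique_copy s A (G \<beta>) (T A i)"
      using TS(2)[OF A, of i] row(2)[OF A i(1)] unfolding clique_copy_def clique_def C_def by simp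
    thus "\<exists>T. clique_copy s A (G \<beta>) T" by blast
  qed
qed

end

lemma (in exponents) positive_from_rows:
  fixes f :: "nat \<Rightarrow> nat \<Rightarrow> nat" and n m K a r :: nat and p \<gamma> :: real
  assumes core_rule: "core_rule s t \<kappa>" and gam: "0 < \<gamma>" "\<gamma> < 1"
    and fs: "\<And>i v. f i v \<le> s"
    and nc: "\<not> crowded n m K {(i, v). i \<in> {1..m} \<and> v \<in> {1..n} \<and> f i v \<noteq> 0}" and K: "2 \<le> K"
    and D_def: "D = (K * (t + t\<^sup>2) + 1) ^ (t + t\<^sup>2)"
    and many: "\<And>A. A \<subseteq> {1..n} \<Longrightarrow> card A = a \<Longrightarrow>
      r * ((s\<^sup>2 + s\<^sup>2 * (D * t\<^sup>2)) * (1 + D * t\<^sup>2)) \<le> card (clean_rows s {1..m} A f)"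
    and p: "0 < p" "p < 1"
    and small: "real (n choose a) * (1 - p ^ (s\<^sup>2) * (1 - p) ^ (s\<^sup>2 * (D * t\<^sup>2))) ^ r < 1"
  shows "measure (outcomes s n m \<gamma>) {\<omega> \<in> space (outcomes s n m \<gamma>).
           \<forall>A. A \<subseteq> {1..n} \<and> card A = a \<longrightarrow> (\<exists>T. clique_copy s A (random_graph s t \<kappa> n m \<omega>) T)} > 0"
proof -
  define h where "h p \<longleftrightarrow> f (fst p) (snd p) \<noteq> 0" for p
  \<comment> \<open>The value 0 encodes absence from \<open>S i\<close>. The probability space draws
    a label from \<open>{1..s}\<close> there too, so 1 is substituted.\<close>
  define l where "l p = max 1 (f (fst p) (snd p))" for p
  define S where "S i = {v \<in> {1..n}. f i v \<noteq> 0}" for i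
  interpret layout s t n m \<kappa> S "\<lambda>i v. l (i, v)"
    using core_rule by unfold_locales (auto simp: S_def)
  have inc: "incidences = {(i, v). i \<in> {1..m} \<and> v \<in> {1..n} \<and> f i v \<noteq> 0}"
    by (auto simp: incidences_def S_def)
  obtain F where F: "\<And>\<beta> A. (\<And>e g. e \<in> nsets {1..n} 2 \<Longrightarrow> g \<in> nsets {1..n} 2 \<Longrightarrow> e \<in> F \<Longrightarrow> g \<notin> F \<Longrightarrow> \<beta> e < \<beta> g) \<Longrightarrow>
     A \<subseteq> {1..n} \<Longrightarrow> card A = a \<Longrightarrow> \<exists>T. clique_copy s A (G \<beta>) T"
    by (rule early_set[OF S_def _ fs _ K D_def many p small])
      (use nc in \<open>auto simp: inc l_def S_def\<close>)
  show ?thesis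
  proof (rule positive_probability[OF exponents_axioms core_rule gam, where h = h and l = l and F = F])
    show "l p \<in> {1..s}" for p using fs[of "fst p" "snd p"] s3 by (auto simp: l_def)
    fix \<omega> :: outcome
    assume 1: "\<And>i v. i \<in> {1..m} \<Longrightarrow> v \<in> {1..n} \<Longrightarrow> fst \<omega> (i, v) = h (i, v)"
      and 2: "\<And>i v. i \<in> {1..m} \<Longrightarrow> v \<in> {1..n} \<Longrightarrow> fst (snd \<omega>) (i, v) = l (i, v)"
      and 3: "\<And>e g. e \<in> nsets {1..n} 2 \<Longrightarrow> g \<in> nsets {1..n} 2 \<Longrightarrow> e \<in> F \<Longrightarrow> g \<notin> F \<Longrightarrow> snd (snd \<omega>) e < snd (snd \<omega>) g"
    \<comment> \<open>\<open>\<omega>\<close> agrees with \<open>h\<close> and \<open>l\<close> only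
      on the index set, while \<open>G\<close> belongs to the total functions;
      \<open>random_graph_cong\<close> bridges the difference.\<close>
    define \<omega>' :: outcome where "\<omega>' = (h, l, snd (snd \<omega>))"
    have "order_data n m \<omega> = order_data n m \<omega>'"
      using 1 2 by (auto simp: order_data_def \<omega>'_def fun_eq_iff restrict_def)
    hence "random_graph s t \<kappa> n m \<omega> = random_graph s t \<kappa> n m \<omega>'"
      by (rule random_graph_cong[OF exponents_axioms core_rule])
    also have "\<dots> = G (snd (snd \<omega>))"
    proof -
      have "random_set n \<omega>' = S" by (auto simp: random_set_def \<omega>'_def S_def h_def fun_eq_iff)
      moreover from this have "random_part n \<omega>' = P" by (auto simp: random_part_def P_def \<omega>'_def fun_eq_iff)
      ultimately show ?thesis by (simp add: random_graph_def G_def \<omega>'_def)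
    qed
    finally show "\<forall>A. A \<subseteq> {1..n} \<and> card A = a \<longrightarrow> (\<exists>T. clique_copy s A (random_graph s t \<kappa> n m \<omega>) T)"
      using F[OF 3] by simp
  qed
qed

lemma (in exponents) random_graph_clique_free:
  assumes "core_rule s t \<kappa>"
  shows "\<not> clique_copy t {1..n} (random_graph s t \<kappa> n m \<omega>) X"
proof -
  interpret layout s t n m \<kappa> "random_set n \<omega>" "\<lambda>i v. fst (snd \<omega>) (i, v)"
    using assms by unfold_locales (auto simp: random_set_def)
  have "random_part n \<omega> = P" by (intro ext) (simp add: random_part_def P_def)
  hence "random_graph s t \<kappa> n m \<omega> = G (snd (snd \<omega>))" by (simp add: random_graph_def G_def)
  thus ?thesis using G_clique_free by simp
qed

section \<open>Choice of the parameters\<close>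

lemma eventually_ln_power_le:
  fixes e :: real
  assumes "e > 0"
  shows "\<forall>\<^sub>F n in sequentially. ln (real n) ^ k \<le> real n powr e"
proof -
  have "((\<lambda>x. (e / (real k + 1)) powr real k * (ln x powr real k) / x powr e) \<longlongrightarrow> 0) at_top"
    using assms by real_asymp
  hence lim: "((\<lambda>n. (e / (real k + 1)) powr real k * (ln (real n) powr real k) / real n powr e) \<longlongrightarrow> 0) sequentially"
    by (rule filterlim_compose[OF _ filterlim_real_sequentially])
  have pos: "(e / (real k + 1)) powr real k > 0" using assms by simp
  have "\<forall>\<^sub>F n in sequentially. (e / (real k + 1)) powr real k * (ln (real n) powr real k) / real n powr e < (e / (real k + 1)) powr real k"
    by (rule order_tendstoD(2)[OF lim pos])
  moreover have "\<forall>\<^sub>F n in sequentially. n \<ge> (2::nat)" by (rule eventually_ge_at_top)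
  ultimately show ?thesis
  proof eventually_elim
    case (elim n)
    hence ln: "ln (real n) > 0" by simp
    have "ln (real n) powr real k / real n powr e < 1"
      using elim pos by (simp add: mult_less_cancel_left_pos flip: times_divide_eq_right)
    hence "ln (real n) powr real k \<le> real n powr e"
      using elim by (simp add: divide_less_eq_1_pos)
    thus ?case using ln by (simp add: powr_realpow)
  qed
qed

context exponents
begin

text \<open>It yields \<open>m \<le> n^2\<close>, so that the number of kernels in
  \<open>prob_crowded\<close> is polynomial in \<open>n\<close>.\<close>

lemma delta_le: "\<delta> \<le> 2"
proof -
  have "(2 * real s - 3) * \<delta> = (2 * real s - 2) - (2 * real s - 1) * w"
    by (simp add: delta_def w_def algebra_simps power2_eq_square)
  also have "\<dots> \<le> (2 * real s - 3) * 2" using w_pos q_bounds by (smt (verit) mult_pos_pos)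
  finally have "(2 * real s - 3) * \<delta> \<le> (2 * real s - 3) * 2" .
  from mult_left_le_imp_le[OF this] show ?thesis using q_bounds by simp
qed

text \<open>The choice \<open>c1 = c2 = 1\<close> works: one factor 1 / log n in \<gamma> beats the
  constant in \<open>petals_weight\<close>, and the polylogarithmic losses are absorbed by
  \<open>c3\<close>.\<close>

lemma positive_for_large_n:
  obtains c3 N :: nat where "c3 > 0"
    "\<And>n \<kappa>. N \<le> n \<Longrightarrow> core_rule s t \<kappa> \<Longrightarrow>
       measure (construction_space s t 1 1 n) {\<omega> \<in> space (construction_space s t 1 1 n).
         \<forall>A. A \<subseteq> {1..n} \<and> card A = target_size s t (real c3) n \<longrightarrow>
           (\<exists>T. clique_copy s A (construction_graph s t \<kappa> 1 n \<omega>) T)} > 0"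
proof -
  define \<tau> where "\<tau> = t + t\<^sup>2"
  \<comment> \<open>The required number of clean rows is \<open>a * L\<close> times
    \<open>s^2 + 2\<close> factors of order \<open>L ^ \<tau>\<close>; one more \<open>L\<close>
    beats the constants. The summand 4 also gives \<open>1 + 2 * c \<le> 3 * (c - 1)\<close>, used
    for \<open>mp\<close>.\<close>
  define c where "c = \<tau> * (s\<^sup>2 + 2) + 4"
  \<comment> \<open>\<open>a * \<gamma>\<close> is about n^(2\<alpha> - 1) = n^(-4 c4). Of this,
    n^(2 c4) is spent on \<open>z * z\<close> below, and n^(2 c4) remains for powers of the
    logarithm.\<close>
  define c4 where "c4 = (1 - 2 * \<alpha>) / 4"
  \<comment> \<open>Chosen so that \<open>z ^ r0 \<ge> n^2 \<ge> m\<close>, which keeps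
    \<open>(1 + 3 / z ^ r0) ^ m\<close> below \<open>exp 3\<close>.\<close>
  define r0 where "r0 = nat \<lceil>2 / c4\<rceil>"
  define \<sigma> where "\<sigma> = real s ^ (2 * s)"
  \<comment> \<open>With \<open>h = \<eta> * a^2\<close> the probability of a hit is at most
    \<open>p / 288\<close>. Against \<open>k \<ge> m * p / 32\<close> this leaves the base 3 * 32 /
    288 = 1 / 3, below \<open>exp (- 1)\<close>.\<close>
  define \<eta> where "\<eta> = 1 / (576 * \<sigma>)"
  \<comment> \<open>From \<open>n + 1 \<le> n^2\<close> and \<open>m + 1 \<le> n^3\<close> there are
    at most n^(2t + 3t^2) kernels; the extra 2 leaves n^(-2).\<close>
  define B where "B = 2 * t + 3 * t\<^sup>2 + 2"
  define d where "d = real (3 * \<tau>) ^ \<tau>"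
  define Eb where "Eb = 2 * real (s\<^sup>2) * real (t\<^sup>2) * d"
  define CC where "CC = {16, 9 * 2 ^ (4 * t ^ 3) * exp (real B), real s, 36 * (real r0)\<^sup>2 / \<eta>, 10 / (c4 * \<eta>),
     512 * \<sigma>, 384 * \<sigma> * Eb ^ (s\<^sup>2 + 2)}"
  define Cst where "Cst = Max CC"
  have c4: "c4 > 0" using alpha_less by (simp add: c4_def)
  have \<sigma>: "\<sigma> \<ge> 1" using s3 by (simp add: \<sigma>_def)
  have \<eta>: "\<eta> > 0" using \<sigma> by (simp add: \<eta>_def)
  have \<tau>: "\<tau> \<ge> 1" using s3 st by (simp add: \<tau>_def)
  have r0: "real r0 * c4 \<ge> 2" "r0 > 0"
  proof -
    have "2 / c4 \<le> real r0" unfolding r0_def by linarith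
    thus "real r0 * c4 \<ge> 2" using c4 by (simp add: field_simps)
    thus "r0 > 0" using c4 by (cases r0) auto
  qed
  have dpos: "\<delta> > 0" using w_pos u_pos by (simp add: delta_eq)
  have "\<forall>\<^sub>F n in sequentially. ln (real n) \<ge> Cst \<and> ln (real n) ^ c \<le> real n powr (2 * c4) \<and>
      ln (real n) ^ 2 \<le> real n powr \<alpha> \<and> ln (real n) ^ 2 \<le> real n powr \<delta>"
  proof (intro eventually_conj eventually_ln_power_le)
    have "filterlim (\<lambda>n. ln (real n)) at_top sequentially"
      by (rule filterlim_compose[OF ln_at_top filterlim_real_sequentially])
    thus "\<forall>\<^sub>F n in sequentially. Cst \<le> ln (real n)" by (simp add: filterlim_at_top)
  qed (use c4 alpha_pos dpos in auto)
  then obtain N where N: "\<And>n. N \<le> n \<Longrightarrow> ln (real n) \<ge> Cst \<and> ln (real n) ^ c \<le> real n powr (2 * c4) \<and>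
      ln (real n) ^ 2 \<le> real n powr \<alpha> \<and> ln (real n) ^ 2 \<le> real n powr \<delta>"
    unfolding eventually_sequentially by blast
  have "measure (construction_space s t 1 1 n) {\<omega> \<in> space (construction_space s t 1 1 n).
         \<forall>A. A \<subseteq> {1..n} \<and> card A = target_size s t (real c) n \<longrightarrow>
           (\<exists>T. clique_copy s A (construction_graph s t \<kappa> 1 n \<omega>) T)} > 0"
    if nN: "N \<le> n" and core_rule: "core_rule s t \<kappa>" for n \<kappa>
  proof -
    define x where "x = real n"
    define L where "L = ln x"
    have LC: "L \<ge> Cst" and Lc4: "L ^ c \<le> x powr (2 * c4)" and L\<alpha>: "L ^ 2 \<le> x powr \<alpha>" and L\<delta>: "L ^ 2 \<le> x powr \<delta>"
      using N[OF nN] unfolding L_def x_def by auto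
    have LL: "L \<ge> 16" "L \<ge> 9 * 2 ^ (4 * t ^ 3) * exp (real B)" "L \<ge> real s" "L \<ge> 36 * (real r0)\<^sup>2 / \<eta>"
      "L \<ge> 10 / (c4 * \<eta>)" "L \<ge> 512 * \<sigma>" "L \<ge> 384 * \<sigma> * Eb ^ (s\<^sup>2 + 2)"
    proof -
      have "y \<le> L" if "y \<in> CC" for y
      proof -
        have "y \<le> Cst" unfolding Cst_def by (rule Max_ge[OF _ that]) (simp add: CC_def)
        thus ?thesis using LC by linarith
      qed
      thus "L \<ge> 16" "L \<ge> 9 * 2 ^ (4 * t ^ 3) * exp (real B)" "L \<ge> real s" "L \<ge> 36 * (real r0)\<^sup>2 / \<eta>"
        "L \<ge> 10 / (c4 * \<eta>)" "L \<ge> 512 * \<sigma>" "L \<ge> 384 * \<sigma> * Eb ^ (s\<^sup>2 + 2)"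
        by (simp_all add: CC_def)
    qed
    have x1: "x > 1" and x0: "x > 0"
    proof -
      have "x \<noteq> 0" using LL(1) by (auto simp: L_def)
      thus x0: "x > 0" by (simp add: x_def)
      have "ln x > 0" using LL(1) by (simp add: L_def)
      thus "x > 1" using x0 by simp
    qed
    have expL: "exp L = x" using x0 by (simp add: L_def)
    have n1: "1 \<le> n" using x0 by (simp add: x_def)
    define m where "m = num_sets s t 1 n"
    define \<gamma> where "\<gamma> = incl_prob s t 1 n"
    define a where "a = target_size s t (real c) n"
    have m_eq: "m = nat \<lfloor>x powr \<delta> / L\<rfloor>"
      using LL(1) by (simp add: m_def num_sets_def x_def[symmetric] L_def[symmetric] powr_minus divide_inverse)
    have \<gamma>_eq: "\<gamma> = x powr (\<alpha> - 1) / L"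
      using LL(1) by (simp add: \<gamma>_def incl_prob_def x_def[symmetric] L_def[symmetric] powr_minus divide_inverse)
    have a_eq: "a = nat \<lceil>x powr \<alpha> * L ^ c\<rceil>"
      using LL(1) by (simp add: a_def target_size_def x_def[symmetric] L_def[symmetric] powr_realpow)
    have m_le: "real m \<le> x powr \<delta> / L" unfolding m_eq using LL(1) by (intro of_nat_floor) auto
    have xdL: "2 \<le> x powr \<delta> / L"
    proof -
      have "2 * L \<le> L * L" using LL(1) by (intro mult_right_mono) auto
      also have "\<dots> \<le> x powr \<delta>" using L\<delta> by (simp add: power2_eq_square)
      finally show ?thesis using LL(1) by (simp add: field_simps)
    qed
    have m_ge: "x powr \<delta> / (2 * L) \<le> real m"
    proof -
      have "x powr \<delta> / L - 1 \<le> real m" unfolding m_eq by linarith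
      moreover have "x powr \<delta> / (2 * L) = (x powr \<delta> / L) / 2" by simp
      ultimately show ?thesis using xdL by linarith
    qed
    have m1: "1 \<le> m"
    proof -
      have "1 \<le> x powr \<delta> / (2 * L)" using xdL by simp
      hence "1 \<le> real m" using m_ge by linarith
      thus ?thesis by simp
    qed
    have m_le_delta: "real m \<le> x powr \<delta>"
      using m_le LL(1) by (smt (verit) divide_le_eq_1_pos divide_le_eq mult_left_mono powr_ge_zero mult_cancel_left1)
    have xd2: "x powr \<delta> \<le> x ^ 2"
    proof -
      have "x powr \<delta> \<le> x powr 2" using x1 delta_le by (intro powr_mono) auto
      thus ?thesis using x0 by (simp add: powr_numeral)
    qed
    have gam: "0 < \<gamma>" "\<gamma> < 1"
    proof -
      show "0 < \<gamma>" unfolding \<gamma>_eq using x0 LL(1) by simp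
      have "x powr (\<alpha> - 1) \<le> x powr 0" using x1 alpha_less by (intro powr_mono) auto
      hence "x powr (\<alpha> - 1) \<le> 1" using x0 by simp
      hence "\<gamma> \<le> 1 / L" unfolding \<gamma>_eq using LL(1) by (intro divide_right_mono) auto
      also have "\<dots> < 1" using LL(1) by simp
      finally show "\<gamma> < 1" .
    qed
    have Lc1: "L \<le> L ^ c" "L ^ 2 \<le> L ^ c"
    proof -
      have "L ^ 1 \<le> L ^ c" using LL(1) by (intro power_increasing) (auto simp: c_def)
      thus "L \<le> L ^ c" by simp
      show "L ^ 2 \<le> L ^ c" using LL(1) by (intro power_increasing) (auto simp: c_def)
    qed
    have Lc0: "0 \<le> L ^ c" using LL(1) by simp
    have xa1: "1 \<le> x powr \<alpha>" using x1 alpha_pos by (simp add: ge_one_powr_ge_zero)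
    have a_ge: "x powr \<alpha> * L ^ c \<le> real a" unfolding a_eq by linarith
    have base1: "1 \<le> x powr \<alpha> * L ^ c"
      using mult_mono[OF xa1, of 1 "L ^ c"] Lc1(1) LL(1) by simp
    have a_le: "real a \<le> 2 * (x powr \<alpha> * L ^ c)"
    proof -
      have "real a \<le> x powr \<alpha> * L ^ c + 1" unfolding a_eq using base1 by linarith
      thus ?thesis using base1 by linarith
    qed
    have aL: "L ^ c \<le> real a"
      using mult_right_mono[OF xa1 Lc0] a_ge by simp
    have a16: "16 \<le> real a" using aL Lc1(1) LL(1) by linarith
    have a_s: "s \<le> a" using aL Lc1(1) LL(3) by linarith
    define z where "z = x powr c4"
    have z1: "1 \<le> z" using x1 c4 by (simp add: z_def ge_one_powr_ge_zero)
    have zz: "z * z = x powr (2 * c4)" by (simp add: z_def powr_add[symmetric])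
    have small: "\<gamma> * real a * (z * z) \<le> 1"
    proof -
      have "\<gamma> * real a * (z * z) \<le> \<gamma> * (2 * (x powr \<alpha> * L ^ c)) * (z * z)"
        using a_le gam by (intro mult_right_mono mult_left_mono) auto
      also have "\<dots> = 2 / L * L ^ c * (x powr (\<alpha> - 1) * x powr \<alpha> * x powr (2 * c4))"
        unfolding \<gamma>_eq zz by simp
      also have "x powr (\<alpha> - 1) * x powr \<alpha> * x powr (2 * c4) = x powr (- (2 * c4))"
      proof -
        have "\<alpha> - 1 + \<alpha> + 2 * c4 = - (2 * c4)" by (simp add: c4_def field_simps)
        thus ?thesis by (simp only: powr_add[symmetric])
      qed
      also have "2 / L * L ^ c * x powr (- (2 * c4)) \<le> 1 * x powr (2 * c4) * x powr (- (2 * c4))"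
        using LL(1) Lc4 by (intro mult_right_mono mult_mono) auto
      also have "\<dots> = 1" using x0 by (simp add: powr_add[symmetric])
      finally show ?thesis .
    qed
    have ag: "real a * \<gamma> \<le> 1 / 2"
    proof -
      have "2 \<le> z * z" unfolding zz using Lc4 Lc1(1) LL(1) by linarith
      hence "\<gamma> * real a * 2 \<le> \<gamma> * real a * (z * z)" using gam by (intro mult_left_mono) auto
      thus ?thesis using small by (simp add: mult.commute)
    qed
    \<comment> \<open>Lower bound for the probability of a good row: the binomial coefficient is at
      least \<open>(a / s) ^ s\<close>, the labels cost another \<open>s ^ s\<close>, together
      \<sigma>, and \<open>(1 - \<gamma>) ^ a \<ge> 1 / 2\<close>.\<close>
    define p where "p = (real a * \<gamma>) ^ s / (2 * \<sigma>)"
    have p0: "p > 0" using a16 gam \<sigma> by (simp add: p_def)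
    have p_le: "p \<le> real (a choose s) * (\<gamma> / s) ^ s * (1 - \<gamma>) ^ a"
    proof -
      have "1 + real a * (- \<gamma>) \<le> (1 + (- \<gamma>)) ^ a" using gam by (intro Bernoulli_inequality) auto
      hence half: "1 / 2 \<le> (1 - \<gamma>) ^ a" using ag by simp
      have "p = (real a / real s) ^ s * (\<gamma> / s) ^ s * (1 / 2)"
      proof -
        have "(real a / real s) ^ s * (\<gamma> / s) ^ s = (real a * \<gamma> / (real s)\<^sup>2) ^ s"
          by (simp add: power_mult_distrib[symmetric] power2_eq_square)
        also have "\<dots> = (real a * \<gamma>) ^ s / \<sigma>"
          unfolding \<sigma>_def power_mult by (rule power_divide)
        finally show ?thesis by (simp add: p_def)
      qed
      also have "\<dots> \<le> real (a choose s) * (\<gamma> / s) ^ s * (1 - \<gamma>) ^ a"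
        using half gam binomial_ge_n_over_k_pow_k[OF a_s, where 'a = real] by (intro mult_mono) auto
      finally show ?thesis .
    qed
    have mp: "real a * L ^ c / (8 * \<sigma>) \<le> real m * p"
    proof -
      have ag_ge: "x powr (2 * \<alpha> - 1) * L ^ (c - 1) \<le> real a * \<gamma>"
      proof -
        have "x powr (2 * \<alpha> - 1) * L ^ (c - 1) = (x powr \<alpha> * L ^ c) * \<gamma>"
        proof -
          have "L ^ c = L ^ (c - 1) * L" by (metis c_def add_gr_0 mult.commute power_minus_mult zero_less_numeral)
          moreover have "x powr (2 * \<alpha> - 1) = x powr \<alpha> * x powr (\<alpha> - 1)"
            by (simp add: powr_add[symmetric])
          ultimately show ?thesis unfolding \<gamma>_eq using LL(1) by simp
        qed
        also have "\<dots> \<le> real a * \<gamma>" using a_ge gam by (intro mult_right_mono) auto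
        finally show ?thesis .
      qed
      have e: "L * (L ^ c * L ^ c) \<le> (L ^ (c - 1)) ^ s"
      proof -
        have "1 + 2 * c \<le> (c - 1) * 3" by (simp add: c_def)
        also have "\<dots> \<le> (c - 1) * s" using s3 by (intro mult_left_mono) auto
        finally have "L ^ (1 + 2 * c) \<le> L ^ ((c - 1) * s)" using LL(1) by (intro power_increasing) auto
        thus ?thesis by (simp add: power_mult power_add mult_2)
      qed
      have "real a * L ^ c / (8 * \<sigma>) \<le> 2 * (x powr \<alpha> * L ^ c) * L ^ c / (8 * \<sigma>)"
        using a_le LL(1) \<sigma> by (intro divide_right_mono mult_right_mono) auto
      also have "\<dots> = x powr \<alpha> * (L ^ c * L ^ c) / (4 * \<sigma>)" by (simp add: field_simps)
      also have "\<dots> = x powr \<alpha> / L * (L * (L ^ c * L ^ c)) / (4 * \<sigma>)" using LL(1) by simp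
      also have "\<dots> \<le> x powr \<alpha> / L * (L ^ (c - 1)) ^ s / (4 * \<sigma>)"
        using e LL(1) \<sigma> by (intro divide_right_mono mult_left_mono) auto
      also have "\<dots> = x powr \<delta> / (2 * L) * ((x powr (2 * \<alpha> - 1) * L ^ (c - 1)) ^ s / (2 * \<sigma>))"
      proof -
        \<comment> \<open>This is the equation that defines \<delta>, in the form \<delta> +
          s(2\<alpha> - 1) = \<alpha>.\<close>
        have "x powr \<alpha> = x powr \<delta> * (x powr (2 * \<alpha> - 1)) ^ s"
        proof -
          have "(x powr (2 * \<alpha> - 1)) ^ s = x powr (real s * (2 * \<alpha> - 1))"
            using x0 by (simp add: powr_realpow[symmetric] powr_powr mult.commute)
          moreover have "\<delta> + real s * (2 * \<alpha> - 1) = \<alpha>" by (simp add: delta_def algebra_simps)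
          ultimately show ?thesis by (simp add: powr_add[symmetric])
        qed
        thus ?thesis by (simp add: power_mult_distrib)
      qed
      also have "\<dots> \<le> real m * ((real a * \<gamma>) ^ s / (2 * \<sigma>))"
      proof (rule mult_mono[OF m_ge])
        show "(x powr (2 * \<alpha> - 1) * L ^ (c - 1)) ^ s / (2 * \<sigma>) \<le> (real a * \<gamma>) ^ s / (2 * \<sigma>)"
          using ag_ge LL(1) \<sigma> by (intro divide_right_mono power_mono) auto
        show "0 \<le> (x powr (2 * \<alpha> - 1) * L ^ (c - 1)) ^ s / (2 * \<sigma>)" using LL(1) \<sigma> by simp
      qed simp
      finally show ?thesis by (simp add: p_def)
    qed
    have mp2: "64 * (real a * L) \<le> real m * p"
    proof -
      have "512 * \<sigma> * L \<le> L * L" using LL(1,6) by (intro mult_right_mono) auto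
      also have "\<dots> \<le> L ^ c" using Lc1(2) by (simp add: power2_eq_square)
      finally have "512 * \<sigma> * L * real a \<le> L ^ c * real a" by (intro mult_right_mono) auto
      hence "64 * (real a * L) \<le> real a * L ^ c / (8 * \<sigma>)" using \<sigma> by (simp add: field_simps)
      thus ?thesis using mp by linarith
    qed
    have aL16: "256 \<le> real a * L" using mult_mono[of 16 "real a" 16 L] a16 LL(1) by simp
    \<comment> \<open>The fraction 1/16 leaves \<open>m * p / 4 - 2 * k \<ge> m * p / 8\<close>
      clean rows.\<close>
    define k where "k = nat \<lfloor>real m * p / 16\<rfloor>"
    have k_le: "real k \<le> real m * p / 16" unfolding k_def using p0 by (intro of_nat_floor) auto
    have k_ge: "real m * p / 32 \<le> real k"
    proof -
      have "real m * p / 16 - 1 \<le> real k" unfolding k_def by linarith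
      thus ?thesis using mp2 aL16 by linarith
    qed
    have k2aL: "2 * (real a * L) \<le> real k" using k_ge mp2 by linarith
    have k0: "k > 0" using k2aL aL16 by linarith
    \<comment> \<open>The bound \<open>h\<close> on covered pairs is shared equally: at most
      \<open>h / 2\<close> for the small rows through \<open>k2\<close>, and
      \<open>h / 2 = \<rho> * W\<close> for the large ones.\<close>
    define h where "h = \<eta> * (real a)\<^sup>2"
    define k2 where "k2 = nat \<lfloor>h / (2 * (real r0)\<^sup>2)\<rfloor>"
    \<comment> \<open>This is \<open>L\<close> times the expected size \<open>\<gamma> * n\<close>
      of a random set.\<close>
    define \<rho> where "\<rho> = x powr \<alpha>"
    define W where "W = h / (2 * \<rho>)"
    have h0: "h > 0" using \<eta> a16 by (simp add: h_def)
    have r02: "(real r0)\<^sup>2 > 0" using r0 by simp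
    have k2_le: "real k2 \<le> h / (2 * (real r0)\<^sup>2)" unfolding k2_def using h0 by (intro of_nat_floor) auto
    have big_h: "4 * (real a * L) \<le> h / (2 * (real r0)\<^sup>2)"
    proof -
      have "36 * (real r0)\<^sup>2 * L \<le> \<eta> * L * L" using LL(1,4) \<eta> by (intro mult_right_mono) (auto simp: field_simps)
      also have "\<dots> \<le> \<eta> * real a" using aL Lc1(2) \<eta> by (simp add: power2_eq_square mult.assoc)
      finally have "36 * (real r0)\<^sup>2 * L * real a \<le> \<eta> * real a * real a" by (intro mult_right_mono) auto
      moreover have "0 \<le> (real r0)\<^sup>2 * L * real a" using LL(1) by (intro mult_nonneg_nonneg) auto
      ultimately have "8 * (real r0)\<^sup>2 * (real a * L) \<le> h" unfolding h_def by (simp add: power2_eq_square algebra_simps)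
      thus ?thesis using r02 by (simp add: pos_le_divide_eq algebra_simps)
    qed
    have k2_ge: "h / (4 * (real r0)\<^sup>2) \<le> real k2"
    proof -
      have "h / (2 * (real r0)\<^sup>2) - 1 \<le> real k2" unfolding k2_def by linarith
      moreover have "h / (4 * (real r0)\<^sup>2) = h / (2 * (real r0)\<^sup>2) / 2" by simp
      ultimately show ?thesis using big_h aL16 by linarith
    qed
    have k22aL: "2 * (real a * L) \<le> real k2"
    proof -
      have "h / (4 * (real r0)\<^sup>2) = h / (2 * (real r0)\<^sup>2) / 2" by simp
      thus ?thesis using k2_ge big_h by linarith
    qed
    have k20: "k2 > 0" using k22aL aL16 by linarith
    have \<rho>0: "\<rho> > 0" using x0 by (simp add: \<rho>_def)
    have h_split: "real r0 ^ 2 * real k2 + \<rho> * W \<le> h"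
    proof -
      have "real r0 ^ 2 * real k2 \<le> h / 2"
        using mult_left_mono[OF k2_le, of "(real r0)\<^sup>2"] r02 by simp
      moreover have "\<rho> * W = h / 2" using \<rho>0 by (simp add: W_def)
      ultimately show ?thesis by linarith
    qed
    define K where "K = nat \<lceil>L\<rceil>"
    have K: "L \<le> real K" "real K \<le> 2 * L" unfolding K_def using LL(1) by linarith+
    have K2: "2 \<le> K" using K(1) LL(1) by linarith
    \<comment> \<open>That is n^(-2a), to be compared with the at most n^a sets
      \<open>A\<close>.\<close>
    define \<epsilon> where "\<epsilon> = exp (- (2 * (real a * L)))"
    have inv_e: "1 / 3 \<le> exp (-1 :: real)"
      using exp_le by (simp add: exp_minus field_simps)
    obtain f :: "nat \<Rightarrow> nat \<Rightarrow> nat" where f: "\<And>i v. f i v \<le> s"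
      "\<not> crowded n m K {(i, v). i \<in> {1..m} \<and> v \<in> {1..n} \<and> f i v \<noteq> 0}"
      "\<And>A. A \<subseteq> {1..n} \<Longrightarrow> card A = a \<Longrightarrow> real m * p / 4 - 2 * real k \<le> real (card (clean_rows s {1..m} A f))"
    proof (rule rows_exist[of n m \<gamma> L k k2 p a z z r0 \<rho> W h K \<epsilon>])
      show "\<gamma> \<le> real n powr (\<alpha> - 1) / L" by (simp add: \<gamma>_eq x_def)
      show "real m \<le> real n powr \<delta>" using m_le_delta by (simp add: x_def)
      show "1 \<le> L" using LL(1) by simp
      show "0 \<le> W" using h0 \<rho>0 by (simp add: W_def)
      show "exp (- real m * p / 4) \<le> \<epsilon>" unfolding \<epsilon>_def using mp2 aL16 by simp
      show "(exp 1 * real m * (real a * \<gamma>)\<^sup>2 / real k2) ^ k2 \<le> \<epsilon>"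
      proof -
        have mg: "real m * \<gamma>\<^sup>2 \<le> 1 / L"
        proof -
          have "real m * \<gamma>\<^sup>2 \<le> x powr \<delta> * \<gamma>\<^sup>2" using m_le_delta by (intro mult_right_mono) auto
          also have "\<dots> = x powr \<delta> * x powr (\<alpha> - 1) * x powr (\<alpha> - 1) / L\<^sup>2"
            unfolding \<gamma>_eq by (simp add: power2_eq_square)
          also have "x powr \<delta> * x powr (\<alpha> - 1) * x powr (\<alpha> - 1) = x powr (- w)"
          proof -
            \<comment> \<open>The expected number of random sets through a given pair is of order
              n^(-w) up to logarithms; here the sign of \<open>w\<close> is used.\<close>
            have "\<delta> + (\<alpha> - 1) + (\<alpha> - 1) = - w" unfolding delta_eq using one_minus_alpha by simp
            thus ?thesis by (simp add: powr_add[symmetric])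
          qed
          also have "x powr (- w) / L\<^sup>2 \<le> 1 / L\<^sup>2"
            using x1 w_pos powr_mono[of "- w" 0 x] by (intro divide_right_mono) auto
          also have "\<dots> \<le> 1 / L" using LL(1) by (intro divide_left_mono) (auto simp: power2_eq_square)
          finally show ?thesis .
        qed
        have "exp 1 * real m * (real a * \<gamma>)\<^sup>2 / real k2 \<le> 3 * real m * (real a * \<gamma>)\<^sup>2 / (h / (4 * (real r0)\<^sup>2))"
          using exp_le k2_ge k20 h0 r02 by (intro frac_le mult_right_mono) auto
        also have "\<dots> = 12 * (real r0)\<^sup>2 / \<eta> * (real m * \<gamma>\<^sup>2)"
          using a16 \<eta> by (simp add: h_def power_mult_distrib field_simps)
        also have "\<dots> \<le> 12 * (real r0)\<^sup>2 / \<eta> * (1 / L)" using mg \<eta> by (intro mult_left_mono) auto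
        also have "\<dots> \<le> 1 / 3" using LL(1,4) \<eta> by (simp add: field_simps)
        also have "\<dots> \<le> exp (-1)" by (rule inv_e)
        finally have "(exp 1 * real m * (real a * \<gamma>)\<^sup>2 / real k2) ^ k2 \<le> exp (-1) ^ k2"
          by (intro power_mono) auto
        also have "\<dots> = exp (- real k2)" by (simp add: exp_of_nat_mult[symmetric])
        also have "\<dots> \<le> \<epsilon>" unfolding \<epsilon>_def using k22aL by simp
        finally show ?thesis .
      qed
      show "(1 + 3 / z ^ r0) ^ m / z powr W \<le> \<epsilon>"
      proof -
        have "x ^ 2 \<le> z ^ r0"
        proof -
          have "x powr 2 \<le> x powr (c4 * real r0)" using x1 r0 by (intro powr_mono) (auto simp: mult.commute)
          also have "\<dots> = z powr real r0" by (simp add: z_def powr_powr)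
          also have "\<dots> = z ^ r0" using z1 by (intro powr_realpow) simp
          finally show ?thesis using x0 by (simp add: powr_numeral)
        qed
        hence mz: "real m \<le> z ^ r0" using m_le_delta xd2 by linarith
        have "(1 + 3 / z ^ r0) ^ m \<le> exp (3 / z ^ r0) ^ m"
          using z1 by (intro power_mono exp_ge_add_one_self) auto
        also have "\<dots> = exp (real m * (3 / z ^ r0))" by (simp add: exp_of_nat_mult[symmetric])
        also have "\<dots> \<le> exp 3" using mz z1 by (simp add: field_simps)
        finally have 1: "(1 + 3 / z ^ r0) ^ m \<le> exp 3" .
        have "z powr W = exp (c4 * W * L)" using x0 by (simp add: z_def powr_powr powr_def L_def[symmetric])
        moreover have "5 * (real a * L) \<le> c4 * W * L"
        proof -
          have "10 \<le> c4 * \<eta> * L" using LL(5) c4 \<eta> by (simp add: field_simps)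
          also have "\<dots> \<le> c4 * \<eta> * L ^ c" using Lc1(1) c4 \<eta> by (intro mult_left_mono) auto
          also have "\<dots> \<le> c4 * \<eta> * (real a / x powr \<alpha>)"
            using a_ge x0 c4 \<eta> by (intro mult_left_mono) (auto simp: pos_le_divide_eq mult.commute)
          finally have "10 * (real a * L) \<le> c4 * \<eta> * (real a / x powr \<alpha>) * (real a * L)"
            using LL(1) by (intro mult_right_mono) auto
          also have "\<dots> = 2 * (c4 * W * L)" by (simp add: W_def \<rho>_def h_def power2_eq_square)
          finally show ?thesis by (simp add: mult_ac)
        qed
        ultimately have 2: "exp (5 * (real a * L)) \<le> z powr W" by simp
        have "(1 + 3 / z ^ r0) ^ m / z powr W \<le> exp 3 / exp (5 * (real a * L))"
          using 1 2 by (intro frac_le) auto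
        also have "\<dots> = exp (3 - 5 * (real a * L))" by (simp add: exp_diff)
        also have "\<dots> \<le> \<epsilon>" unfolding \<epsilon>_def exp_le_cancel_iff using aL16 by linarith
        finally show ?thesis .
      qed
      show "(exp 1 * real m * (h * real a ^ (s - 2) * \<gamma> ^ s) / real k) ^ k \<le> \<epsilon>"
      proof -
        have as: "(real a)\<^sup>2 * real a ^ (s - 2) = real a ^ s"
        proof -
          have "2 + (s - 2) = s" using s3 by simp
          thus ?thesis by (metis power_add)
        qed
        have "h * real a ^ (s - 2) * \<gamma> ^ s = \<eta> * (real a * \<gamma>) ^ s"
          unfolding h_def power_mult_distrib as[symmetric] by simp
        also have "\<dots> = \<eta> * (2 * \<sigma>) * p" using \<sigma> by (simp add: p_def)
        also have "\<dots> = p / 288" using \<sigma> by (simp add: \<eta>_def)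
        finally have e: "h * real a ^ (s - 2) * \<gamma> ^ s = p / 288" .
        have "exp 1 * real m * (h * real a ^ (s - 2) * \<gamma> ^ s) / real k = exp 1 * (real m * (p / 288)) / real k"
          unfolding e by simp
        also have "\<dots> \<le> 3 * (real m * (p / 288)) / (real m * p / 32)"
          using exp_le k_ge p0 m1 k0 by (intro frac_le mult_right_mono) auto
        also have "\<dots> = 1 / 3" using p0 m1 by simp
        also have "\<dots> \<le> exp (-1)" by (rule inv_e)
        finally have "(exp 1 * real m * (h * real a ^ (s - 2) * \<gamma> ^ s) / real k) ^ k \<le> exp (-1) ^ k"
          using h0 gam by (intro power_mono) auto
        also have "\<dots> = exp (- real k)" by (simp add: exp_of_nat_mult[symmetric])
        also have "\<dots> \<le> \<epsilon>" unfolding \<epsilon>_def using k2aL by simp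
        finally show ?thesis .
      qed
      show "real n ^ a * (5 * \<epsilon>) < 1 / 3"
      proof -
        have "real n ^ a = exp (real a * L)" using expL by (simp add: x_def exp_of_nat_mult)
        hence "real n ^ a * (5 * \<epsilon>) = 5 * exp (- (real a * L))" by (simp add: \<epsilon>_def exp_add[symmetric])
        moreover have "exp (- (real a * L)) < 1 / 15"
        proof -
          have "1 + real a * L \<le> exp (real a * L)" by (rule exp_ge_add_one_self)
          hence "15 < exp (real a * L)" using aL16 by linarith
          thus ?thesis by (simp add: exp_minus field_simps)
        qed
        ultimately show ?thesis by linarith
      qed
      show "real m * (exp (\<gamma> * real n) / 2 powr \<rho>) < 1 / 3"
      proof -
        have gn: "\<gamma> * real n = \<rho> / L"
        proof -
          have "x powr (\<alpha> - 1) * x = x powr \<alpha>" using x0 by (simp add: powr_diff)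
          thus ?thesis unfolding \<gamma>_eq \<rho>_def x_def[symmetric] by simp
        qed
        have ln2: "1 / 2 \<le> ln (2::real)"
          using exp_half_le2 ln_ge_iff[of 2 "1 / 2"] by (simp only: zero_less_numeral)
        have "exp (\<rho> / 2) \<le> exp (\<rho> * ln 2)" using ln2 \<rho>0 by simp
        hence p2: "exp (\<rho> / 2) \<le> 2 powr \<rho>" by (simp add: powr_def)
        have "exp (\<gamma> * real n) / 2 powr \<rho> \<le> exp (\<rho> / 4) / exp (\<rho> / 2)"
          unfolding gn using p2 LL(1) \<rho>0 by (intro frac_le) (auto simp: field_simps)
        also have "\<dots> = exp (- (\<rho> / 4))" by (simp add: exp_diff[symmetric])
        also have "\<dots> \<le> exp (- (4 * L))"
        proof -
          have "16 * L \<le> L ^ 2" using LL(1) by (simp add: power2_eq_square)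
          thus ?thesis using L\<alpha> by (simp add: \<rho>_def)
        qed
        also have "\<dots> = 1 / x ^ 4"
          using expL exp_of_nat_mult[of 4 L] by (simp add: exp_minus divide_inverse)
        finally have "real m * (exp (\<gamma> * real n) / 2 powr \<rho>) \<le> x ^ 2 * (1 / x ^ 4)"
          using m_le_delta xd2 by (intro mult_mono) auto
        also have "\<dots> = 1 / x ^ 2" using x0 by (simp add: power2_eq_square power4_eq_xxxx)
        also have "\<dots> < 1 / 3"
        proof -
          have "17 \<le> x" using exp_ge_add_one_self[of L] LL(1) unfolding expL by linarith
          hence "17 * 17 \<le> x * x" by (intro mult_mono) auto
          thus ?thesis by (simp add: power2_eq_square field_simps)
        qed
        finally show ?thesis .
      qed
      show "real ((n + 1) ^ t * (m + 1) ^ t\<^sup>2) * (9 * 2 ^ (4 * t ^ 3) / L) ^ K < 1 / 3"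
      proof -
        have x17: "17 \<le> x" using exp_ge_add_one_self[of L] LL(1) unfolding expL by linarith
        have "real (n + 1) \<le> x ^ 2"
        proof -
          have "x + 1 \<le> x * 2" using x17 by simp
          also have "\<dots> \<le> x * x" using x17 by (intro mult_left_mono) auto
          finally show ?thesis by (simp add: x_def power2_eq_square)
        qed
        moreover have "real (m + 1) \<le> x ^ 3"
        proof -
          have "real (m + 1) \<le> x ^ 2 + 1" using m_le_delta xd2 by simp
          also have "\<dots> \<le> x ^ 2 * 2" using x17 one_le_power[of x 2] by simp
          also have "\<dots> \<le> x ^ 2 * x" using x17 by (intro mult_left_mono) auto
          finally show ?thesis by (simp add: power2_eq_square power3_eq_cube)
        qed
        ultimately have "real (n + 1) ^ t * real (m + 1) ^ t\<^sup>2 \<le> (x ^ 2) ^ t * (x ^ 3) ^ t\<^sup>2"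
          using x0 by (intro mult_mono power_mono) auto
        also have "\<dots> = x ^ (2 * t + 3 * t\<^sup>2)" by (simp add: power_add power_mult)
        finally have 1: "real ((n + 1) ^ t * (m + 1) ^ t\<^sup>2) \<le> x ^ (2 * t + 3 * t\<^sup>2)" by simp
        have "9 * 2 ^ (4 * t ^ 3) / L \<le> exp (- real B)"
          using LL(1,2) by (simp add: exp_minus field_simps)
        hence "(9 * 2 ^ (4 * t ^ 3) / L) ^ K \<le> exp (- real B) ^ K"
          using LL(1) by (intro power_mono) auto
        also have "\<dots> = exp (- (real B * real K))" by (simp add: exp_of_nat_mult[symmetric] mult.commute)
        also have "\<dots> \<le> exp (- (real B * L))" using K(1) by (simp add: mult_left_mono)
        also have "\<dots> = 1 / x ^ B"
          using expL by (simp add: exp_minus exp_of_nat_mult divide_inverse)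
        finally have 2: "(9 * 2 ^ (4 * t ^ 3) / L) ^ K \<le> 1 / x ^ B" .
        have "real ((n + 1) ^ t * (m + 1) ^ t\<^sup>2) * (9 * 2 ^ (4 * t ^ 3) / L) ^ K \<le> x ^ (2 * t + 3 * t\<^sup>2) * (1 / x ^ B)"
          using 1 2 LL(1) x0 by (intro mult_mono) auto
        also have "\<dots> = 1 / x ^ 2" using x0 by (simp add: B_def power_add power2_eq_square)
        also have "\<dots> < 1 / 3"
        proof -
          have "17 * 17 \<le> x * x" using x17 by (intro mult_mono) auto
          thus ?thesis by (simp add: power2_eq_square field_simps)
        qed
        finally show ?thesis .
      qed
    qed (use n1 m1 gam k0 k20 p0 p_le z1 small h_split \<rho>0 in \<open>auto simp: less_imp_le\<close>)
    define D where "D = (K * (t + t\<^sup>2) + 1) ^ (t + t\<^sup>2)"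
    define c' where "c' = s\<^sup>2 * (D * t\<^sup>2)"
    \<comment> \<open>For this density \<open>(1 - pe) ^ c' \<ge> 1 / 2\<close> by Bernoulli's
      inequality, so the success probability \<open>X\<close> is at least a negative power of the
      logarithm.\<close>
    define pe where "pe = 1 / (2 * real c')"
    define X where "X = pe ^ s\<^sup>2 * (1 - pe) ^ c'"
    \<comment> \<open>Then \<open>(1 - X) ^ r \<le> exp (- (2 * (a * L)))\<close>, which beats the
      number of sets \<open>A\<close>, at most \<open>exp (a * L)\<close>.\<close>
    define r where "r = nat \<lceil>2 * (real a * L) / X\<rceil>"
    have D1: "D \<ge> 1" by (simp add: D_def)
    have D_le: "real D \<le> d * L ^ \<tau>"
    proof -
      have "real (K * \<tau> + 1) \<le> 2 * L * real \<tau> + 1" using K(2) by (simp add: mult_right_mono)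
      also have "\<dots> \<le> 2 * L * real \<tau> + L * real \<tau>"
        using mult_mono[of 1 L 1 "real \<tau>"] LL(1) \<tau> by simp
      also have "\<dots> = real (3 * \<tau>) * L" by simp
      finally have "real (K * \<tau> + 1) ^ \<tau> \<le> (real (3 * \<tau>) * L) ^ \<tau>" by (intro power_mono) auto
      thus ?thesis by (simp add: D_def d_def \<tau>_def power_mult_distrib)
    qed
    have c'1: "real c' \<ge> 1"
    proof -
      have "c' \<noteq> 0" using D1 s3 st by (simp add: c'_def)
      thus ?thesis by simp
    qed
    have pe: "0 < pe" "pe < 1" using c'1 by (auto simp: pe_def)
    have X_ge: "1 / (2 * (2 * real c') ^ s\<^sup>2) \<le> X"
    proof -
      have "1 + real c' * (- pe) \<le> (1 + (- pe)) ^ c'" using pe by (intro Bernoulli_inequality) auto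
      moreover have "real c' * pe = 1 / 2" using c'1 by (simp add: pe_def)
      ultimately have "1 / 2 \<le> (1 - pe) ^ c'" by simp
      hence "pe ^ s\<^sup>2 * (1 / 2) \<le> X" unfolding X_def using pe by (intro mult_left_mono) auto
      thus ?thesis by (simp add: pe_def power_one_over)
    qed
    have X01: "0 < X" "X \<le> 1"
      unfolding X_def using pe by (auto intro!: mult_le_one power_le_one)
    have r_ge: "2 * (real a * L) / X \<le> real r" unfolding r_def by linarith
    have many: "r * ((s\<^sup>2 + s\<^sup>2 * (D * t\<^sup>2)) * (1 + D * t\<^sup>2)) \<le> card (clean_rows s {1..m} A f)"
      if A: "A \<subseteq> {1..n}" "card A = a" for A
    proof -
      have EbL: "2 * real c' \<le> Eb * L ^ \<tau>" "real (s\<^sup>2 + c') \<le> Eb * L ^ \<tau>" "real (1 + D * t\<^sup>2) \<le> Eb * L ^ \<tau>"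
      proof -
        have "2 * real c' = 2 * real (s\<^sup>2) * real (t\<^sup>2) * real D" by (simp add: c'_def)
        also have "\<dots> \<le> 2 * real (s\<^sup>2) * real (t\<^sup>2) * (d * L ^ \<tau>)" using D_le by (intro mult_left_mono) auto
        finally show 1: "2 * real c' \<le> Eb * L ^ \<tau>" by (simp add: Eb_def)
        have Dt: "1 \<le> D * t\<^sup>2" using D1 s3 st by (simp add: Suc_le_eq)
        have "s\<^sup>2 * 1 \<le> s\<^sup>2 * (D * t\<^sup>2)" using Dt by (rule mult_le_mono2)
        hence "s\<^sup>2 + c' \<le> 2 * c'" by (simp add: c'_def)
        hence "real (s\<^sup>2 + c') \<le> real (2 * c')" by (rule of_nat_mono)
        thus "real (s\<^sup>2 + c') \<le> Eb * L ^ \<tau>" using 1 unfolding of_nat_mult of_nat_numeral by (rule order_trans)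
        have "1 * (D * t\<^sup>2) \<le> s\<^sup>2 * (D * t\<^sup>2)" using s3 by (intro mult_le_mono1) (simp add: Suc_le_eq)
        hence "1 + D * t\<^sup>2 \<le> 2 * c'" using Dt unfolding c'_def by linarith
        hence "real (1 + D * t\<^sup>2) \<le> real (2 * c')" by (rule of_nat_mono)
        thus "real (1 + D * t\<^sup>2) \<le> Eb * L ^ \<tau>" using 1 unfolding of_nat_mult of_nat_numeral by linarith
      qed
      have Eb0: "Eb * L ^ \<tau> \<ge> 0" using EbL(3) by (rule order_trans[rotated]) simp
      have X2: "2 * (real a * L) \<le> 2 * (real a * L) / X"
        using X01 aL16 by (simp add: pos_le_divide_eq mult_left_le)
      have "real r \<le> 2 * (real a * L) / X + 1" unfolding r_def using X2 aL16 by linarith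
      also have "\<dots> \<le> 3 * (real a * L) / X"
      proof -
        define Z where "Z = real a * L / X"
        have "1 \<le> Z" using X2 aL16 by (simp add: Z_def)
        hence "2 * Z + 1 \<le> 3 * Z" by simp
        thus ?thesis by (simp add: Z_def)
      qed
      also have "\<dots> \<le> 3 * (real a * L) / (1 / (2 * (2 * real c') ^ s\<^sup>2))"
        using X_ge X01 c'1 aL16 by (intro divide_left_mono) auto
      also have "\<dots> = 6 * (real a * L) * (2 * real c') ^ s\<^sup>2" by simp
      also have "\<dots> \<le> 6 * (real a * L) * (Eb * L ^ \<tau>) ^ s\<^sup>2"
        using EbL(1) aL16 by (intro mult_left_mono power_mono) auto
      finally have r_le: "real r \<le> 6 * (real a * L) * (Eb * L ^ \<tau>) ^ s\<^sup>2" .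
      have "real (r * ((s\<^sup>2 + c') * (1 + D * t\<^sup>2))) = real r * (real (s\<^sup>2 + c') * real (1 + D * t\<^sup>2))"
        by (simp only: of_nat_mult)
      also have "\<dots> \<le> 6 * (real a * L) * (Eb * L ^ \<tau>) ^ s\<^sup>2 * ((Eb * L ^ \<tau>) * (Eb * L ^ \<tau>))"
        by (rule mult_mono[OF r_le mult_mono[OF EbL(2,3) Eb0] order_trans[OF _ r_le]]) simp_all
      also have "\<dots> = 6 * (real a * L) * (Eb * L ^ \<tau>) ^ (s\<^sup>2 + 2)"
        by (simp add: power_add power2_eq_square)
      also have "\<dots> = 6 * real a * L * Eb ^ (s\<^sup>2 + 2) * L ^ (\<tau> * (s\<^sup>2 + 2))"
        unfolding power_mult_distrib power_mult by (simp only: mult.assoc)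
      also have "\<dots> \<le> real a * L ^ c / (64 * \<sigma>)"
      proof -
        have "384 * \<sigma> * Eb ^ (s\<^sup>2 + 2) * (L * L ^ (\<tau> * (s\<^sup>2 + 2))) \<le> L * (L * L ^ (\<tau> * (s\<^sup>2 + 2)))"
          using LL(1,7) by (intro mult_right_mono) auto
        also have "\<dots> = L ^ (\<tau> * (s\<^sup>2 + 2) + 2)" by (simp add: power_add power2_eq_square)
        also have "\<dots> \<le> L ^ c" using LL(1) by (intro power_increasing) (auto simp: c_def)
        finally have "real a * (384 * \<sigma> * Eb ^ (s\<^sup>2 + 2) * (L * L ^ (\<tau> * (s\<^sup>2 + 2)))) \<le> real a * L ^ c"
          by (intro mult_left_mono) auto
        thus ?thesis using \<sigma> by (simp add: pos_le_divide_eq mult_ac)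
      qed
      also have "\<dots> \<le> real m * p / 8" using mp by simp
      also have "\<dots> \<le> real m * p / 4 - 2 * real k" using k_le by linarith
      also have "\<dots> \<le> real (card (clean_rows s {1..m} A f))" by (rule f(3)[OF A])
      finally show ?thesis unfolding c'_def of_nat_le_iff .
    qed
    have small_prob: "real (n choose a) * (1 - pe ^ (s\<^sup>2) * (1 - pe) ^ (s\<^sup>2 * (D * t\<^sup>2))) ^ r < 1"
    proof -
      have "(1 - X) ^ r \<le> exp (- X) ^ r"
        using X01 exp_ge_add_one_self[of "- X"] by (intro power_mono) auto
      also have "\<dots> = exp (- (real r * X))" by (simp add: exp_of_nat_mult[symmetric])
      also have "\<dots> \<le> exp (- (2 * (real a * L)))" using r_ge X01 by (simp add: pos_divide_le_eq)
      finally have 1: "(1 - X) ^ r \<le> exp (- (2 * (real a * L)))" .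
      have "real (n choose a) \<le> real ((n choose a) * fact a)" by (intro of_nat_mono) simp
      also have "\<dots> \<le> real (n ^ a)" by (intro of_nat_mono binomial_fact_pow)
      also have "\<dots> = exp (real a * L)" using expL by (simp add: x_def exp_of_nat_mult)
      finally have "real (n choose a) * (1 - X) ^ r \<le> exp (real a * L) * exp (- (2 * (real a * L)))"
        using 1 X01 by (intro mult_mono) auto
      also have "\<dots> = exp (- (real a * L))" by (simp add: exp_add[symmetric])
      also have "\<dots> < 1" using aL16 by simp
      finally show ?thesis unfolding X_def c'_def .
    qed
    show ?thesis
      unfolding m_def[symmetric] \<gamma>_def[symmetric] a_def[symmetric]
      by (rule positive_from_rows[OF core_rule gam f(1,2) K2 D_def many pe small_prob])
  qed
  thus ?thesis by (intro that[of c N]) (auto simp: c_def)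
qed

end

theorem theorem2p3:
  fixes s t :: nat
  assumes "3 \<le> s" and "s + 2 \<le> t" and "t \<le> 2 * s - 1"
  shows "(\<exists>c1 > 0. \<exists>c2 > 0. \<exists>c3 > 0. \<exists>N. \<forall>n \<ge> N. \<forall>\<kappa>. core_rule s t \<kappa> \<longrightarrow>
            measure (construction_space s t c1 c2 n)
              {\<omega> \<in> space (construction_space s t c1 c2 n).
                 \<forall>A. A \<subseteq> {1..n} \<and> card A = target_size s t c3 n \<longrightarrow>
                   (\<exists>K. clique_copy s A (construction_graph s t \<kappa> c1 n \<omega>) K)} > 0)
       \<and> (\<forall>c1 > 0. \<forall>c2 > 0. \<forall>n. \<forall>\<kappa>. core_rule s t \<kappa> \<longrightarrow>
            (\<forall>\<omega> \<in> space (construction_space s t c1 c2 n).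
               \<nexists>X. clique_copy t {1..n} (construction_graph s t \<kappa> c1 n \<omega>) X))"
proof -
  interpret exponents s t using assms by unfold_locales
  obtain c3 N :: nat where c3: "c3 > 0" and N:
    "\<And>n \<kappa>. N \<le> n \<Longrightarrow> core_rule s t \<kappa> \<Longrightarrow>
       measure (construction_space s t 1 1 n) {\<omega> \<in> space (construction_space s t 1 1 n).
         \<forall>A. A \<subseteq> {1..n} \<and> card A = target_size s t (real c3) n \<longrightarrow>
           (\<exists>T. clique_copy s A (construction_graph s t \<kappa> 1 n \<omega>) T)} > 0"
    by (rule positive_for_large_n) (rule that, assumption+)
  have "\<exists>N. \<forall>n \<ge> N. \<forall>\<kappa>. core_rule s t \<kappa> \<longrightarrow>
       measure (construction_space s t 1 1 n) {\<omega> \<in> space (construction_space s t 1 1 n).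
         \<forall>A. A \<subseteq> {1..n} \<and> card A = target_size s t (real c3) n \<longrightarrow>
           (\<exists>T. clique_copy s A (construction_graph s t \<kappa> 1 n \<omega>) T)} > 0" using N by blast
  moreover have "(0::real) < 1" "0 < real c3" using c3 by simp_all
  ultimately show ?thesis using random_graph_clique_free by blast
qed

end
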